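(* Let $\widehat T_{y}$, $y\ge1$, be the random fragmentation tree with ratio $y=x_0/x_1$ (initial mass over threshold) of a non-lattice fragmentation process. Let $\overline{\mathcal T}$ be the random tree constructed by the same fragmentation process started at $x_0=1$ with a random threshold $x_1=U\sim U(0,1)$, where $U$ is independent of the fragmentation. Let $\widehat T_y^{*}$ denote the random fringe tree of $\widehat T_y$. Then, as $y=x_0/x_1\to\infty$: (i) $\widehat T_y^{*}$ converges in distribution to $\overline{\mathcal T}$. (ii) For every finite rooted tree $T$, $$\mathbb P\bigl(\widehat T_y^{*}\approx T\mid \widehat T_y\bigr)=\frac{n_T(\widehat T_y)}{|\widehat T_y|}\longrightarrow \mathbb P(\overline{\mathcal T}\approx T)\quad\text{almost surely},$$ and, more generally, for every property $\mathcal P$ of a node $v$ that depends only on the subtree consisting of $v$ and its descendants, $$\mathbb P\bigl(\widehat T_y^{*}\in\mathcal P\mid \widehat T_y\bigr)=\frac{n_{\mathcal P}(\widehat T_y)}{|\widehat T_y|}\longrightarrow p_{\mathcal P}(\overline{\mathcal T})\quad\text{almost surely}.$$ Furthermore, for such a property, $$p_{\mathcal P}(\overline{\mathcal T})=\int_0^\infty e^{-t}\,p_{\mathcal P}\bigl(\widehat T_{e^t}\bigr)\,dt=\mathbb E\int_0^\infty e^{-t}\,\mathbf 1\{\widehat T_{e^t}\in\mathcal P\}\,dt .$$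
   Context: Fragmentation process: fix an integer $b\ge2$ and the law of a random vector $\mathbf V=(V_1,\dots,V_b)$ with $0\le V_j\le 1$, $\sum_{j=1}^b V_j=1$, and $V_j<1$ a.s. for each $j$. Attach to every node $u$ of the infinite $b$-ary tree an independent copy $\mathbf V^{(u)}$ of $\mathbf V$. The root has mass $x_0$, and the $j$-th child of a node $u$ with mass $x$ has mass $V^{(u)}_j x$. Given a threshold $x_1\in(0,x_0]$, the fragmentation tree consists of all nodes of mass $\ge x_1$. It depends only on $x_0/x_1$ and is denoted $\widehat T_{x_0/x_1}$; the trees for all ratios $y\ge 1$ are defined on the same probability space using the same vectors $\mathbf V^{(u)}$. The process is non-lattice if there is no $r\in(0,1)$ such that every $V_i$ is a.s. concentrated on $\{0\}\cup\{r,r^2,r^3,\dots\}$. Notation: $T_1\approx T_2$ means isomorphic as rooted trees (the trees may be regarded as unordered, or as ordered or $b$-ary with each child carrying its index $j$). $|T|$ is the number of nodes. $T^v$ is the subtree of $T$ consisting of $v$ and its descendants. The random fringe tree $T^*$ of a finite tree $T$ is $T^v$ with $v$ uniformly random in $T$. $n_S(T)$ is the number of $v\in T$ with $T^v\approx S$; $n_{\mathcal P}(T)$ is the number of $v\in T$ having property $\mathcal P$; a property depending only on $T^v$ is identified with a set of rooted trees ($v$ has $\mathcal P$ iff $T^v\in\mathcal P$), and $p_{\mathcal P}(\mathcal T)=\mathbb P(\mathcal T\in\mathcal P)$ for a random rooted tree $\mathcal T$. *)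

theory Defs
  imports "HOL-Probability.Probability"
begin

section \<open>Rooted trees\<close>

text \<open>
  Trees are sets of Ulam--Harris words: the root is the empty word and the children of \<open>u\<close> are
  words \<open>u @ [j]\<close>, where \<open>j\<close> is the index carried by the child. Indices may be skipped (as in
  \<open>b\<close>-ary trees). Every finite rooted tree, unordered or ordered, has such a representative.
\<close>

type_synonym node = "nat list"
type_synonym tree = "node set"

definition rooted_tree :: "tree \<Rightarrow> bool" where
  "rooted_tree T \<longleftrightarrow> finite T \<and> [] \<in> T \<and> (\<forall>u j. u @ [j] \<in> T \<longrightarrow> u \<in> T)"

definition subtree_at :: "tree \<Rightarrow> node \<Rightarrow> tree" where
  "subtree_at T v = {w. v @ w \<in> T}"

definition num_nodes_with :: "tree set \<Rightarrow> tree \<Rightarrow> nat" where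
  "num_nodes_with P T = card {v \<in> T. subtree_at T v \<in> P}"

definition rooted_iso_map :: "(node \<Rightarrow> node) \<Rightarrow> tree \<Rightarrow> tree \<Rightarrow> bool" where
  "rooted_iso_map f S T \<longleftrightarrow> bij_betw f S T \<and> f [] = [] \<and>
     (\<forall>u\<in>S. \<forall>w\<in>S. (\<exists>j. w = u @ [j]) \<longleftrightarrow> (\<exists>k. f w = f u @ [k]))"

definition unordered_iso :: "tree \<Rightarrow> tree \<Rightarrow> bool" where
  "unordered_iso S T \<longleftrightarrow> (\<exists>f. rooted_iso_map f S T)"

definition ordered_iso :: "tree \<Rightarrow> tree \<Rightarrow> bool" where
  "ordered_iso S T \<longleftrightarrow> (\<exists>f. rooted_iso_map f S T \<and>
     (\<forall>u i j. u @ [i] \<in> S \<longrightarrow> u @ [j] \<in> S \<longrightarrow> i < j \<longrightarrow> last (f (u @ [i])) < last (f (u @ [j]))))"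

definition bary_iso :: "tree \<Rightarrow> tree \<Rightarrow> bool" where
  "bary_iso S T \<longleftrightarrow> (\<exists>f. rooted_iso_map f S T \<and> (\<forall>u j. u @ [j] \<in> S \<longrightarrow> f (u @ [j]) = f u @ [j]))"

section \<open>Random trees\<close>

text \<open>
  The product sigma-algebra on sets of words. It contains every set of finite trees, because there
  are only countably many finite trees.
\<close>

definition tree_space :: "tree measure" where
  "tree_space = sigma UNIV (range (\<lambda>u. {T. u \<in> T}))"

text \<open>
  A random node \<open>v\<close> which, conditionally on the random (a.s. finite) tree \<open>X\<close>, is uniformly
  distributed on the nodes of \<open>X\<close>.
\<close>

definition uniform_random_node :: "'w measure \<Rightarrow> ('w \<Rightarrow> tree) \<Rightarrow> ('w \<Rightarrow> node) \<Rightarrow> bool" where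
  "uniform_random_node M X v \<longleftrightarrow> v \<in> measurable M (count_space UNIV) \<and>
     (\<forall>S u. rooted_tree S \<longrightarrow> u \<in> S \<longrightarrow>
        \<P>(\<omega> in M. X \<omega> = S \<and> v \<omega> = u) = \<P>(\<omega> in M. X \<omega> = S) / real (card S))"

text \<open>Conditional probability \<open>\<P>(Y \<in> P | X)\<close>, i.e. given the sigma-algebra generated by \<open>X\<close>.\<close>

definition cond_prob_tree ::
  "'w measure \<Rightarrow> ('w \<Rightarrow> tree) \<Rightarrow> tree set \<Rightarrow> ('w \<Rightarrow> tree) \<Rightarrow> 'w \<Rightarrow> real" where
  "cond_prob_tree M Y P X =
     real_cond_exp M (vimage_algebra (space M) X tree_space) (\<lambda>\<omega>. indicat_real P (Y \<omega>))"

text \<open>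
  Convergence in distribution, as \<open>y \<rightarrow> \<infinity>\<close>, of random finite rooted trees. The state space is the
  countable set of finite rooted trees with the discrete topology, on which every function is
  continuous; the bounded test functions are extended by \<open>0\<close> to sets of words that are not finite
  rooted trees, which occur with probability 0 only. Words retain the child indices, so this is the version for trees
  regarded as \<open>b\<close>-ary; the unordered and ordered versions are the cases of test functions that are
  invariant under the corresponding isomorphisms.
\<close>

definition tree_converges_in_distribution ::
  "'w measure \<Rightarrow> (real \<Rightarrow> 'w \<Rightarrow> tree) \<Rightarrow> ('w \<Rightarrow> tree) \<Rightarrow> bool" where
  "tree_converges_in_distribution M X Y \<longleftrightarrow>
     (\<forall>f :: tree \<Rightarrow> real. bounded (range f) \<longrightarrow> (\<forall>S. \<not> rooted_tree S \<longrightarrow> f S = 0) \<longrightarrow>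
        ((\<lambda>y. \<integral>\<omega>. f (X y \<omega>) \<partial>M) \<longlongrightarrow> (\<integral>\<omega>. f (Y \<omega>) \<partial>M)) at_top)"

section \<open>The fragmentation process\<close>

text \<open>Children are indexed by \<open>0, \<dots>, b - 1\<close>.\<close>

definition nodes :: "nat \<Rightarrow> node set" where
  "nodes b = {u. set u \<subseteq> {..<b}}"

definition vec_space :: "nat \<Rightarrow> (nat \<Rightarrow> real) measure" where
  "vec_space b = PiM {..<b} (\<lambda>_. borel)"

text \<open>\<open>L\<close> is the law of the splitting vector; \<open>V u j\<close> is the \<open>j\<close>-th component of the copy at \<open>u\<close>.\<close>

definition split_vec ::
  "nat \<Rightarrow> (node \<Rightarrow> nat \<Rightarrow> 'w \<Rightarrow> real) \<Rightarrow> node \<Rightarrow> 'w \<Rightarrow> (nat \<Rightarrow> real)" where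
  "split_vec b V u \<omega> = (\<lambda>j\<in>{..<b}. V u j \<omega>)"

locale fragmentation = prob_space M
  for M :: "'w measure" and b :: nat and L :: "(nat \<Rightarrow> real) measure"
    and V :: "node \<Rightarrow> nat \<Rightarrow> 'w \<Rightarrow> real" +
  assumes b_ge_2: "b \<ge> 2"
    and law_prob_space: "prob_space L"
    and sets_law: "sets L = sets (vec_space b)"
    and law_bounds: "AE v in L. \<forall>j<b. 0 \<le> v j \<and> v j \<le> 1"
    and law_sum: "AE v in L. (\<Sum>j<b. v j) = 1"
    and law_less_1: "\<forall>j<b. AE v in L. v j < 1"
    and indep_copies: "indep_vars (\<lambda>_. vec_space b) (split_vec b V) (nodes b)"
    and distr_copies: "\<forall>u\<in>nodes b. distr M (vec_space b) (split_vec b V u) = L"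

definition non_lattice :: "nat \<Rightarrow> (nat \<Rightarrow> real) measure \<Rightarrow> bool" where
  "non_lattice b L \<longleftrightarrow>
     \<not> (\<exists>r::real. 0 < r \<and> r < 1 \<and> (\<forall>j<b. AE v in L. v j = 0 \<or> (\<exists>k\<ge>1. v j = r ^ k)))"

definition node_mass ::
  "(node \<Rightarrow> nat \<Rightarrow> 'w \<Rightarrow> real) \<Rightarrow> real \<Rightarrow> 'w \<Rightarrow> node \<Rightarrow> real" where
  "node_mass V x0 \<omega> u = (\<Prod>i<length u. V (take i u) (u ! i) \<omega>) * x0"

definition frag_tree ::
  "nat \<Rightarrow> (node \<Rightarrow> nat \<Rightarrow> 'w \<Rightarrow> real) \<Rightarrow> real \<Rightarrow> real \<Rightarrow> 'w \<Rightarrow> tree" where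
  "frag_tree b V x0 x1 \<omega> = {u \<in> nodes b. node_mass V x0 \<omega> u \<ge> x1}"

lemma node_mass_Nil: "node_mass V x0 \<omega> [] = x0"
  by (simp add: node_mass_def)

lemma node_mass_snoc: "node_mass V x0 \<omega> (u @ [j]) = V u j \<omega> * node_mass V x0 \<omega> u"
  by (simp add: node_mass_def nth_append)

lemma frag_tree_ratio:
  assumes "x1 > 0"
  shows "frag_tree b V x0 x1 = frag_tree b V (x0 / x1) 1"
  using assms by (auto simp: frag_tree_def node_mass_def fun_eq_iff field_simps)

end

theory Submission
  imports Defs
begin

text \<open>
  Since the fragments at a node sum to its mass, weighting nodes by mass turns the expected number
  of nodes of mass at least \<open>1\<close> in \<open>T y\<close>, divided by \<open>y\<close>, into a renewal potential \<open>F y\<close>. A maximum principle in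
  the style of Feller shows \<open>F (w * y) - F y \<longlongrightarrow> 0\<close> as \<open>y\<close> grows, for every \<open>w > 0\<close>: the set of good
  \<open>ln w\<close> is a closed subgroup of the reals containing the support of the logarithms of the splitting vector,
  hence everything in the non-lattice case. The existence of the limit of \<open>F\<close> is never needed.

  A node \<open>v\<close> has a fringe tree containing a finite set \<open>A\<close> of words iff \<open>y * m v * m\<^sub>A v \<ge> 1\<close>, where \<open>m v\<close> is the
  mass of \<open>v\<close> relative to the root and \<open>m\<^sub>A v\<close> is the least relative mass in \<open>A\<close> below \<open>v\<close>. By the invariance of \<open>F\<close>, the number of such
  nodes minus \<open>E m\<^sub>A\<close> times the number of all nodes has expectation \<open>o(y)\<close>. Conditioning on the first \<open>c * ln y\<close>
  generations splits it into independent pieces with summable variances, so that it is \<open>o(y)\<close> almost surely along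
  geometric sequences; monotonicity in \<open>y\<close> fills the gaps. As \<open>E m\<^sub>A\<close> is the probability that the
  tree with uniform threshold contains \<open>A\<close>, inclusion-exclusion over the boundary of a finite tree gives the convergence for a
  single tree, and since the limits sum to one it extends to all properties.
\<close>

section \<open>The averaging operator of the splitting law\<close>

text \<open>The factor \<open>E m\<^sub>A\<close> arises by scaling: mass \<open>y\<close> yields
  \<open>y * F y\<close> nodes on average, so an independent factor \<open>m\<close> turns the count
  into \<open>y * m * F (y * m)\<close>, and the invariance of \<open>F\<close> leaves
  \<open>m\<close> times the original count. The obstacle is a splitting law without atoms.
  Closeness of a scaling difference to its upper limit can then be inferred only for sets of scales
  of positive probability, and a modulus of continuity on the logarithmic scale must carry it to a
  single scale. The counting kernel jumps at mass \<open>1\<close>, so this is done for Lipschitz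
  kernels \<open>ramp\<close>, whose potentials squeeze that of \<open>base\<close> up to dilation.
  Since trees may be infinite on a null set, all sums are truncated after \<open>h\<close>
  generations. One constant governs every error: \<open>\<rho>\<close>, the expected sum of squared
  relative masses of the children of a node. Truncation costs order
  \<open>y\<^sup>2 * \<rho> ^ h\<close> in the mean, and the independent pieces after
  \<open>n\<close> generations have variance of order at most
  \<open>h\<^sup>2 * y\<^sup>2 * \<rho> ^ n\<close>; both \<open>h\<close> and \<open>n\<close> grow
  linearly in \<open>ln y\<close>.\<close>

lemma closed_subgroup_real_cases:
  fixes G :: "real set"
  assumes cl: "closed G" and zero: "0 \<in> G" and diff: "\<And>x y. x \<in> G \<Longrightarrow> y \<in> G \<Longrightarrow> x - y \<in> G"
    and ne: "G \<noteq> UNIV"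
  shows "\<exists>d>0. \<forall>g\<in>G. \<exists>k::int. g = of_int k * d"
proof -
  have neg: "- x \<in> G" if "x \<in> G" for x using diff[OF zero that] by simp
  have add: "x + y \<in> G" if "x \<in> G" "y \<in> G" for x y using diff[OF that(1) neg[OF that(2)]] by simp
  have nmul: "of_nat n * x \<in> G" if "x \<in> G" for n :: nat and x
    by (induction n) (auto simp: zero algebra_simps intro: add that)
  have imul: "of_int k * x \<in> G" if "x \<in> G" for k :: int and x
  proof (cases "k \<ge> 0")
    case True then show ?thesis using nmul[OF that, of "nat k"] by simp
  next
    case False then show ?thesis using neg[OF nmul[OF that, of "nat (-k)"]] by simp
  qed
  \<comment> \<open>Arbitrarily small positive elements would have multiples close to every real,
    and closedness would give the excluded case \<open>G = UNIV\<close>. So there is a gap above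
    \<open>0\<close>.\<close>
  obtain \<eta> where \<eta>: "\<eta> > 0" "\<And>g. g \<in> G \<Longrightarrow> 0 < g \<Longrightarrow> g \<ge> \<eta>"
  proof (rule ccontr)
    assume "\<not> thesis"
    with that have small: "\<exists>g\<in>G. 0 < g \<and> g < \<eta>" if "\<eta> > 0" for \<eta>
      using \<open>\<eta> > 0\<close> by (meson not_less)
    have "x \<in> G" for x
    proof -
      have "\<exists>y\<in>G. dist y x < e" if "e > 0" for e
      proof -
        obtain g where g: "g \<in> G" "0 < g" "g < e" using small[OF \<open>e > 0\<close>] by auto
        have "of_int \<lfloor>x / g\<rfloor> * g \<le> x" "x < of_int \<lfloor>x / g\<rfloor> * g + g"
          using floor_divide_lower[OF g(2), of x] floor_divide_upper[OF g(2), of x] by (auto simp: algebra_simps)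
        then have "dist (of_int \<lfloor>x / g\<rfloor> * g) x < e" using g by (auto simp: dist_real_def)
        then show ?thesis using imul[OF g(1)] by blast
      qed
      then show ?thesis using closed_approachable[OF cl] by blast
    qed
    then show False using ne by auto
  qed
  show ?thesis
  proof (cases "\<exists>g\<in>G. g > 0")
    case False
    then have "g = 0" if "g \<in> G" for g using neg[OF that] that by (meson neg_0_less_iff_less not_less_iff_gr_or_eq)
    then show ?thesis by (intro exI[of _ 1]) (auto intro!: exI[of _ 0])
  next
    case True
    define P where "P = G \<inter> {0<..}"
    define d where "d = Inf P"
    have ne: "P \<noteq> {}" and bb: "bdd_below P"
      using True by (auto simp: P_def bdd_below_def intro!: exI[of _ 0])
    have d\<eta>: "d \<ge> \<eta>" unfolding d_def by (intro cInf_greatest ne) (auto simp: P_def \<eta>)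
    have dle: "d \<le> g" if "g \<in> P" for g unfolding d_def by (intro cInf_lower that bb)
    have "\<exists>g\<in>P. g < d + \<eta>" using ne bb \<eta>(1) unfolding d_def
      by (metis cInf_less_iff less_add_same_cancel1)
    then obtain g where g: "g \<in> P" "g < d + \<eta>" by blast
    have "d \<in> G"
    proof (rule ccontr)
      \<comment> \<open>Two elements of \<open>P\<close> would lie between \<open>d\<close> and
        \<open>d + \<eta>\<close>, and their difference would be a positive element of
        \<open>G\<close> smaller than the gap.\<close>
      assume "d \<notin> G"
      then have "d < g" using dle[OF g(1)] g by (auto simp: P_def less_le)
      then obtain g' where g': "g' \<in> P" "g' < g" using ne bb unfolding d_def by (metis cInf_less_iff)
      then have "g - g' \<in> G" "g - g' > 0" using g diff by (auto simp: P_def)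
      then show False using \<eta>(2)[of "g - g'"] dle[OF g'(1)] g by auto
    qed
    have "g = of_int \<lfloor>g / d\<rfloor> * d" if "g \<in> G" for g
    proof (rule ccontr)
      assume ne: "g \<noteq> of_int \<lfloor>g / d\<rfloor> * d"
      have d0: "d > 0" using d\<eta> \<eta> by simp
      have "of_int \<lfloor>g / d\<rfloor> * d \<le> g" "g < of_int \<lfloor>g / d\<rfloor> * d + d"
        using floor_divide_lower[OF d0, of g] floor_divide_upper[OF d0, of g] by (auto simp: algebra_simps)
      then have "g - of_int \<lfloor>g / d\<rfloor> * d \<in> P" "g - of_int \<lfloor>g / d\<rfloor> * d < d"
        using ne diff[OF that imul[OF \<open>d \<in> G\<close>]] by (auto simp: P_def)
      then show False using dle by fastforce
    qed
    then show ?thesis using d\<eta> \<eta> by (intro exI[of _ d]) auto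
  qed
qed

section \<open>Test functions and size-biased averaging\<close>

definition bdd_borel :: "real \<Rightarrow> (real \<Rightarrow> real) \<Rightarrow> bool" where
  "bdd_borel C \<phi> \<longleftrightarrow> \<phi> \<in> borel_measurable borel \<and> (\<forall>y. \<bar>\<phi> y\<bar> \<le> C)"

lemma bdd_borelD: "bdd_borel C \<phi> \<Longrightarrow> \<phi> \<in> borel_measurable borel" "bdd_borel C \<phi> \<Longrightarrow> \<bar>\<phi> y\<bar> \<le> C"
  by (auto simp: bdd_borel_def)

text \<open>On positive arguments this is uniform continuity of \<open>Z\<close> in the logarithm of
  its argument.\<close>

definition log_unif_cont :: "(real \<Rightarrow> real) \<Rightarrow> bool" where
  "log_unif_cont Z \<longleftrightarrow> (\<forall>\<epsilon>>0. \<exists>r>0. \<forall>y t. 0 < t \<longrightarrow> \<bar>t - 1\<bar> < r \<longrightarrow> \<bar>Z (y * t) - Z y\<bar> \<le> \<epsilon>)"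

text \<open>The indicator of \<open>1 \<le> y\<close> divided by \<open>y\<close>. After division by
  the mass, sums over the fragments of a node become averages with the weights
  \<open>W a j\<close>.\<close>

definition base :: "real \<Rightarrow> real" where
  "base y = (if 1 \<le> y then 1 / y else 0)"

lemma base_measurable [measurable]: "base \<in> borel_measurable borel"
  unfolding base_def by measurable

lemma base_bounds: "0 \<le> base y" "base y \<le> 1" "0 \<le> y \<Longrightarrow> base y \<le> y" "y \<le> 0 \<Longrightarrow> base y = 0"
proof -
  show "0 \<le> y \<Longrightarrow> base y \<le> y"
    using mult_mono[of 1 y 1 y] by (auto simp: base_def divide_simps)
qed (auto simp: base_def divide_simps)

text \<open>Domination by \<open>base\<close> lets one potential bound serve the count and all its
  smoothings.\<close>

definition kernel :: "(real \<Rightarrow> real) \<Rightarrow> bool" where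
  "kernel z \<longleftrightarrow> z \<in> borel_measurable borel \<and> (\<forall>y. 0 \<le> z y \<and> z y \<le> base y)"

lemma kernelD: "kernel z \<Longrightarrow> z \<in> borel_measurable borel" "kernel z \<Longrightarrow> 0 \<le> z y" "kernel z \<Longrightarrow> z y \<le> base y"
  by (auto simp: kernel_def)

lemma kernel_base: "kernel base"
  by (auto simp: kernel_def base_bounds)

text \<open>The bounds and the sum hold for every \<open>a\<close> instead of almost every one, so
  that masses are bounded and add up to one without exceptional sets.\<close>

locale splitting = prob_space L for L :: "'a measure" +
  fixes b :: nat and W :: "'a \<Rightarrow> nat \<Rightarrow> real"
  assumes W_measurable [measurable]: "\<And>j. (\<lambda>a. W a j) \<in> borel_measurable L"
    and W_nonneg: "\<And>a j. 0 \<le> W a j"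
    and W_less_1: "\<And>a j. W a j < 1"
    and W_sum: "\<And>a. (\<Sum>j<b. W a j) = 1"
    and W_non_lattice: "\<not> (\<exists>r::real. 0 < r \<and> r < 1 \<and>
          (\<forall>j<b. AE a in L. W a j = 0 \<or> (\<exists>k\<ge>1. W a j = r ^ k)))"
begin

text \<open>Transition operator of the multiplicative random walk that follows a tagged fragment,
  each child being chosen with probability equal to its share of the mass.\<close>

definition avg :: "(real \<Rightarrow> real) \<Rightarrow> real \<Rightarrow> real" where
  "avg \<phi> y = (\<integral>a. (\<Sum>j<b. W a j * \<phi> (y * W a j)) \<partial>L)"

text \<open>The expected shrinking factor of the tagged fragment: \<open>avg\<close> multiplies the
  identity function by \<open>\<rho>\<close>.\<close>

definition \<rho> :: real where "\<rho> = (\<integral>a. (\<Sum>j<b. W a j * W a j) \<partial>L)"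

lemma W_avg_bound:
  assumes "\<And>y. \<bar>\<phi> y\<bar> \<le> C"
  shows "\<bar>\<Sum>j<b. W a j * \<phi> (f j)\<bar> \<le> C"
proof -
  have "\<bar>\<Sum>j<b. W a j * \<phi> (f j)\<bar> \<le> (\<Sum>j<b. W a j * C)"
    by (intro order_trans[OF sum_abs] sum_mono) (auto simp: abs_mult W_nonneg intro!: mult_left_mono assms)
  also have "\<dots> = C" by (simp add: sum_distrib_right[symmetric] W_sum)
  finally show ?thesis .
qed

lemma integrable_avg:
  assumes "bdd_borel C \<phi>"
  shows "integrable L (\<lambda>a. \<Sum>j<b. W a j * \<phi> (y * W a j))"
proof (rule integrable_const_bound[where B=C])
  have [measurable]: "\<phi> \<in> borel_measurable borel" using assms by (rule bdd_borelD)
  show "(\<lambda>a. \<Sum>j<b. W a j * \<phi> (y * W a j)) \<in> borel_measurable L" by measurable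
  show "AE a in L. norm (\<Sum>j<b. W a j * \<phi> (y * W a j)) \<le> C"
    using W_avg_bound[of \<phi> C] bdd_borelD(2)[OF assms] by simp
qed

lemma avg_bdd_borel:
  assumes "bdd_borel C \<phi>"
  shows "bdd_borel C (avg \<phi>)"
proof -
  have [measurable]: "\<phi> \<in> borel_measurable borel" using assms by (rule bdd_borelD)
  have "avg \<phi> \<in> borel_measurable borel"
    unfolding avg_def[abs_def] by (rule borel_measurable_lebesgue_integral) measurable
  moreover have "\<bar>avg \<phi> y\<bar> \<le> C" for y
  proof -
    have "\<bar>avg \<phi> y\<bar> \<le> (\<integral>a. \<bar>\<Sum>j<b. W a j * \<phi> (y * W a j)\<bar> \<partial>L)"
      unfolding avg_def by (rule integral_abs_bound)
    also have "\<dots> \<le> (\<integral>a. C \<partial>L)"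
      using W_avg_bound[of \<phi> C] bdd_borelD(2)[OF assms]
      by (intro integral_mono integrable_abs integrable_avg[OF assms] integrable_const) auto
    finally have "\<bar>avg \<phi> y\<bar> \<le> (\<integral>a. C \<partial>L)" .
    then show ?thesis by (simp add: prob_space)
  qed
  ultimately show ?thesis by (auto simp: bdd_borel_def)
qed

lemma avg_mono:
  assumes "bdd_borel C \<phi>" "bdd_borel D \<psi>" "\<And>w. 0 \<le> w \<Longrightarrow> w < 1 \<Longrightarrow> \<phi> (y * w) \<le> \<psi> (y * w)"
  shows "avg \<phi> y \<le> avg \<psi> y"
  unfolding avg_def
  by (intro integral_mono integrable_avg[OF assms(1)] integrable_avg[OF assms(2)] sum_mono mult_left_mono
      assms(3) W_nonneg W_less_1)

lemma avg_diff:
  assumes "bdd_borel C \<phi>" "bdd_borel D \<psi>"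
  shows "avg \<phi> y - avg \<psi> y = (\<integral>a. (\<Sum>j<b. W a j * (\<phi> (y * W a j) - \<psi> (y * W a j))) \<partial>L)"
  unfolding avg_def right_diff_distrib sum_subtractf
  by (rule Bochner_Integration.integral_diff[OF integrable_avg[OF assms(1)] integrable_avg[OF assms(2)], symmetric])

lemma integrable_W_square: "integrable L (\<lambda>a. \<Sum>j<b. W a j * W a j)"
proof (rule integrable_const_bound[where B=1])
  show "AE a in L. norm (\<Sum>j<b. W a j * W a j) \<le> 1"
  proof (rule AE_I2)
    fix a show "norm (\<Sum>j<b. W a j * W a j) \<le> 1"
    proof -
      have "(\<Sum>j<b. W a j * W a j) \<le> (\<Sum>j<b. W a j * 1)"
        by (intro sum_mono mult_left_mono W_nonneg less_imp_le[OF W_less_1])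
      moreover have "(\<Sum>j<b. W a j * W a j) \<ge> 0" by (intro sum_nonneg mult_nonneg_nonneg W_nonneg)
      ultimately show ?thesis by (simp add: W_sum)
    qed
  qed
qed measurable

lemma \<rho>_nonneg: "0 \<le> \<rho>"
  unfolding \<rho>_def by (intro integral_nonneg_AE AE_I2 sum_nonneg mult_nonneg_nonneg W_nonneg)

text \<open>Pointwise, some child has positive mass and every share is below one, so the squares add
  up to less than the shares; integration over a probability space preserves strictness.\<close>

lemma \<rho>_less_1: "\<rho> < 1"
proof -
  have "(\<integral>a. (\<Sum>j<b. W a j * W a j) \<partial>L) < (\<integral>a. 1 \<partial>L)"
  proof (rule integral_less_AE_space)
    show "AE a in L. (\<Sum>j<b. W a j * W a j) < 1"
    proof (rule AE_I2)
      fix a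
      have "\<exists>j<b. W a j > 0"
      proof (rule ccontr)
        assume "\<not> ?thesis"
        then have "(\<Sum>j<b. W a j) = 0" using W_nonneg[of a] by (intro sum.neutral) (auto simp: less_le)
        then show False using W_sum by simp
      qed
      then obtain i where "i < b" "W a i > 0" by blast
      then have "(\<Sum>j<b. W a j * W a j) < (\<Sum>j<b. W a j * 1)"
        using W_less_1[of a] by (intro sum_strict_mono_ex1 ballI mult_left_mono W_nonneg bexI[of _ i] mult_strict_left_mono)
          (auto intro: less_imp_le)
      then show "(\<Sum>j<b. W a j * W a j) < 1" by (simp add: W_sum)
    qed
  qed (auto simp: integrable_W_square emeasure_space_1)
  then show ?thesis by (simp add: \<rho>_def prob_space)
qed

section \<open>The potential of a kernel\<close>

text \<open>\<open>y * pot base n y\<close> is the expected number of nodes of mass at least \<open>1\<close> in the first \<open>n\<close>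
  generations, started from mass \<open>y\<close>.\<close>

primrec pot :: "(real \<Rightarrow> real) \<Rightarrow> nat \<Rightarrow> real \<Rightarrow> real" where
  "pot z 0 = (\<lambda>y. 0)"
| "pot z (Suc n) = (\<lambda>y. z y + avg (pot z n) y)"

text \<open>A bounded function that still drops by order \<open>1 / y\<close> when a large
  \<open>y\<close> is shrunk by a fixed factor, which is the size of \<open>base y\<close>.\<close>

definition hill :: "real \<Rightarrow> real" where "hill y = (if y \<le> 0 then 0 else y / (1 + y))"

text \<open>The \<open>4\<close> comes from \<open>hill_decrement\<close>, and
  \<open>1 - \<rho>\<close> is the size-biased average of the factor \<open>1 - w\<close>
  there.\<close>

definition pot_bound :: real where "pot_bound = 4 / (1 - \<rho>)"

lemma hill_bdd_borel: "bdd_borel 1 hill"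
  by (auto simp: bdd_borel_def hill_def[abs_def])

lemma pot_bound_pos: "pot_bound > 0"
  using \<rho>_less_1 by (simp add: pot_bound_def)

text \<open>For \<open>y \<ge> 1\<close> the difference is
  \<open>(1 - w) * y / ((1 + y) * (1 + y * w))\<close>, and both factors of the denominator are at
  most \<open>2 * y\<close>. For smaller \<open>y\<close> the right-hand side vanishes and
  monotonicity of \<open>hill\<close> suffices.\<close>

lemma hill_decrement:
  assumes "0 \<le> w" "w < 1"
  shows "hill y - hill (y * w) \<ge> (1 - w) * base y / 4"
proof (cases "y \<ge> 1")
  case True
  have "(1 + y) * (1 + y * w) \<le> (2 * y) * (2 * y)"
  proof (intro mult_mono)
    have "y * w \<le> y * 1" using True assms by (intro mult_left_mono) auto
    then show "1 + y * w \<le> 2 * y" using True by linarith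
  qed (use True assms in auto)
  then have *: "1 / (4 * y) \<le> y / ((1 + y) * (1 + y * w))"
    using True assms by (simp add: divide_simps mult_pos_pos add_pos_nonneg)
  have pos: "1 + y * w > 0" "1 + y > 0" using True assms by (auto intro: add_pos_nonneg)
  have "hill y - hill (y * w) = (1 - w) * (y / ((1 + y) * (1 + y * w)))"
    using True assms pos by (auto simp: hill_def divide_simps mult_le_0_iff) (auto simp: algebra_simps)
  also have "\<dots> \<ge> (1 - w) * (1 / (4 * y))" using assms * by (intro mult_left_mono) auto
  finally show ?thesis using True by (simp add: base_def)
next
  case False
  have "hill (y * w) \<le> hill y"
  proof (cases "y > 0 \<and> w > 0")
    case True
    then have "y * w \<le> y" "y * w > 0" using assms by auto
    then show ?thesis using True by (auto simp: hill_def divide_simps) (simp add: algebra_simps)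
  next
    case False
    then have "y * w \<le> 0" using assms by (auto simp: mult_le_0_iff)
    moreover have "hill y \<ge> 0" by (simp add: hill_def)
    ultimately show ?thesis by (simp add: hill_def)
  qed
  then show ?thesis using False by (simp add: base_def)
qed

text \<open>Since \<open>hill\<close> is concave and its defect \<open>hill - avg hill\<close> dominates a multiple of \<open>base\<close>, it bounds
  every potential.\<close>

lemma hill_superharmonic: "base y / pot_bound + avg hill y \<le> hill y"
proof -
  have "hill y - avg hill y = (\<integral>a. (\<Sum>j<b. W a j * (hill y - hill (y * W a j))) \<partial>L)"
  proof -
    have "avg (\<lambda>_. hill y) y = hill y" by (simp add: avg_def sum_distrib_right[symmetric] W_sum prob_space)
    then show ?thesis using avg_diff[of "\<bar>hill y\<bar>" "\<lambda>_. hill y" 1 hill y] hill_bdd_borel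
      by (simp add: bdd_borel_def)
  qed
  also have "\<dots> \<ge> (\<integral>a. (1 - (\<Sum>j<b. W a j * W a j)) * (base y / 4) \<partial>L)"
  proof (rule integral_mono)
    show "integrable L (\<lambda>a. \<Sum>j<b. W a j * (hill y - hill (y * W a j)))"
      using integrable_avg[OF hill_bdd_borel] by (simp add: right_diff_distrib sum_subtractf sum_distrib_right[symmetric] W_sum)
    fix a
    have "(1 - (\<Sum>j<b. W a j * W a j)) * (base y / 4) = (\<Sum>j<b. W a j * ((1 - W a j) * base y / 4))"
      by (subst W_sum[of a, symmetric]) (simp only: sum_subtractf[symmetric] sum_distrib_right, simp add: algebra_simps diff_divide_distrib)
    also have "\<dots> \<le> (\<Sum>j<b. W a j * (hill y - hill (y * W a j)))"
      by (intro sum_mono mult_left_mono hill_decrement W_nonneg W_less_1)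
    finally show "(1 - (\<Sum>j<b. W a j * W a j)) * (base y / 4) \<le> (\<Sum>j<b. W a j * (hill y - hill (y * W a j)))" .
  qed (intro integrable_mult_left Bochner_Integration.integrable_diff integrable_W_square integrable_const)
  also have "(\<integral>a. (1 - (\<Sum>j<b. W a j * W a j)) * (base y / 4) \<partial>L) = (1 - \<rho>) * (base y / 4)"
    by (simp add: integrable_W_square \<rho>_def prob_space)
  finally show ?thesis by (simp add: pot_bound_def field_simps)
qed

text \<open>The bound by a multiple of \<open>hill\<close> reproduces itself, since
  \<open>hill_superharmonic\<close> absorbs exactly one kernel and one averaging step. Measurability
  and boundedness belong to the same induction because \<open>avg\<close> must be applied to an
  integrable function.\<close>

lemma pot_props:
  assumes z: "kernel z"
  shows "bdd_borel pot_bound (pot z n) \<and> (\<forall>y. 0 \<le> pot z n y \<and> pot z n y / pot_bound \<le> hill y)"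
proof (induction n)
  case 0 then show ?case using pot_bound_pos by (auto simp: bdd_borel_def hill_def)
next
  case (Suc n)
  note [measurable] = kernelD(1)[OF z]
  have bm: "bdd_borel pot_bound (pot z n)" and nn: "\<And>y. 0 \<le> pot z n y"
    and le: "\<And>y. pot z n y / pot_bound \<le> hill y" using Suc by auto
  have [measurable]: "avg (pot z n) \<in> borel_measurable borel" using avg_bdd_borel[OF bm] by (auto dest: bdd_borelD)
  have 1: "pot z (Suc n) y / pot_bound \<le> hill y" for y
  proof -
    have "avg (pot z n) y / pot_bound = avg (\<lambda>y. pot z n y / pot_bound) y"
      by (simp add: avg_def sum_divide_distrib[symmetric])
    also have "\<dots> \<le> avg hill y"
      using bm pot_bound_pos le
      by (intro avg_mono[where C=1 and D=1] hill_bdd_borel) (auto simp: bdd_borel_def)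
    finally have "pot z (Suc n) y / pot_bound \<le> base y / pot_bound + avg hill y"
      using kernelD(3)[OF z, of y] pot_bound_pos by (simp add: add_divide_distrib add_mono divide_right_mono)
    then show ?thesis using hill_superharmonic[of y] by linarith
  qed
  have 2: "0 \<le> pot z (Suc n) y" for y
    using kernelD(2)[OF z, of y] nn
    by (auto simp: avg_def intro!: add_nonneg_nonneg integral_nonneg_AE sum_nonneg mult_nonneg_nonneg W_nonneg)
  have "pot z (Suc n) y / pot_bound \<le> 1" for y
    using 1[of y] bdd_borelD(2)[OF hill_bdd_borel, of y] by linarith
  then have "bdd_borel pot_bound (pot z (Suc n))" using 2 pot_bound_pos
    by (auto simp: bdd_borel_def simp del: pot.simps) (simp add: pot.simps)
  then show ?case using 1 2 by blast
qed

lemma pot_bdd_borel: "kernel z \<Longrightarrow> bdd_borel pot_bound (pot z n)"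
  and pot_nonneg: "kernel z \<Longrightarrow> 0 \<le> pot z n y"
  using pot_props by blast+

lemma pot_le_bound: "kernel z \<Longrightarrow> pot z n y \<le> pot_bound"
  using bdd_borelD(2)[OF pot_bdd_borel, of z n y] by linarith

lemma pot_mono_Suc: "kernel z \<Longrightarrow> pot z n y \<le> pot z (Suc n) y"
proof (induction n arbitrary: y)
  case 0 then show ?case using pot_nonneg[OF 0, of 1 y] by simp
next
  case (Suc n)
  have "avg (pot z n) y \<le> avg (pot z (Suc n)) y"
    by (rule avg_mono[OF pot_bdd_borel pot_bdd_borel]) (use Suc in auto)
  then show ?case by simp
qed

text \<open>The increment is the kernel after \<open>n\<close> averaging steps. On nonnegative
  arguments the kernel lies below the identity, which each step multiplies by
  \<open>\<rho>\<close>.\<close>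

lemma pot_increment:
  assumes "kernel z" "0 \<le> y"
  shows "pot z (Suc n) y - pot z n y \<le> y * \<rho> ^ n"
  using assms(2)
proof (induction n arbitrary: y)
  case 0 then show ?case using kernelD(3)[OF assms(1), of y] base_bounds(3)[of y] by (simp add: avg_def)
next
  case (Suc n)
  have "pot z (Suc (Suc n)) y - pot z (Suc n) y = avg (pot z (Suc n)) y - avg (pot z n) y" by simp
  also have "\<dots> = (\<integral>a. (\<Sum>j<b. W a j * (pot z (Suc n) (y * W a j) - pot z n (y * W a j))) \<partial>L)"
    by (rule avg_diff) (rule pot_bdd_borel[OF assms(1)])+
  also have "\<dots> \<le> (\<integral>a. (\<Sum>j<b. W a j * W a j) * (y * \<rho> ^ n) \<partial>L)"
  proof (rule integral_mono)
    have "integrable L (\<lambda>a. (\<Sum>j<b. W a j * pot z (Suc n) (y * W a j)) - (\<Sum>j<b. W a j * pot z n (y * W a j)))"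
      by (intro Bochner_Integration.integrable_diff integrable_avg[OF pot_bdd_borel[OF assms(1)]])
    then show "integrable L (\<lambda>a. \<Sum>j<b. W a j * (pot z (Suc n) (y * W a j) - pot z n (y * W a j)))"
      by (simp only: right_diff_distrib sum_subtractf)
    fix a
    have "(\<Sum>j<b. W a j * (pot z (Suc n) (y * W a j) - pot z n (y * W a j))) \<le> (\<Sum>j<b. W a j * ((y * W a j) * \<rho> ^ n))"
      using Suc by (intro sum_mono mult_left_mono Suc.IH W_nonneg mult_nonneg_nonneg)
    also have "\<dots> = (\<Sum>j<b. W a j * W a j) * (y * \<rho> ^ n)" by (simp only: sum_distrib_right) (simp add: mult_ac)
    finally show "(\<Sum>j<b. W a j * (pot z (Suc n) (y * W a j) - pot z n (y * W a j))) \<le> (\<Sum>j<b. W a j * W a j) * (y * \<rho> ^ n)" .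
  qed (intro integrable_mult_left integrable_W_square)
  also have "\<dots> = y * \<rho> ^ Suc n" by (simp add: \<rho>_def[symmetric])
  finally show ?case .
qed

definition potential :: "(real \<Rightarrow> real) \<Rightarrow> real \<Rightarrow> real" where
  "potential z y = lim (\<lambda>n. pot z n y)"

lemma pot_tendsto: assumes "kernel z" shows "(\<lambda>n. pot z n y) \<longlonglongrightarrow> potential z y"
proof -
  have "incseq (\<lambda>n. pot z n y)" by (rule incseq_SucI) (rule pot_mono_Suc[OF assms])
  from incseq_convergent[OF this, of pot_bound] pot_le_bound[OF assms]
  show ?thesis unfolding potential_def using limI by metis
qed

lemma potential_bdd_borel: assumes "kernel z" shows "bdd_borel pot_bound (potential z)"
proof -
  have "potential z \<in> borel_measurable borel"
    by (rule borel_measurable_LIMSEQ_real[OF pot_tendsto[OF assms]]) (rule bdd_borelD[OF pot_bdd_borel[OF assms]])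
  moreover have "\<bar>potential z y\<bar> \<le> pot_bound" for y
    by (rule LIMSEQ_le_const2[OF tendsto_rabs[OF pot_tendsto[OF assms]]]) (use bdd_borelD(2)[OF pot_bdd_borel[OF assms]] in auto)
  ultimately show ?thesis by (auto simp: bdd_borel_def)
qed

lemma pot_le_potential: assumes "kernel z" shows "pot z n y \<le> potential z y"
  by (rule incseq_le[OF incseq_SucI pot_tendsto[OF assms]]) (rule pot_mono_Suc[OF assms])

lemma potential_eq: assumes "kernel z" shows "potential z y = z y + avg (potential z) y"
proof (rule LIMSEQ_unique)
  show "(\<lambda>n. pot z (Suc n) y) \<longlonglongrightarrow> potential z y" using pot_tendsto[OF assms] by (rule LIMSEQ_Suc)
  have [measurable]: "pot z n \<in> borel_measurable borel" "potential z \<in> borel_measurable borel" for n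
    using bdd_borelD(1) pot_bdd_borel[OF assms] potential_bdd_borel[OF assms] by blast+
  have "(\<lambda>n. avg (pot z n) y) \<longlonglongrightarrow> avg (potential z) y" unfolding avg_def
  proof (rule integral_dominated_convergence[where w="\<lambda>_. pot_bound"])
    show "AE a in L. (\<lambda>n. \<Sum>j<b. W a j * pot z n (y * W a j)) \<longlonglongrightarrow> (\<Sum>j<b. W a j * potential z (y * W a j))"
      by (intro AE_I2 tendsto_sum tendsto_mult pot_tendsto assms tendsto_const)
    show "AE a in L. norm (\<Sum>j<b. W a j * pot z n (y * W a j)) \<le> pot_bound" for n
      using W_avg_bound[of "pot z n" pot_bound] bdd_borelD(2)[OF pot_bdd_borel[OF assms]] by simp
  qed auto
  then show "(\<lambda>n. pot z (Suc n) y) \<longlonglongrightarrow> z y + avg (potential z) y" by (auto intro: tendsto_add)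
qed

text \<open>Summing the geometric increments gives an error linear in \<open>y\<close>, so a number
  of generations of order \<open>ln y\<close> approximates the full potential.\<close>

lemma potential_tail: assumes "kernel z" "0 \<le> y" shows "potential z y - pot z h y \<le> y * \<rho> ^ h / (1 - \<rho>)"
proof -
  have "pot z (h + m) y - pot z h y \<le> y * \<rho> ^ h / (1 - \<rho>)" for m
  proof -
    have "pot z (h + m) y - pot z h y \<le> (\<Sum>i<m. y * \<rho> ^ (h + i))"
    proof (induction m)
      case (Suc m) then show ?case using pot_increment[OF assms, of "h + m"] by simp
    qed simp
    also have "\<dots> = y * \<rho> ^ h * (\<Sum>i<m. \<rho> ^ i)" by (simp add: power_add sum_distrib_left mult.assoc)
    also have "\<dots> \<le> y * \<rho> ^ h * (1 / (1 - \<rho>))"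
      using \<rho>_nonneg \<rho>_less_1 assms(2) sum_le_suminf[OF summable_geometric, of \<rho> "{..<m}"]
      by (intro mult_left_mono) (auto simp: suminf_geometric)
    finally show ?thesis by simp
  qed
  moreover have "(\<lambda>m. pot z (h + m) y - pot z h y) \<longlonglongrightarrow> potential z y - pot z h y"
    by (intro tendsto_diff tendsto_const LIMSEQ_ignore_initial_segment[OF pot_tendsto[OF assms(1)], of h, unfolded add.commute[of _ h]])
  ultimately show ?thesis by (intro LIMSEQ_le_const2) auto
qed

section \<open>Asymptotic invariance of potentials under scaling\<close>

text \<open>Up to the small term \<open>e y\<close>, the value \<open>D y\<close> is an average of
  values that hardly exceed \<open>\<eta>\<close>. If it is close to \<open>\<eta>\<close>, no set
  of scales of positive probability can carry values well below \<open>\<eta>\<close>. The scales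
  near \<open>w\<close> are such a set, and \<open>log_unif_cont\<close> moves the conclusion to
  \<open>w\<close> itself.\<close>

lemma avg_maximum_principle:
  assumes D: "bdd_borel C D" and luc: "log_unif_cont D"
    and eq: "\<And>y. D y = e y + avg D y" and e: "(e \<longlongrightarrow> 0) at_top"
    and top: "\<And>\<epsilon>. \<epsilon> > 0 \<Longrightarrow> \<forall>\<^sub>F y in at_top. D y \<le> \<eta> + \<epsilon>" and \<eta>: "\<eta> > 0"
    and w: "0 < w" "w < 1" and i: "i < b" and supp: "\<And>r. r > 0 \<Longrightarrow> prob {a \<in> space L. \<bar>W a i - w\<bar> < r} > 0"
    and \<epsilon>: "\<epsilon> > 0"
  shows "\<exists>\<delta>>0. \<exists>Y. \<forall>y\<ge>Y. D y \<ge> \<eta> - \<delta> \<longrightarrow> D (y * w) \<ge> \<eta> - \<epsilon>"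
proof -
  have [measurable]: "D \<in> borel_measurable borel" using D by (rule bdd_borelD)
  have C: "\<bar>D y\<bar> \<le> C" for y using D by (rule bdd_borelD)
  have C0: "0 \<le> C" using C[of 0] by linarith
  obtain r where r: "r > 0" "\<And>y t. 0 < t \<Longrightarrow> \<bar>t - 1\<bar> < r \<Longrightarrow> \<bar>D (y * t) - D y\<bar> \<le> \<epsilon> / 2"
    using luc \<epsilon> unfolding log_unif_cont_def by (meson half_gt_zero)
  define r' where "r' = min (r * w) (w / 2)"
  have r': "r' > 0" using r w by (simp add: r'_def)
  define E where "E = {a \<in> space L. \<bar>W a i - w\<bar> < r'}"
  have E_meas [measurable]: "E \<in> sets L" unfolding E_def by measurable
  \<comment> \<open>The loss suffered by the average if the claim fails at \<open>y\<close>: on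
    \<open>E\<close> the weight is at least \<open>w / 2\<close> and the deficit at least
    \<open>\<epsilon> / 2\<close>.\<close>
  define c where "c = prob E * (w * \<epsilon> / 4)"
  have c: "c > 0" using supp[OF r'] w \<epsilon> by (simp add: c_def E_def)
  \<comment> \<open>Three errors of size \<open>\<kappa>\<close> will enter: the excess over
    \<open>\<eta>\<close>, the small fragments, and \<open>e\<close>. They leave a loss of
    \<open>5 * c / 8\<close>, more than the \<open>c / 2\<close> that is granted.\<close>
  define \<kappa> where "\<kappa> = c / 8"
  have \<kappa>: "\<kappa> > 0" using c by (simp add: \<kappa>_def)
  \<comment> \<open>Cut-off for small fragments, whose mass may leave the range where
    \<open>D\<close> is controlled. At most \<open>b\<close> of them contribute at most
    \<open>\<delta> * C\<close> each; the summand \<open>1\<close> covers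
    \<open>C = 0\<close>.\<close>
  define \<delta> where "\<delta> = \<kappa> / (real b * C + 1)"
  have \<delta>: "\<delta> > 0" using \<kappa> C0 by (simp add: \<delta>_def add_nonneg_pos)
  have bC: "real b * (\<delta> * C) \<le> \<kappa>"
  proof -
    have "real b * (\<delta> * C) = \<kappa> * ((real b * C) / (real b * C + 1))" by (simp add: \<delta>_def)
    also have "\<dots> \<le> \<kappa> * 1" using \<kappa> C0 by (intro mult_left_mono) (auto simp: divide_simps add_nonneg_pos)
    finally show ?thesis by simp
  qed
  obtain Y0 where Y0: "\<And>y. y \<ge> Y0 \<Longrightarrow> D y \<le> \<eta> + \<kappa>"
    using top[OF \<kappa>] by (auto simp: eventually_at_top_linorder)
  have "\<forall>\<^sub>F y in at_top. e y < \<kappa>" using order_tendstoD(2)[OF e \<kappa>] .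
  then obtain Y1 where Y1: "\<And>y. y \<ge> Y1 \<Longrightarrow> e y < \<kappa>" by (auto simp: eventually_at_top_linorder)
  define Y where "Y = Max {Y1, Y0 / \<delta>, 0}"
  have "D (y * w) \<ge> \<eta> - \<epsilon>" if y: "y \<ge> Y" "D y \<ge> \<eta> - c / 2" for y
  proof (rule ccontr)
    assume neg: "\<not> D (y * w) \<ge> \<eta> - \<epsilon>"
    have yY: "y \<ge> Y1" "y \<ge> Y0 / \<delta>" "y \<ge> 0" using y(1) by (auto simp: Y_def)
    have gen: "W a j * D (y * W a j) \<le> W a j * (\<eta> + \<kappa>) + \<delta> * C" for a j
    proof (cases "W a j \<ge> \<delta>")
      case True
      have "Y0 \<le> y * \<delta>" using yY(2) \<delta> by (simp add: pos_divide_le_eq)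
      also have "\<dots> \<le> y * W a j" using True yY(3) by (intro mult_left_mono)
      finally have "W a j * D (y * W a j) \<le> W a j * (\<eta> + \<kappa>)" by (intro mult_left_mono Y0 W_nonneg)
      then show ?thesis using \<delta> C0 by (simp add: add_increasing2)
    next
      case False
      have "W a j * D (y * W a j) \<le> W a j * C" using C[of "y * W a j"] by (intro mult_left_mono W_nonneg) linarith
      also have "\<dots> \<le> \<delta> * C" using False C0 by (intro mult_right_mono) auto
      finally show ?thesis using W_nonneg[of a j] \<eta> \<kappa> by (simp add: add_increasing)
    qed
    have spec: "W a i * D (y * W a i) \<le> W a i * (\<eta> + \<kappa>) + \<delta> * C - indicator E a * (w * \<epsilon> / 4)" for a
    proof (cases "a \<in> E")
      case True
      then have 1: "\<bar>W a i - w\<bar> < r * w" "W a i \<ge> w / 2" unfolding E_def r'_def min_less_iff_conj mem_Collect_eq by linarith+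
      have "\<bar>W a i / w - 1\<bar> = \<bar>W a i - w\<bar> / w" using w by (simp add: field_simps abs_divide)
      then have "\<bar>W a i / w - 1\<bar> < r" using 1 w by (simp add: pos_divide_less_eq)
      then have "\<bar>D (y * w * (W a i / w)) - D (y * w)\<bar> \<le> \<epsilon> / 2" using 1 w by (intro r(2)) auto
      moreover have "y * w * (W a i / w) = y * W a i" using w by simp
      ultimately have "\<bar>D (y * W a i) - D (y * w)\<bar> \<le> \<epsilon> / 2" by metis
      then have "D (y * W a i) \<le> \<eta> - \<epsilon> / 2" using neg by linarith
      then have "W a i * D (y * W a i) \<le> W a i * (\<eta> - \<epsilon> / 2)" by (intro mult_left_mono W_nonneg)
      moreover have "W a i * (\<eta> - \<epsilon> / 2) = W a i * (\<eta> + \<kappa>) - W a i * (\<kappa> + \<epsilon> / 2)"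
        by (simp add: algebra_simps)
      moreover have "W a i * (\<kappa> + \<epsilon> / 2) \<ge> (w / 2) * (\<epsilon> / 2)" using 1 w \<kappa> \<epsilon> by (intro mult_mono) auto
      ultimately have "W a i * D (y * W a i) \<le> W a i * (\<eta> + \<kappa>) - w * \<epsilon> / 4" by simp
      moreover have "0 \<le> \<delta> * C" using \<delta> C0 by simp
      ultimately show ?thesis using True by simp
    qed (use gen[of a i] in simp)
    have pt: "(\<Sum>j<b. W a j * D (y * W a j)) \<le> \<eta> + 2 * \<kappa> - indicator E a * (w * \<epsilon> / 4)" for a
    proof -
      have "(\<Sum>j<b. W a j * D (y * W a j)) \<le>
          (\<Sum>j<b. W a j * (\<eta> + \<kappa>) + \<delta> * C - (if j = i then indicator E a * (w * \<epsilon> / 4) else 0))"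
        using gen spec by (intro sum_mono) auto
      also have "\<dots> = \<eta> + \<kappa> + real b * (\<delta> * C) - indicator E a * (w * \<epsilon> / 4)"
        using i by (simp add: sum_subtractf sum.distrib sum_distrib_right[symmetric] W_sum sum.delta)
      finally show ?thesis using bC by linarith
    qed
    have "avg D y \<le> (\<integral>a. \<eta> + 2 * \<kappa> - indicator E a * (w * \<epsilon> / 4) \<partial>L)"
      unfolding avg_def
      by (intro integral_mono integrable_avg[OF D] pt Bochner_Integration.integrable_diff integrable_const
          integrable_mult_left integrable_real_indicator E_meas) (auto simp: emeasure_eq_measure)
    also have "\<dots> = \<eta> + 2 * \<kappa> - c"
      by (subst Bochner_Integration.integral_diff) (auto simp: prob_space c_def emeasure_eq_measure)
    finally have "D y \<le> \<eta> + 3 * \<kappa> - c" using eq[of y] Y1[OF yY(1)] by linarith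
    then show False using y(2) c by (simp add: \<kappa>_def)
  qed
  \<comment> \<open>The witness for the claimed \<open>\<delta>\<close> is \<open>c / 2\<close>; the
    local \<open>\<delta>\<close> was only the cut-off for fragments.\<close>
  then show ?thesis using c by (intro exI[of _ "c / 2"]) auto
qed

lemma avg_maximum_principle_iterated:
  assumes D: "bdd_borel C D" and luc: "log_unif_cont D"
    and eq: "\<And>y. D y = e y + avg D y" and e: "(e \<longlongrightarrow> 0) at_top"
    and top: "\<And>\<epsilon>. \<epsilon> > 0 \<Longrightarrow> \<forall>\<^sub>F y in at_top. D y \<le> \<eta> + \<epsilon>" and \<eta>: "\<eta> > 0"
    and w: "0 < w" "w < 1" and i: "i < b" and supp: "\<And>r. r > 0 \<Longrightarrow> prob {a \<in> space L. \<bar>W a i - w\<bar> < r} > 0"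
    and \<epsilon>: "\<epsilon> > 0"
  shows "\<exists>\<delta>>0. \<exists>Y. \<forall>y\<ge>Y. D y \<ge> \<eta> - \<delta> \<longrightarrow> (\<forall>k\<le>m. D (y * w ^ k) \<ge> \<eta> - \<epsilon>)"
  using \<epsilon>
proof (induction m arbitrary: \<epsilon>)
  case 0 then show ?case by auto
next
  case (Suc m)
  obtain \<epsilon>' Y' where 1: "\<epsilon>' > 0" "\<And>y. y \<ge> Y' \<Longrightarrow> D y \<ge> \<eta> - \<epsilon>' \<Longrightarrow> D (y * w) \<ge> \<eta> - \<epsilon>"
    using avg_maximum_principle[OF assms(1-10) Suc.prems] by blast
  obtain \<delta> Y where 2: "\<delta> > 0" "\<And>y k. y \<ge> Y \<Longrightarrow> D y \<ge> \<eta> - \<delta> \<Longrightarrow> k \<le> m \<Longrightarrow> D (y * w ^ k) \<ge> \<eta> - min \<epsilon> \<epsilon>'"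
    using Suc.IH[of "min \<epsilon> \<epsilon>'"] 1(1) Suc.prems by auto
  \<comment> \<open>The bound \<open>Y' / w ^ m\<close> keeps \<open>y * w ^ m\<close>, where the
    last step starts, in the range of the one-step principle. The minimum of
    \<open>\<epsilon>\<close> and \<open>\<epsilon>'\<close> both meets the target and triggers that
    step.\<close>
  have "D (y * w ^ k) \<ge> \<eta> - \<epsilon>" if "y \<ge> max Y (Y' / w ^ m)" "D y \<ge> \<eta> - \<delta>" "k \<le> Suc m" for y k
  proof (cases "k = Suc m")
    case True
    have "y * w ^ m \<ge> Y'" using that(1) w by (simp add: pos_divide_le_eq)
    moreover have "D (y * w ^ m) \<ge> \<eta> - \<epsilon>'" using 2(2)[of y m] that by simp
    ultimately show ?thesis using 1(2)[of "y * w ^ m"] True by (simp add: mult.assoc mult.commute[of w])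
  qed (use 2(2)[of y k] that in simp)
  then show ?case using 2(1) by blast
qed

text \<open>If the upper limit \<open>\<eta>\<close> of \<open>D y = Z (y * w) - Z y\<close> were positive, then \<open>D\<close> would be near \<open>\<eta>\<close>
  along \<open>y, y * w, y * w\<^sup>2, ...\<close>, and telescoping would make \<open>Z\<close> unbounded.\<close>

lemma scaling_difference_eventually_less:
  assumes Z: "bdd_borel C Z" and luc: "log_unif_cont Z"
    and eq: "\<And>y. Z y = z y + avg Z y" and z: "(z \<longlongrightarrow> 0) at_top"
    and w: "0 < w" "w < 1" and i: "i < b" and supp: "\<And>r. r > 0 \<Longrightarrow> prob {a \<in> space L. \<bar>W a i - w\<bar> < r} > 0"
    and \<theta>: "\<theta> > 0"
  shows "\<forall>\<^sub>F y in at_top. Z (y * w) - Z y < \<theta>"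
proof -
  define D where "D y = Z (y * w) - Z y" for y
  define e where "e y = z (y * w) - z y" for y
  have C: "\<bar>Z y\<bar> \<le> C" for y using Z by (rule bdd_borelD)
  have [measurable]: "Z \<in> borel_measurable borel" using Z by (rule bdd_borelD)
  have DC: "\<bar>D y\<bar> \<le> 2 * C" for y using C[of y] C[of "y * w"] by (auto simp: D_def)
  have Dm: "bdd_borel (2 * C) D" using DC by (auto simp: bdd_borel_def D_def[abs_def])
  have Zw: "bdd_borel C (\<lambda>y. Z (y * w))" using C by (auto simp: bdd_borel_def)
  have w_top: "filterlim (\<lambda>y. y * w) at_top at_top"
    by (rule filterlim_at_top_mult_tendsto_pos[OF tendsto_const w(1) filterlim_ident])
  have De: "D y = e y + avg D y" for y
  proof -
    have "avg D y = avg (\<lambda>y. Z (y * w)) y - avg Z y"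
      by (subst avg_diff[OF Zw Z]) (simp add: avg_def D_def)
    also have "avg (\<lambda>y. Z (y * w)) y = avg Z (y * w)" by (simp add: avg_def mult_ac)
    finally show ?thesis using eq[of "y * w"] eq[of y] unfolding D_def[of y] e_def by linarith
  qed
  have e0: "(e \<longlongrightarrow> 0) at_top"
    using tendsto_diff[OF filterlim_compose[OF z w_top] z] by (simp add: e_def[abs_def])
  have Dl: "log_unif_cont D"
    unfolding log_unif_cont_def
  proof (intro allI impI)
    fix \<epsilon> :: real assume "\<epsilon> > 0"
    then obtain r where r: "r > 0" "\<And>y t. 0 < t \<Longrightarrow> \<bar>t - 1\<bar> < r \<Longrightarrow> \<bar>Z (y * t) - Z y\<bar> \<le> \<epsilon> / 2"
      using luc unfolding log_unif_cont_def by (meson half_gt_zero)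
    have "\<bar>D (y * t) - D y\<bar> \<le> \<epsilon>" if "0 < t" "\<bar>t - 1\<bar> < r" for y t
      using r(2)[OF that, of y] r(2)[OF that, of "y * w"]
      unfolding D_def mult.assoc mult.commute[of t w] by linarith
    then show "\<exists>r>0. \<forall>y t. 0 < t \<longrightarrow> \<bar>t - 1\<bar> < r \<longrightarrow> \<bar>D (y * t) - D y\<bar> \<le> \<epsilon>" using r(1) by blast
  qed
  \<comment> \<open>The infimum of \<open>S\<close> is the upper limit of \<open>D\<close>. It need
    not belong to \<open>S\<close>, hence the slack in \<open>top\<close>.\<close>
  define S where "S = {c. \<forall>\<^sub>F y in at_top. D y \<le> c}"
  define \<eta> where "\<eta> = Inf S"
  have Sne: "2 * C \<in> S" unfolding S_def mem_Collect_eq by (intro always_eventually allI) (rule abs_le_D1[OF DC])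
  have Sbb: "bdd_below S"
  proof (rule bdd_belowI)
    fix c assume "c \<in> S"
    then obtain y where "D y \<le> c" by (auto simp: S_def eventually_at_top_linorder)
    then show "- (2 * C) \<le> c" using DC[of y] by linarith
  qed
  have top: "\<forall>\<^sub>F y in at_top. D y \<le> \<eta> + \<epsilon>" if "\<epsilon> > 0" for \<epsilon>
  proof -
    have "\<exists>c\<in>S. c < \<eta> + \<epsilon>" using cInf_less_iff[of S "\<eta> + \<epsilon>"] Sne Sbb that by (auto simp: \<eta>_def)
    then show ?thesis by (auto simp: S_def elim!: eventually_mono)
  qed
  have "\<eta> \<le> 0"
  proof (rule ccontr)
    assume "\<not> \<eta> \<le> 0"
    then have \<eta>: "\<eta> > 0" by simp
    \<comment> \<open>After \<open>m\<close> steps gaining at least \<open>\<eta> / 2\<close> each,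
      the total gain exceeds \<open>2 * C\<close>, the largest possible oscillation of
      \<open>Z\<close>.\<close>
    obtain m where m: "4 * C / \<eta> < real m" using reals_Archimedean2 by blast
    obtain \<delta> Y where \<delta>: "\<delta> > 0" and
      Y: "\<And>y k. y \<ge> Y \<Longrightarrow> D y \<ge> \<eta> - \<delta> \<Longrightarrow> k \<le> m \<Longrightarrow> D (y * w ^ k) \<ge> \<eta> - \<eta> / 2"
      using avg_maximum_principle_iterated[OF Dm Dl De e0 top \<eta> w i supp half_gt_zero[OF \<eta>], of m] by blast
    have "\<eta> - \<delta> \<notin> S" using cInf_lower[OF _ Sbb] \<delta> by (fastforce simp: \<eta>_def)
    then have "\<exists>y\<ge>Y. D y \<ge> \<eta> - \<delta>"
      by (auto simp: S_def eventually_at_top_linorder not_le) (meson less_imp_le)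
    then obtain y where y: "y \<ge> Y" "D y \<ge> \<eta> - \<delta>" by blast
    have "Z (y * w ^ n) - Z y = (\<Sum>k<n. D (y * w ^ k))" for n
      by (induction n) (auto simp: D_def mult_ac)
    moreover have "(\<Sum>k<m. \<eta> / 2) \<le> (\<Sum>k<m. D (y * w ^ k))"
      using Y[OF y] by (intro sum_mono) fastforce
    ultimately have "Z (y * w ^ m) - Z y \<ge> (\<Sum>k<m. \<eta> / 2)" by metis
    then have "real m * (\<eta> / 2) \<le> 2 * C" using C[of y] C[of "y * w ^ m"] by simp
    then show False using m \<eta> by (simp add: field_simps)
  qed
  then have "\<exists>c\<in>S. c < \<theta>" using cInf_less_iff[of S \<theta>] Sne Sbb \<theta> by (auto simp: \<eta>_def)
  then show ?thesis unfolding S_def D_def by (auto elim!: eventually_mono)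
qed

text \<open>The lower estimate is the upper estimate for \<open>- Z\<close>, which solves the same
  equation with \<open>- z\<close>.\<close>

lemma scaling_difference_tendsto_support:
  assumes Z: "bdd_borel C Z" and luc: "log_unif_cont Z"
    and eq: "\<And>y. Z y = z y + avg Z y" and z: "(z \<longlongrightarrow> 0) at_top"
    and w: "0 < w" "w < 1" and i: "i < b" and supp: "\<And>r. r > 0 \<Longrightarrow> prob {a \<in> space L. \<bar>W a i - w\<bar> < r} > 0"
  shows "((\<lambda>y. Z (y * w) - Z y) \<longlongrightarrow> 0) at_top"
proof (rule order_tendstoI)
  fix \<theta> :: real assume "0 < \<theta>"
  show "\<forall>\<^sub>F y in at_top. Z (y * w) - Z y < \<theta>"
    by (rule scaling_difference_eventually_less[OF assms \<open>0 < \<theta>\<close>])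
next
  fix \<theta> :: real assume "\<theta> < 0"
  have "bdd_borel C (\<lambda>y. - Z y)" using Z by (simp add: bdd_borel_def)
  moreover have "log_unif_cont (\<lambda>y. - Z y)"
    using luc unfolding log_unif_cont_def minus_diff_minus abs_minus_cancel .
  moreover have "- Z y = - z y + avg (\<lambda>y. - Z y) y" for y
    using eq[of y] by (simp add: avg_def sum_negf)
  moreover have "((\<lambda>y. - z y) \<longlongrightarrow> 0) at_top" using tendsto_minus[OF z] by simp
  ultimately have "\<forall>\<^sub>F y in at_top. - Z (y * w) - - Z y < - \<theta>"
    by (rule scaling_difference_eventually_less[OF _ _ _ _ w i supp]) (use \<open>\<theta> < 0\<close> in auto)
  then show "\<forall>\<^sub>F y in at_top. \<theta> < Z (y * w) - Z y" by eventually_elim simp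
qed

lemma scaling_difference_tendsto:
  assumes Z: "bdd_borel C Z" and luc: "log_unif_cont Z"
    and eq: "\<And>y. Z y = z y + avg Z y" and z: "(z \<longlongrightarrow> 0) at_top" and w: "w > 0"
  shows "((\<lambda>y. Z (y * w) - Z y) \<longlongrightarrow> 0) at_top"
proof -
  define G where "G = {a. ((\<lambda>y. Z (y * exp a) - Z y) \<longlongrightarrow> 0) at_top}"
  have top: "filterlim (\<lambda>y. y * exp a) at_top at_top" for a :: real
    by (rule filterlim_at_top_mult_tendsto_pos[OF tendsto_const exp_gt_zero filterlim_ident])
  have "0 \<in> G" by (simp add: G_def)
  have diff: "x - y \<in> G" if "x \<in> G" "y \<in> G" for x y
  proof -
    have x: "((\<lambda>s. Z (s * exp x) - Z s) \<longlongrightarrow> 0) at_top" and y: "((\<lambda>s. Z (s * exp y) - Z s) \<longlongrightarrow> 0) at_top"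
      using that by (auto simp: G_def)
    have "((\<lambda>s. (Z ((s * exp (-y)) * exp x) - Z (s * exp (-y))) - (Z ((s * exp (-y)) * exp y) - Z (s * exp (-y)))) \<longlongrightarrow> 0 - 0) at_top"
      by (intro tendsto_diff filterlim_compose[OF x top] filterlim_compose[OF y top])
    then show ?thesis by (simp add: G_def mult.assoc exp_add[symmetric] exp_diff[symmetric] add.commute)
  qed
  have "closed G"
    unfolding closed_sequential_limits
  proof (intro allI impI)
    fix x :: "nat \<Rightarrow> real" and l assume x: "(\<forall>n. x n \<in> G) \<and> x \<longlonglongrightarrow> l"
    have "((\<lambda>y. Z (y * exp l) - Z y) \<longlongrightarrow> 0) at_top"
    proof (rule tendstoI)
      fix \<epsilon> :: real assume \<epsilon>: "\<epsilon> > 0"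
      then obtain r where r: "r > 0" "\<And>y t. 0 < t \<Longrightarrow> \<bar>t - 1\<bar> < r \<Longrightarrow> \<bar>Z (y * t) - Z y\<bar> \<le> \<epsilon> / 2"
        using luc unfolding log_unif_cont_def by (meson half_gt_zero)
      have "(\<lambda>n. exp (l - x n)) \<longlonglongrightarrow> exp (l - l)" using x by (intro tendsto_exp tendsto_diff tendsto_const) auto
      then have "(\<lambda>n. exp (l - x n)) \<longlonglongrightarrow> 1" by simp
      then obtain n where n: "\<bar>exp (l - x n) - 1\<bar> < r"
        using tendstoD[OF _ r(1)] by (fastforce simp: dist_real_def eventually_sequentially)
      have "((\<lambda>y. Z (y * exp (x n)) - Z y) \<longlongrightarrow> 0) at_top" using x by (auto simp: G_def)
      then have "\<forall>\<^sub>F y in at_top. dist (Z (y * exp (x n)) - Z y) 0 < \<epsilon> / 2" by (rule tendstoD) (use \<epsilon> in auto)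
      then show "\<forall>\<^sub>F y in at_top. dist (Z (y * exp l) - Z y) 0 < \<epsilon>"
      proof eventually_elim
        case (elim y)
        have eq: "y * exp (x n) * exp (l - x n) = y * exp l" by (simp add: mult.assoc exp_add[symmetric])
        have "\<bar>Z (y * exp (x n) * exp (l - x n)) - Z (y * exp (x n))\<bar> \<le> \<epsilon> / 2" by (rule r(2)) (use n in auto)
        then show ?case using elim unfolding dist_real_def eq by linarith
      qed
    qed
    then show "l \<in> G" by (simp add: G_def)
  qed
  have inG: "AE a in L. W a j = 0 \<or> ln (W a j) \<in> G" if j: "j < b" for j
  proof -
    \<comment> \<open>Every point of \<open>Q\<close> has a neighbourhood that \<open>W a j\<close>
      avoids almost surely. Lindelof's theorem replaces the possibly uncountable union of these
      neighbourhoods by a countable one, which is still null.\<close>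
    define Q where "Q = {c::real. 0 < c \<and> c < 1 \<and> ln c \<notin> G}"
    have "\<exists>r>0. prob {a \<in> space L. \<bar>W a j - c\<bar> < r} = 0" if "c \<in> Q" for c
    proof (rule ccontr)
      assume "\<not> ?thesis"
      then have "prob {a \<in> space L. \<bar>W a j - c\<bar> < r} > 0" if "r > 0" for r
        using that by (metis measure_nonneg order_le_less)
      then have "((\<lambda>y. Z (y * c) - Z y) \<longlongrightarrow> 0) at_top"
        using that by (intro scaling_difference_tendsto_support[OF Z luc eq z _ _ j]) (auto simp: Q_def)
      then show False using that by (auto simp: Q_def G_def)
    qed
    then obtain r where r: "\<And>c. c \<in> Q \<Longrightarrow> r c > 0" "\<And>c. c \<in> Q \<Longrightarrow> prob {a \<in> space L. \<bar>W a j - c\<bar> < r c} = 0"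
      by metis
    obtain F where F: "F \<subseteq> (\<lambda>c. ball c (r c)) ` Q" "countable F" "\<Union>F = \<Union>((\<lambda>c. ball c (r c)) ` Q)"
      using Lindelof[of "(\<lambda>c. ball c (r c)) ` Q"] by auto
    have "AE a in L. \<forall>B\<in>F. W a j \<notin> B"
    proof (subst AE_ball_countable[OF F(2)], intro ballI)
      fix B assume "B \<in> F"
      then obtain c where c: "c \<in> Q" "B = ball c (r c)" using F(1) by auto
      have "AE a in L. a \<notin> {a \<in> space L. \<bar>W a j - c\<bar> < r c}"
        by (rule AE_not_in) (use r(2)[OF c(1)] in \<open>auto simp: null_sets_def emeasure_eq_measure\<close>)
      then show "AE a in L. W a j \<notin> B" by (rule AE_mp) (auto simp: c(2) dist_real_def abs_minus_commute)
    qed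
    then show ?thesis
    proof (eventually_elim)
      case (elim a)
      show ?case
      proof (rule ccontr)
        assume "\<not> ?thesis"
        then have "W a j \<in> Q" using W_nonneg[of a j] W_less_1[of a j] by (auto simp: Q_def less_le)
        then have "W a j \<in> \<Union>F" unfolding F(3) using r(1) by (auto intro!: bexI[of _ "W a j"])
        then show False using elim by auto
      qed
    qed
  qed
  have "G = UNIV"
  proof (rule ccontr)
    assume "G \<noteq> UNIV"
    then obtain d where d: "d > 0" "\<And>g. g \<in> G \<Longrightarrow> \<exists>k::int. g = of_int k * d"
      using closed_subgroup_real_cases[OF \<open>closed G\<close> \<open>0 \<in> G\<close> diff] by blast
    have "AE a in L. W a j = 0 \<or> (\<exists>k\<ge>1. W a j = exp (- d) ^ k)" if "j < b" for j
      using inG[OF that]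
    proof (eventually_elim)
      case (elim a)
      show ?case
      proof (cases "W a j = 0")
        case False
        then have pos: "W a j > 0" using W_nonneg[of a j] by simp
        obtain k :: int where k: "ln (W a j) = of_int k * d" using False elim d(2) by blast
        \<comment> \<open>Since \<open>W a j < 1\<close>, the multiple of \<open>d\<close> is
          negative, and the power of \<open>exp (- d)\<close> is at least the first, as in the
          lattice condition.\<close>
        have "ln (W a j) < 0" using pos W_less_1[of a j] by simp
        then have "k < 0" using k d(1) by (simp add: mult_less_0_iff)
        have "W a j = exp (of_int k * d)" using k pos by (metis exp_ln)
        also have "\<dots> = exp (- d) ^ nat (- k)"
          using \<open>k < 0\<close> by (simp add: exp_of_nat_mult[symmetric])
        finally show ?thesis using \<open>k < 0\<close> by (intro disjI2 exI[of _ "nat (- k)"]) auto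
      qed simp
    qed
    then show False using W_non_lattice d(1) by (auto dest!: spec[of _ "exp (- d)"])
  qed
  then have "ln w \<in> G" by simp
  then show ?thesis using w by (simp add: G_def)
qed

section \<open>Smoothing the kernel\<close>

text \<open>For positive \<open>y\<close> this is a Lipschitz function of \<open>1 / y\<close>, squeezed between \<open>base\<close> and a dilation of it.\<close>

definition ramp :: "real \<Rightarrow> real \<Rightarrow> real" where
  "ramp \<epsilon> y = (if y \<le> 0 then 0 else max 0 (min ((1 - 1 / y) / \<epsilon>) (1 / y)))"

lemma kernel_ramp: assumes "\<epsilon> > 0" shows "kernel (ramp \<epsilon>)"
proof -
  have "ramp \<epsilon> \<in> borel_measurable borel" unfolding ramp_def[abs_def] by measurable
  moreover have "ramp \<epsilon> y \<le> base y" for y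
  proof (cases "0 < y \<and> y < 1")
    case True
    then have "1 - 1 / y \<le> 0" by simp
    then have "(1 - 1 / y) / \<epsilon> \<le> 0" using assms by (simp add: divide_nonpos_pos)
    then have "min ((1 - 1 / y) / \<epsilon>) (1 / y) \<le> 0" by (rule min.coboundedI1)
    then have "ramp \<epsilon> y = 0" by (simp add: ramp_def max_absorb1)
    then show ?thesis by (simp add: base_bounds)
  qed (auto simp: ramp_def base_def)
  moreover have "0 \<le> ramp \<epsilon> y" for y by (simp add: ramp_def)
  ultimately show ?thesis by (simp add: kernel_def)
qed

lemma ramp_ge_base: assumes "\<epsilon> > 0" shows "base (y / (1 + \<epsilon>)) / (1 + \<epsilon>) \<le> ramp \<epsilon> y"
proof (cases "y \<ge> 1 + \<epsilon>")
  case True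
  then have y: "y > 0" using assms by linarith
  have "1 / y \<le> (1 - 1 / y) / \<epsilon>" using True y assms by (simp add: field_simps)
  moreover have "base (y / (1 + \<epsilon>)) / (1 + \<epsilon>) = 1 / y" using True assms by (simp add: base_def)
  moreover have "0 \<le> 1 / y" using y by simp
  ultimately show ?thesis using y by (simp add: ramp_def min_def max_def)
next
  case False
  then have "base (y / (1 + \<epsilon>)) = 0" using assms by (simp add: base_def)
  then show ?thesis by (simp add: ramp_def)
qed

text \<open>As a function of \<open>1 / y\<close>, the ramp has Lipschitz constant
  \<open>1 / \<epsilon>\<close>. With \<open>t\<close> up to \<open>2\<close> the difference may be
  nonzero already for \<open>y\<close> slightly above \<open>1 / 2\<close>, so the bound involves
  \<open>base (y * 2)\<close>, whose value \<open>1 / (2 * y)\<close> accounts for the factor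
  \<open>2\<close>.\<close>

lemma ramp_modulus:
  assumes "0 < \<epsilon>" "\<epsilon> \<le> 1" "0 < t" "t \<le> 2"
  shows "\<bar>ramp \<epsilon> (y * t) - ramp \<epsilon> y\<bar> \<le> (2 / \<epsilon> * \<bar>1 / t - 1\<bar>) * base (y * 2)"
proof (cases "y * 2 \<ge> 1")
  case True
  define \<psi> where "\<psi> u = max 0 (min ((1 - u) / \<epsilon>) u)" for u :: real
  have lip: "\<bar>\<psi> u - \<psi> v\<bar> \<le> \<bar>u - v\<bar> / \<epsilon>" for u v
  proof -
    have "\<bar>(1 - u) / \<epsilon> - (1 - v) / \<epsilon>\<bar> = \<bar>u - v\<bar> / \<epsilon>"
      using assms by (simp add: diff_divide_distrib[symmetric] abs_divide abs_minus_commute)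
    moreover have "\<bar>u - v\<bar> \<le> \<bar>u - v\<bar> / \<epsilon>" using assms by (simp add: divide_simps mult_left_le)
    ultimately show ?thesis unfolding \<psi>_def by linarith
  qed
  have y: "y > 0" using True by simp
  then have yt: "y * t > 0" using assms by simp
  have "\<bar>ramp \<epsilon> (y * t) - ramp \<epsilon> y\<bar> = \<bar>\<psi> (1 / (y * t)) - \<psi> (1 / y)\<bar>"
    using y yt by (simp add: ramp_def \<psi>_def not_le)
  also have "\<dots> \<le> \<bar>1 / (y * t) - 1 / y\<bar> / \<epsilon>" by (rule lip)
  also have "1 / (y * t) - 1 / y = (1 / t - 1) * (1 / y)" using y assms by (simp add: field_simps)
  also have "\<bar>(1 / t - 1) * (1 / y)\<bar> / \<epsilon> = (2 / \<epsilon> * \<bar>1 / t - 1\<bar>) * base (y * 2)"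
    using True y assms by (simp add: base_def abs_mult)
  finally show ?thesis .
next
  case False
  have "y * t \<le> 1"
  proof (cases "y \<ge> 0")
    case True
    have "y * t \<le> y * 2" using True assms by (intro mult_left_mono) auto
    then show ?thesis using False by simp
  next
    case False
    then show ?thesis using assms by (meson less_imp_le mult_nonpos_nonneg not_le order_trans zero_le_one)
  qed
  moreover have "ramp \<epsilon> s = 0" if "s \<le> 1" for s
  proof (cases "s > 0")
    case True
    then have "(1 - 1 / s) / \<epsilon> \<le> 0" using assms that by (intro divide_nonpos_pos) auto
    then have "min ((1 - 1 / s) / \<epsilon>) (1 / s) \<le> 0" by (rule min.coboundedI1)
    then show ?thesis by (simp add: ramp_def max_absorb1)
  qed (simp add: ramp_def)
  ultimately have "ramp \<epsilon> (y * t) = 0" "ramp \<epsilon> y = 0" using False by auto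
  then show ?thesis using assms base_bounds by simp
qed

text \<open>Averaging commutes with dilations, so the modulus of the kernel passes through the
  recursion and is multiplied by a potential of \<open>base\<close>, which is bounded uniformly in
  \<open>n\<close> and \<open>y\<close>.\<close>

lemma pot_ramp_modulus:
  assumes "0 < \<epsilon>" "\<epsilon> \<le> 1" "0 < t" "t \<le> 2"
  shows "\<bar>pot (ramp \<epsilon>) n (y * t) - pot (ramp \<epsilon>) n y\<bar> \<le> (2 / \<epsilon> * \<bar>1 / t - 1\<bar>) * pot base n (y * 2)"
proof (induction n arbitrary: y)
  case 0 then show ?case by simp
next
  case (Suc n)
  define K where "K = 2 / \<epsilon> * \<bar>1 / t - 1\<bar>"
  have K: "K \<ge> 0" using assms by (simp add: K_def)
  let ?p = "pot (ramp \<epsilon>) n" and ?q = "pot base n"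
  have p: "bdd_borel pot_bound ?p" by (rule pot_bdd_borel[OF kernel_ramp[OF assms(1)]])
  have q: "bdd_borel pot_bound ?q" by (rule pot_bdd_borel[OF kernel_base])
  have pt: "bdd_borel pot_bound (\<lambda>y. ?p (y * t))" using p by (auto simp: bdd_borel_def)
  have [measurable]: "?p \<in> borel_measurable borel" "?q \<in> borel_measurable borel" using bdd_borelD p q by blast+
  have q2: "bdd_borel (K * pot_bound) (\<lambda>y. K * ?q (y * 2))"
    using bdd_borelD(2)[OF q] K by (auto simp: bdd_borel_def abs_mult intro!: mult_left_mono)
  have "avg ?p (y * t) - avg ?p y = avg (\<lambda>y. ?p (y * t)) y - avg ?p y" by (simp add: avg_def mult_ac)
  also have "\<dots> = (\<integral>a. (\<Sum>j<b. W a j * (?p (y * W a j * t) - ?p (y * W a j))) \<partial>L)"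
    by (rule avg_diff[OF pt p])
  finally have "\<bar>avg ?p (y * t) - avg ?p y\<bar> = \<bar>\<integral>a. (\<Sum>j<b. W a j * (?p (y * W a j * t) - ?p (y * W a j))) \<partial>L\<bar>"
    by (rule arg_cong)
  also have "\<dots> \<le> (\<integral>a. \<bar>\<Sum>j<b. W a j * (?p (y * W a j * t) - ?p (y * W a j))\<bar> \<partial>L)" by (rule integral_abs_bound)
  also have "\<dots> \<le> (\<integral>a. (\<Sum>j<b. W a j * (K * ?q (y * W a j * 2))) \<partial>L)"
  proof (rule integral_mono)
    have "integrable L (\<lambda>a. (\<Sum>j<b. W a j * ?p (y * W a j * t)) - (\<Sum>j<b. W a j * ?p (y * W a j)))"
      by (intro Bochner_Integration.integrable_diff integrable_avg[OF pt] integrable_avg[OF p])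
    then show "integrable L (\<lambda>a. \<bar>\<Sum>j<b. W a j * (?p (y * W a j * t) - ?p (y * W a j))\<bar>)"
      by (simp only: right_diff_distrib sum_subtractf integrable_abs)
    show "integrable L (\<lambda>a. \<Sum>j<b. W a j * (K * ?q (y * W a j * 2)))" by (rule integrable_avg[OF q2])
    show "\<bar>\<Sum>j<b. W a j * (?p (y * W a j * t) - ?p (y * W a j))\<bar> \<le> (\<Sum>j<b. W a j * (K * ?q (y * W a j * 2)))" for a
      by (rule order_trans[OF sum_abs], intro sum_mono, unfold abs_mult[of "W _ _"] abs_of_nonneg[OF W_nonneg])
         (intro mult_left_mono W_nonneg Suc.IH[folded K_def])
  qed
  also have "\<dots> = K * avg ?q (y * 2)"
  proof -
    have "(\<Sum>j<b. W a j * (K * ?q (y * W a j * 2))) = K * (\<Sum>j<b. W a j * ?q (y * 2 * W a j))" for a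
      unfolding sum_distrib_left by (intro sum.cong refl) (simp add: mult_ac)
    then show ?thesis unfolding avg_def by simp
  qed
  finally have "\<bar>avg ?p (y * t) - avg ?p y\<bar> \<le> K * avg ?q (y * 2)" .
  moreover have "\<bar>ramp \<epsilon> (y * t) - ramp \<epsilon> y\<bar> \<le> K * base (y * 2)"
    using ramp_modulus[OF assms] by (simp add: K_def)
  ultimately show ?case unfolding pot.simps distrib_left K_def[symmetric] by linarith
qed

lemma log_unif_cont_potential_ramp:
  assumes \<epsilon>: "0 < \<epsilon>" "\<epsilon> \<le> 1"
  shows "log_unif_cont (potential (ramp \<epsilon>))"
  unfolding log_unif_cont_def
proof (intro allI impI)
  fix \<theta> :: real assume \<theta>: "\<theta> > 0"
  have "((\<lambda>t. 2 / \<epsilon> * \<bar>1 / t - 1\<bar> * pot_bound) \<longlongrightarrow> 2 / \<epsilon> * \<bar>1 / 1 - 1\<bar> * pot_bound) (at (1::real))"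
    by (intro tendsto_intros) auto
  then have "\<forall>\<^sub>F t in at (1::real). 2 / \<epsilon> * \<bar>1 / t - 1\<bar> * pot_bound < \<theta>"
    using order_tendstoD(2)[of _ 0 _ \<theta>] \<theta> by simp
  then obtain r where r: "r > 0" "\<And>t. t \<noteq> 1 \<Longrightarrow> dist t 1 < r \<Longrightarrow> 2 / \<epsilon> * \<bar>1 / t - 1\<bar> * pot_bound < \<theta>"
    by (auto simp: eventually_at)
  have "\<bar>potential (ramp \<epsilon>) (y * t) - potential (ramp \<epsilon>) y\<bar> \<le> \<theta>"
    if t: "0 < t" "\<bar>t - 1\<bar> < min r 1" for y t
  proof -
    have "\<bar>pot (ramp \<epsilon>) n (y * t) - pot (ramp \<epsilon>) n y\<bar> \<le> \<theta>" for n
    proof (cases "t = 1")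
      case False
      have "\<bar>pot (ramp \<epsilon>) n (y * t) - pot (ramp \<epsilon>) n y\<bar> \<le> (2 / \<epsilon> * \<bar>1 / t - 1\<bar>) * pot base n (y * 2)"
        by (rule pot_ramp_modulus[OF \<epsilon>]) (use t in auto)
      also have "\<dots> \<le> (2 / \<epsilon> * \<bar>1 / t - 1\<bar>) * pot_bound"
        using \<epsilon> by (intro mult_left_mono pot_le_bound kernel_base) auto
      also have "\<dots> < \<theta>" using r(2)[OF False] t by (simp add: dist_real_def)
      finally show ?thesis by simp
    qed (use \<theta> in simp)
    moreover have "(\<lambda>n. \<bar>pot (ramp \<epsilon>) n (y * t) - pot (ramp \<epsilon>) n y\<bar>) \<longlonglongrightarrow> \<bar>potential (ramp \<epsilon>) (y * t) - potential (ramp \<epsilon>) y\<bar>"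
      by (intro tendsto_rabs tendsto_diff pot_tendsto kernel_ramp \<epsilon>)
    ultimately show ?thesis by (intro LIMSEQ_le_const2) auto
  qed
  then show "\<exists>r>0. \<forall>y t. 0 < t \<longrightarrow> \<bar>t - 1\<bar> < r \<longrightarrow> \<bar>potential (ramp \<epsilon>) (y * t) - potential (ramp \<epsilon>) y\<bar> \<le> \<theta>"
    using r(1) by (intro exI[of _ "min r 1"]) auto
qed

lemma base_tendsto_0: "(base \<longlongrightarrow> 0) at_top"
proof (rule tendsto_sandwich[of "\<lambda>_. 0" _ _ "\<lambda>y. inverse y"])
  show "((\<lambda>y::real. inverse y) \<longlongrightarrow> 0) at_top" by (rule tendsto_inverse_0_at_top[OF filterlim_ident])
  show "\<forall>\<^sub>F y in at_top. base y \<le> inverse y"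
    using eventually_ge_at_top[of "1::real"] by eventually_elim (simp add: base_def divide_inverse)
qed (auto simp: base_bounds)

lemma pot_mono_kernel:
  assumes "kernel z" "kernel z'" "\<And>y. z y \<le> z' y"
  shows "pot z n y \<le> pot z' n y"
proof (induction n arbitrary: y)
  case (Suc n)
  have "avg (pot z n) y \<le> avg (pot z' n) y"
    by (rule avg_mono[OF pot_bdd_borel[OF assms(1)] pot_bdd_borel[OF assms(2)] Suc])
  then show ?case using assms(3)[of y] by simp
qed simp

lemma pot_base_ramp:
  assumes "\<epsilon> > 0"
  shows "pot base n (y / (1 + \<epsilon>)) / (1 + \<epsilon>) \<le> pot (ramp \<epsilon>) n y"
proof (induction n arbitrary: y)
  case (Suc n)
  have "bdd_borel pot_bound (pot base n)" by (rule pot_bdd_borel[OF kernel_base])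
  then have "bdd_borel (pot_bound / (1 + \<epsilon>)) (\<lambda>y. pot base n (y / (1 + \<epsilon>)) / (1 + \<epsilon>))"
    using assms by (auto simp: bdd_borel_def intro!: divide_right_mono)
  then have "avg (\<lambda>y. pot base n (y / (1 + \<epsilon>)) / (1 + \<epsilon>)) y \<le> avg (pot (ramp \<epsilon>) n) y"
    by (rule avg_mono[OF _ pot_bdd_borel[OF kernel_ramp[OF assms]] Suc.IH])
  moreover have "avg (\<lambda>y. pot base n (y / (1 + \<epsilon>)) / (1 + \<epsilon>)) y = avg (pot base n) (y / (1 + \<epsilon>)) / (1 + \<epsilon>)"
    by (simp add: avg_def sum_divide_distrib[symmetric] mult_ac)
  ultimately show ?case using ramp_ge_base[OF assms, of y] by (simp add: add_divide_distrib)
qed simp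

theorem potential_base_scaling:
  assumes w: "w > 0"
  shows "((\<lambda>y. potential base (y * w) - potential base y) \<longlongrightarrow> 0) at_top"
proof (rule tendstoI)
  fix \<theta> :: real assume \<theta>: "\<theta> > 0"
  \<comment> \<open>Replacing the factor \<open>1 + \<epsilon>\<close> in \<open>up\<close> by
    \<open>1\<close> costs at most \<open>\<theta> / 2\<close>. The other half pays for at most two
    scaling differences of the ramp potential, \<open>\<theta> / 4\<close> each.\<close>
  define \<epsilon> where "\<epsilon> = min 1 (\<theta> / (2 * pot_bound))"
  have \<epsilon>: "0 < \<epsilon>" "\<epsilon> \<le> 1" "\<epsilon> * pot_bound \<le> \<theta> / 2"
    using \<theta> pot_bound_pos by (auto simp: \<epsilon>_def min_def field_simps)
  note kr = kernel_ramp[OF \<epsilon>(1)]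
  have r0: "(ramp \<epsilon> \<longlongrightarrow> 0) at_top"
    by (rule tendsto_sandwich[OF _ _ tendsto_const base_tendsto_0]) (auto intro!: always_eventually kernelD[OF kr])
  have sc: "((\<lambda>y. potential (ramp \<epsilon>) (y * u) - potential (ramp \<epsilon>) y) \<longlongrightarrow> 0) at_top" if "u > 0" for u
    by (rule scaling_difference_tendsto[OF potential_bdd_borel[OF kr] log_unif_cont_potential_ramp[OF \<epsilon>(1,2)]
        potential_eq[OF kr] r0 that])
  have lo: "potential (ramp \<epsilon>) y \<le> potential base y" for y
    by (rule LIMSEQ_le[OF pot_tendsto[OF kr] pot_tendsto[OF kernel_base]])
       (auto intro!: pot_mono_kernel kr kernel_base kernelD[OF kr])
  have up: "potential base y \<le> (1 + \<epsilon>) * potential (ramp \<epsilon>) (y * (1 + \<epsilon>))" for y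
  proof (rule LIMSEQ_le[OF pot_tendsto[OF kernel_base] tendsto_mult[OF tendsto_const pot_tendsto[OF kr]]])
    show "\<exists>N. \<forall>n\<ge>N. pot base n y \<le> (1 + \<epsilon>) * pot (ramp \<epsilon>) n (y * (1 + \<epsilon>))"
      using pot_base_ramp[OF \<epsilon>(1), of _ "y * (1 + \<epsilon>)"] \<epsilon> by (auto simp: divide_simps mult_ac)
  qed
  have up': "potential base y \<le> potential (ramp \<epsilon>) (y * (1 + \<epsilon>)) + \<theta> / 2" for y
  proof -
    have "\<epsilon> * potential (ramp \<epsilon>) (y * (1 + \<epsilon>)) \<le> \<epsilon> * pot_bound"
      using bdd_borelD(2)[OF potential_bdd_borel[OF kr], of "y * (1 + \<epsilon>)"] \<epsilon> by (intro mult_left_mono) auto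
    then show ?thesis using up[of y] \<epsilon>(3) by (simp add: distrib_right)
  qed
  have u: "w * (1 + \<epsilon>) > 0" "1 + \<epsilon> > 0" using w \<epsilon> by auto
  have \<theta>2: "\<theta> / 4 > 0" using \<theta> by simp
  show "\<forall>\<^sub>F y in at_top. dist (potential base (y * w) - potential base y) 0 < \<theta>"
    using tendstoD[OF sc[OF u(1)] \<theta>2] tendstoD[OF sc[OF u(2)] \<theta>2] tendstoD[OF sc[OF w] \<theta>2]
  proof eventually_elim
    case (elim y)
    show ?case
      using elim lo[of y] lo[of "y * w"] up'[of y] up'[of "y * w"] \<theta> unfolding dist_real_def mult.assoc by linarith
  qed
qed

end

section \<open>Marked Ulam-Harris trees\<close>

definition ind :: "real \<Rightarrow> real" where "ind s = (if 1 \<le> s then 1 else 0)"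

lemma ind_measurable [measurable]: "ind \<in> borel_measurable borel"
  unfolding ind_def[abs_def] by measurable

lemma ind_bounds: "0 \<le> ind s" "ind s \<le> 1" "0 \<le> s \<Longrightarrow> ind s \<le> s" "0 \<le> s \<Longrightarrow> ind s \<le> s\<^sup>2" "ind s = s * base s"
  by (auto simp: ind_def base_def)

lemma nodes_append [simp]: "u @ w \<in> nodes b \<longleftrightarrow> u \<in> nodes b \<and> w \<in> nodes b"
  by (auto simp: nodes_def)

lemma nodes_Nil [simp]: "[] \<in> nodes b"
  by (simp add: nodes_def)

lemma nodes_Cons [simp]: "j # w \<in> nodes b \<longleftrightarrow> j < b \<and> w \<in> nodes b"
  by (auto simp: nodes_def)

lemma nodes_take: "u \<in> nodes b \<Longrightarrow> take n u \<in> nodes b"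
  and nodes_drop: "u \<in> nodes b \<Longrightarrow> drop n u \<in> nodes b"
  by (auto simp: nodes_def dest: in_set_takeD in_set_dropD)

definition gen :: "nat \<Rightarrow> nat \<Rightarrow> node set" where "gen b n = {v \<in> nodes b. length v = n}"
definition below :: "nat \<Rightarrow> nat \<Rightarrow> node set" where "below b h = {v \<in> nodes b. length v < h}"

lemma gen_eq: "gen b n = {v. set v \<subseteq> {..<b} \<and> length v = n}"
  by (auto simp: gen_def nodes_def)

lemma finite_gen [simp]: "finite (gen b n)"
  unfolding gen_eq by (rule finite_lists_length_eq) simp

lemma card_gen: "card (gen b n) = b ^ n"
  unfolding gen_eq by (subst card_lists_length_eq) auto

lemma below_eq: "below b h = (\<Union>i<h. gen b i)"
  by (auto simp: below_def gen_def)

lemma finite_below [simp]: "finite (below b h)"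
  unfolding below_eq by (intro finite_UN_I finite_gen) simp

lemma below_nodes: "v \<in> below b h \<Longrightarrow> v \<in> nodes b" and gen_nodes: "v \<in> gen b h \<Longrightarrow> v \<in> nodes b"
  by (auto simp: below_def gen_def)

lemma gen_0 [simp]: "gen b 0 = {[]}"
  by (auto simp: gen_def)

lemma sum_below: "(\<Sum>v\<in>below b h. f v) = (\<Sum>i<h. \<Sum>v\<in>gen b i. f v)"
  unfolding below_eq by (rule sum.UNION_disjoint) (simp, simp, auto simp: gen_def)

lemma sum_gen_add: "(\<Sum>v\<in>gen b (n + k). f v) = (\<Sum>u\<in>gen b n. \<Sum>w\<in>gen b k. f (u @ w))"
proof -
  have "(\<Sum>u\<in>gen b n. \<Sum>w\<in>gen b k. f (u @ w)) = (\<Sum>p\<in>gen b n \<times> gen b k. f (fst p @ snd p))"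
    by (simp add: sum.cartesian_product case_prod_unfold)
  also have "\<dots> = (\<Sum>v\<in>gen b (n + k). f v)"
    by (rule sum.reindex_bij_witness[where i="\<lambda>v. (take n v, drop n v)" and j="\<lambda>p. fst p @ snd p"])
       (auto simp: gen_def nodes_take nodes_drop)
  finally show ?thesis ..
qed

lemma sum_gen_1: "(\<Sum>v\<in>gen b (Suc 0). f v) = (\<Sum>j<b. f [j])"
  by (rule sum.reindex_bij_witness[where i="\<lambda>j. [j]" and j="\<lambda>v. v ! 0"])
     (auto simp: gen_def length_Suc_conv)

lemma sum_gen_Suc: "(\<Sum>v\<in>gen b (Suc n). f v) = (\<Sum>u\<in>gen b n. \<Sum>j<b. f (u @ [j]))"
  using sum_gen_add[of f b n "Suc 0"] by (simp add: sum_gen_1)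

lemma sum_below_add:
  "(\<Sum>v\<in>below b (n + h). f v) = (\<Sum>v\<in>below b n. f v) + (\<Sum>u\<in>gen b n. \<Sum>w\<in>below b h. f (u @ w))"
proof -
  have "(\<Sum>i<n + h. \<Sum>v\<in>gen b i. f v) = (\<Sum>i<n. \<Sum>v\<in>gen b i. f v) + (\<Sum>i<h. \<Sum>v\<in>gen b (n + i). f v)"
    by (induction h) (auto simp: add.assoc)
  also have "(\<Sum>i<h. \<Sum>v\<in>gen b (n + i). f v) = (\<Sum>u\<in>gen b n. \<Sum>i<h. \<Sum>w\<in>gen b i. f (u @ w))"
    unfolding sum_gen_add by (rule sum.swap)
  finally show ?thesis by (simp add: sum_below)
qed

section \<open>The product space of splitting vectors and resampling below a node\<close>

context splitting
begin

definition Om :: "(node \<Rightarrow> 'a) measure" where "Om = PiM (nodes b) (\<lambda>_. L)"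

definition mass :: "(node \<Rightarrow> 'a) \<Rightarrow> node \<Rightarrow> real" where
  "mass x v = (\<Prod>i<length v. W (x (take i v)) (v ! i))"

definition shift :: "node \<Rightarrow> (node \<Rightarrow> 'a) \<Rightarrow> node \<Rightarrow> 'a" where
  "shift v x = (\<lambda>u\<in>nodes b. x (v @ u))"

text \<open>Resampling the vectors at and below \<open>v\<close> preserves \<open>Om\<close>; this is the form in which the independence
  of the subtree at \<open>v\<close> from the rest of the tree is used.\<close>

definition splice :: "node \<Rightarrow> (node \<Rightarrow> 'a) \<Rightarrow> (node \<Rightarrow> 'a) \<Rightarrow> node \<Rightarrow> 'a" where
  "splice v x x' = (\<lambda>u\<in>nodes b. if take (length v) u = v then x' (drop (length v) u) else x u)"

lemma prod_space: "product_prob_space (\<lambda>_. L)"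
  by (simp add: product_prob_space_def product_prob_space_axioms_def product_sigma_finite_def
      prob_space_axioms sigma_finite_measure_axioms)

sublocale Om: prob_space Om
  unfolding Om_def by (rule prob_space_PiM) (rule prob_space_axioms)

sublocale OmOm: pair_prob_space Om Om ..

lemma mass_Nil [simp]: "mass x [] = 1"
  by (simp add: mass_def)

lemma mass_snoc: "mass x (v @ [j]) = mass x v * W (x v) j"
  by (simp add: mass_def nth_append)

lemma mass_single: "mass x [j] = W (x []) j"
  using mass_snoc[of x "[]" j] by simp

lemma mass_append:
  assumes "w \<in> nodes b"
  shows "mass x (v @ w) = mass x v * mass (shift v x) w"
  using assms
proof (induction w rule: rev_induct)
  case (snoc j w)
  then have "mass x ((v @ w) @ [j]) = mass x (v @ w) * W (x (v @ w)) j" by (rule_tac mass_snoc)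
  then show ?case using snoc by (simp add: mass_snoc shift_def)
qed simp

lemma mass_nonneg: "0 \<le> mass x v"
  unfolding mass_def by (intro prod_nonneg) (simp add: W_nonneg)

lemma mass_le_1: "mass x v \<le> 1"
  unfolding mass_def by (intro prod_le_1) (simp add: W_nonneg less_imp_le[OF W_less_1])

lemma sum_mass_gen: "(\<Sum>v\<in>gen b n. mass x v) = 1"
  by (induction n) (auto simp: sum_gen_Suc mass_snoc sum_distrib_left[symmetric] W_sum)

lemma shift_shift: "v \<in> nodes b \<Longrightarrow> shift w (shift v x) = shift (v @ w) x" if "w \<in> nodes b"
  using that by (auto simp: shift_def fun_eq_iff)

lemma component_measurable [measurable]: "u \<in> nodes b \<Longrightarrow> (\<lambda>x. x u) \<in> measurable Om L"
  unfolding Om_def by (rule measurable_component_singleton)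

lemma mass_measurable [measurable]:
  assumes "v \<in> nodes b" shows "(\<lambda>x. mass x v) \<in> borel_measurable Om"
proof -
  have "(\<lambda>x. W (x (take i v)) (v ! i)) \<in> borel_measurable Om" for i
    by (rule measurable_compose[OF component_measurable[OF nodes_take[OF assms]] W_measurable])
  then show ?thesis unfolding mass_def by (intro borel_measurable_prod) auto
qed

lemma shift_measurable [measurable]:
  assumes "v \<in> nodes b" shows "shift v \<in> measurable Om Om"
  unfolding shift_def[abs_def] using assms by (subst (2) Om_def, intro measurable_restrict) simp

lemma splice_measurable:
  "case_prod (splice v) \<in> measurable (Om \<Otimes>\<^sub>M Om) Om"
proof (subst (3) Om_def, unfold splice_def[abs_def] case_prod_beta', intro measurable_restrict)
  fix u assume "u \<in> nodes b"
  then have [measurable]: "(\<lambda>x. x u) \<in> measurable Om L" "(\<lambda>x. x (drop (length v) u)) \<in> measurable Om L"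
    by (auto intro!: component_measurable nodes_drop)
  show "(\<lambda>x. if take (length v) u = v then snd x (drop (length v) u) else fst x u) \<in> measurable (Om \<Otimes>\<^sub>M Om) L"
    by (cases "take (length v) u = v") (simp_all, measurable)
qed

lemma space_OmD: "x \<in> space Om \<Longrightarrow> restrict x (nodes b) = x"
  by (auto simp: Om_def space_PiM PiE_restrict)

lemma shift_splice_same: "v \<in> nodes b \<Longrightarrow> x' \<in> space Om \<Longrightarrow> shift v (splice v x x') = x'"
  using space_OmD[of x'] by (auto simp: shift_def splice_def fun_eq_iff restrict_def split: if_splits)

lemma shift_splice_other:
  "length w = length v \<Longrightarrow> w \<noteq> v \<Longrightarrow> w \<in> nodes b \<Longrightarrow> shift w (splice v x x') = shift w x"
  by (auto simp: shift_def splice_def fun_eq_iff)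

lemma mass_splice:
  assumes "u \<in> nodes b" "length u \<le> length v"
  shows "mass (splice v x x') u = mass x u"
  unfolding mass_def
proof (rule prod.cong[OF refl])
  fix i assume "i \<in> {..<length u}"
  then have "take (length v) (take i u) \<noteq> v" using assms by (auto dest: arg_cong[of _ _ length])
  then show "W (splice v x x' (take i u)) (u ! i) = W (x (take i u)) (u ! i)"
    using assms by (simp add: splice_def nodes_take)
qed

text \<open>On a cylinder the coordinates split into those not below \<open>v\<close>, read from the
  first sample, and those at or below \<open>v\<close>, read from the second. The index sets are
  disjoint, so the product formula reappears.\<close>

lemma distr_splice:
  assumes v: "v \<in> nodes b"
  shows "distr (Om \<Otimes>\<^sub>M Om) Om (case_prod (splice v)) = Om"
proof -
  interpret P: product_prob_space "\<lambda>_. L" "nodes b" by (rule prod_space)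
  have "distr (Om \<Otimes>\<^sub>M Om) Om (case_prod (splice v)) = PiM (nodes b) (\<lambda>_. L)"
  proof (rule P.PiM_eq)
    show "sets (distr (Om \<Otimes>\<^sub>M Om) Om (case_prod (splice v))) = sets (PiM (nodes b) (\<lambda>_. L))"
      by (simp add: Om_def)
    fix J and F :: "node \<Rightarrow> 'a set"
    assume J: "finite J" "J \<subseteq> nodes b" and F: "\<And>j. j \<in> J \<Longrightarrow> F j \<in> sets L"
    define J1 where "J1 = {j \<in> J. take (length v) j \<noteq> v}"
    define J2 where "J2 = {k. v @ k \<in> J}"
    have J1: "J1 \<subseteq> nodes b" "finite J1" using J by (auto simp: J1_def)
    have J2: "J2 \<subseteq> nodes b" "finite J2"
      using J finite_vimageI[OF J(1), of "(@) v"] by (auto simp: J2_def vimage_def inj_def)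
    have split: "J = J1 \<union> (@) v ` J2" "J1 \<inter> (@) v ` J2 = {}"
      by (auto simp: J1_def J2_def image_iff) (metis append_take_drop_id)
    have Fsp: "\<And>j a. j \<in> J \<Longrightarrow> a \<in> F j \<Longrightarrow> a \<in> space L" using F[THEN sets.sets_into_space] by auto
    define A where "A = {x \<in> space Om. \<forall>j\<in>J1. x j \<in> F j}"
    define A' where "A' = {x \<in> space Om. \<forall>k\<in>J2. x k \<in> F (v @ k)}"
    have A: "emeasure Om A = (\<Prod>j\<in>J1. emeasure L (F j))"
      unfolding A_def Om_def by (rule P.emeasure_PiM_Collect[OF J1]) (auto intro!: F simp: J1_def)
    have A': "emeasure Om A' = (\<Prod>k\<in>J2. emeasure L (F (v @ k)))"
      unfolding A'_def Om_def by (rule P.emeasure_PiM_Collect[OF J2]) (auto intro!: F simp: J2_def)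
    have coord: "{x \<in> space Om. x k \<in> F j} \<in> sets Om" if "k \<in> nodes b" "j \<in> J" for k j
      using measurable_sets[OF component_measurable[OF that(1)] F[OF that(2)]]
      by (simp add: vimage_def Int_def conj_commute)
    have Am: "A \<in> sets Om" unfolding A_def using J1
      by (intro sets.sets_Collect_finite_All coord) (auto simp: J1_def)
    have A'm: "A' \<in> sets Om" unfolding A'_def using J2
      by (intro sets.sets_Collect_finite_All coord) (auto simp: J2_def)
    have pre: "case_prod (splice v) -` prod_emb (nodes b) (\<lambda>_. L) J (Pi\<^sub>E J F) \<inter> space (Om \<Otimes>\<^sub>M Om) = A \<times> A'"
    proof (intro set_eqI iffI)
      fix p assume "p \<in> A \<times> A'"
      then obtain x x' where p: "p = (x, x')" "x \<in> A" "x' \<in> A'" by auto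
      have sp: "(x, x') \<in> space (Om \<Otimes>\<^sub>M Om)" using p by (simp add: A_def A'_def space_pair_measure)
      have "splice v x x' \<in> space Om" using measurable_space[OF splice_measurable sp] by simp
      moreover have "splice v x x' j \<in> F j" if "j \<in> J" for j
      proof (cases "take (length v) j = v")
        case True
        then have j: "v @ drop (length v) j = j" by (metis append_take_drop_id)
        then have "drop (length v) j \<in> J2" using that by (simp add: J2_def)
        then have "x' (drop (length v) j) \<in> F j" using p(3) j by (auto simp: A'_def)
        then show ?thesis using True that J by (auto simp: splice_def)
      next
        case False
        then have "j \<in> J1" using that by (simp add: J1_def)
        then show ?thesis using False that J p(2) by (auto simp: splice_def A_def)
      qed
      ultimately show "p \<in> case_prod (splice v) -` prod_emb (nodes b) (\<lambda>_. L) J (Pi\<^sub>E J F) \<inter> space (Om \<Otimes>\<^sub>M Om)"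
        using sp p(1) by (auto simp: prod_emb_def Om_def space_PiM)
    next
      fix p assume "p \<in> case_prod (splice v) -` prod_emb (nodes b) (\<lambda>_. L) J (Pi\<^sub>E J F) \<inter> space (Om \<Otimes>\<^sub>M Om)"
      then obtain x x' where p: "p = (x, x')" "x \<in> space Om" "x' \<in> space Om" "\<And>j. j \<in> J \<Longrightarrow> splice v x x' j \<in> F j"
        by (auto simp: prod_emb_def space_pair_measure PiE_iff)
      have "x j \<in> F j" if "j \<in> J1" for j
        using p(4)[of j] that J1 by (auto simp: J1_def splice_def split: if_splits)
      moreover have "x' k \<in> F (v @ k)" if "k \<in> J2" for k
        using p(4)[of "v @ k"] that J2 v by (auto simp: J2_def splice_def)
      ultimately show "p \<in> A \<times> A'" using p by (auto simp: A_def A'_def)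
    qed
    have "emeasure (distr (Om \<Otimes>\<^sub>M Om) Om (case_prod (splice v))) (prod_emb (nodes b) (\<lambda>_. L) J (Pi\<^sub>E J F))
        = emeasure (Om \<Otimes>\<^sub>M Om) (A \<times> A')"
      unfolding pre[symmetric] using J F
      by (intro emeasure_distr splice_measurable) (auto simp: Om_def intro!: sets_PiM_I)
    also have "\<dots> = emeasure Om A * emeasure Om A'" by (rule Om.emeasure_pair_measure_Times[OF Am A'm])
    also have "\<dots> = (\<Prod>j\<in>J. emeasure L (F j))"
      unfolding A A' split(1)
      using J1 J2 split(2) by (subst prod.union_disjoint) (auto simp: prod.reindex inj_on_def)
    finally show "emeasure (distr (Om \<Otimes>\<^sub>M Om) Om (case_prod (splice v))) (prod_emb (nodes b) (\<lambda>_. L) J (Pi\<^sub>E J F)) =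
        (\<Prod>j\<in>J. emeasure L (F j))" .
  qed
  then show ?thesis by (simp add: Om_def)
qed

lemma integrable_Om_bounded:
  fixes f :: "(node \<Rightarrow> 'a) \<Rightarrow> real"
  assumes "f \<in> borel_measurable Om" "\<And>x. x \<in> space Om \<Longrightarrow> \<bar>f x\<bar> \<le> K"
  shows "integrable Om f"
  using assms by (intro Om.integrable_const_bound[where B=K]) auto

lemma integral_splice:
  fixes f :: "(node \<Rightarrow> 'a) \<Rightarrow> real"
  assumes v: "v \<in> nodes b" and f [measurable]: "f \<in> borel_measurable Om"
    and K: "\<And>x. x \<in> space Om \<Longrightarrow> \<bar>f x\<bar> \<le> K"
  shows "(\<integral>x. f x \<partial>Om) = (\<integral>x. (\<integral>x'. f (splice v x x') \<partial>Om) \<partial>Om)"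
proof -
  note splice_measurable[of v, measurable]
  have "integrable (Om \<Otimes>\<^sub>M Om) (\<lambda>p. f (case_prod (splice v) p))"
    using measurable_space[OF splice_measurable[of v]] K
    by (intro OmOm.integrable_const_bound[where B=K] AE_I2) auto
  then have "integrable (Om \<Otimes>\<^sub>M Om) (\<lambda>(x, x'). f (splice v x x'))" by (simp add: case_prod_beta')
  from OmOm.integral_fst'[OF this]
  have "(\<integral>x. (\<integral>x'. f (splice v x x') \<partial>Om) \<partial>Om) = (\<integral>p. f (case_prod (splice v) p) \<partial>(Om \<Otimes>\<^sub>M Om))"
    by (simp add: case_prod_beta')
  also have "\<dots> = (\<integral>x. f x \<partial>distr (Om \<Otimes>\<^sub>M Om) Om (case_prod (splice v)))"
    by (rule integral_distr[symmetric]) measurable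
  finally show ?thesis by (simp add: distr_splice[OF v])
qed

text \<open>The mass of \<open>v\<close> reads only the vectors at proper prefixes of
  \<open>v\<close>, the shifted configuration only those at and below \<open>v\<close>. Resampling
  the latter leaves the former unchanged.\<close>

lemma integral_shift:
  fixes f :: "real \<Rightarrow> (node \<Rightarrow> 'a) \<Rightarrow> real"
  assumes v: "v \<in> nodes b" and f [measurable]: "(\<lambda>(s, x). f s x) \<in> borel_measurable (borel \<Otimes>\<^sub>M Om)"
    and K: "\<And>s x. 0 \<le> s \<Longrightarrow> s \<le> 1 \<Longrightarrow> \<bar>f s x\<bar> \<le> K"
  shows "(\<integral>x. f (mass x v) (shift v x) \<partial>Om) = (\<integral>x. (\<integral>x'. f (mass x v) x' \<partial>Om) \<partial>Om)"
proof -
  note [measurable] = mass_measurable[OF v] shift_measurable[OF v]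
  have "(\<integral>x. f (mass x v) (shift v x) \<partial>Om)
      = (\<integral>x. (\<integral>x'. f (mass (splice v x x') v) (shift v (splice v x x')) \<partial>Om) \<partial>Om)"
    by (rule integral_splice[OF v, where K=K]) (auto intro!: K mass_nonneg mass_le_1)
  also have "\<dots> = (\<integral>x. (\<integral>x'. f (mass x v) x' \<partial>Om) \<partial>Om)"
    by (intro Bochner_Integration.integral_cong refl) (simp add: mass_splice shift_splice_same v)
  finally show ?thesis .
qed

lemma integral_root:
  fixes f :: "'a \<Rightarrow> real"
  assumes "f \<in> borel_measurable L"
  shows "(\<integral>x. f (x []) \<partial>Om) = (\<integral>a. f a \<partial>L)"
proof -
  have "distr Om L (\<lambda>x. x []) = L" unfolding Om_def
    by (rule distr_PiM_component[of "nodes b" "\<lambda>_. L"]) (auto simp: prob_space_axioms)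
  then show ?thesis using integral_distr[of "\<lambda>x. x []" Om L f] assms by simp
qed

text \<open>Splitting off the first generation keeps the mass of a child independent of the vectors
  at and below it, so every generation contributes a factor \<open>\<rho>\<close>.\<close>

lemma sum_mass_square: "(\<integral>x. (\<Sum>v\<in>gen b n. (mass x v)\<^sup>2) \<partial>Om) = \<rho> ^ n"
proof (induction n)
  case 0 then show ?case by (simp add: Om.prob_space)
next
  case (Suc n)
  define G where "G x = (\<Sum>v\<in>gen b n. (mass x v)\<^sup>2)" for x
  have Gm [measurable]: "G \<in> borel_measurable Om" unfolding G_def[abs_def]
    by (intro borel_measurable_sum borel_measurable_power mass_measurable gen_nodes)
  have G: "0 \<le> G x" "G x \<le> 1" for x
  proof -
    show "0 \<le> G x" unfolding G_def by (intro sum_nonneg) auto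
    have "G x \<le> (\<Sum>v\<in>gen b n. mass x v)" unfolding G_def power2_eq_square
      by (intro sum_mono mult_left_le mass_le_1 mass_nonneg)
    then show "G x \<le> 1" by (simp add: sum_mass_gen)
  qed
  have bd: "\<bar>s\<^sup>2 * G x\<bar> \<le> 1" if "0 \<le> s" "s \<le> 1" for s x
    using mult_le_one[of "s\<^sup>2" "G x"] G[of x] that by (simp add: power_le_one abs_mult)
  have m1 [measurable]: "(\<lambda>x. mass x [j]) \<in> borel_measurable Om" "shift [j] \<in> measurable Om Om" if "j < b" for j
    using that by (auto intro!: mass_measurable shift_measurable)
  have "(\<integral>x. (\<Sum>v\<in>gen b (Suc n). (mass x v)\<^sup>2) \<partial>Om) = (\<integral>x. (\<Sum>j<b. (mass x [j])\<^sup>2 * G (shift [j] x)) \<partial>Om)"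
  proof (intro Bochner_Integration.integral_cong refl)
    fix x
    show "(\<Sum>v\<in>gen b (Suc n). (mass x v)\<^sup>2) = (\<Sum>j<b. (mass x [j])\<^sup>2 * G (shift [j] x))"
      using sum_gen_add[of "\<lambda>v. (mass x v)\<^sup>2" b "Suc 0" n]
      by (simp add: sum_gen_1 G_def sum_distrib_left mass_append[OF gen_nodes, of _ n x "[_]", simplified] power_mult_distrib)
  qed
  also have "\<dots> = (\<Sum>j<b. \<integral>x. (mass x [j])\<^sup>2 * G (shift [j] x) \<partial>Om)"
    by (intro Bochner_Integration.integral_sum integrable_Om_bounded[where K=1] bd mass_nonneg mass_le_1) auto
  also have "\<dots> = (\<Sum>j<b. \<integral>x. (\<integral>x'. (mass x [j])\<^sup>2 * G x' \<partial>Om) \<partial>Om)"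
    by (intro sum.cong refl integral_shift[where K=1] bd) auto
  also have "\<dots> = (\<Sum>j<b. (\<integral>x. (mass x [j])\<^sup>2 \<partial>Om) * \<rho> ^ n)"
    using Suc by (simp add: G_def)
  also have "\<dots> = (\<integral>x. (\<Sum>j<b. (mass x [j])\<^sup>2) \<partial>Om) * \<rho> ^ n"
    unfolding sum_distrib_right[symmetric]
    by (subst Bochner_Integration.integral_sum)
       (auto intro!: integrable_Om_bounded[where K=1] power_le_one mass_nonneg mass_le_1)
  also have "(\<integral>x. (\<Sum>j<b. (mass x [j])\<^sup>2) \<partial>Om) = \<rho>"
    unfolding \<rho>_def mass_single power2_eq_square by (rule integral_root) measurable
  finally show ?case by simp
qed

section \<open>Random characteristics of nodes, their truncated totals and means\<close>

definition mark :: "real \<Rightarrow> (real \<Rightarrow> (node \<Rightarrow> 'a) \<Rightarrow> real) \<Rightarrow> bool" where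
  "mark C \<xi> \<longleftrightarrow> (\<lambda>(s, x). \<xi> s x) \<in> borel_measurable (borel \<Otimes>\<^sub>M Om) \<and> 0 \<le> C \<and> (\<forall>s x. \<bar>\<xi> s x\<bar> \<le> C * ind s)"

text \<open>As for characteristics of general branching processes, \<open>\<xi>\<close> sees the
  mass of a node and the vectors at and below it. Truncation at \<open>h\<close> keeps the sum
  finite even where the tree is infinite.\<close>

definition total :: "(real \<Rightarrow> (node \<Rightarrow> 'a) \<Rightarrow> real) \<Rightarrow> nat \<Rightarrow> real \<Rightarrow> (node \<Rightarrow> 'a) \<Rightarrow> real" where
  "total \<xi> h y x = (\<Sum>v\<in>below b h. \<xi> (y * mass x v) (shift v x))"

definition mean :: "(real \<Rightarrow> (node \<Rightarrow> 'a) \<Rightarrow> real) \<Rightarrow> nat \<Rightarrow> real \<Rightarrow> real" where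
  "mean \<xi> h y = (\<integral>x. total \<xi> h y x \<partial>Om)"

lemma markD:
  assumes "mark C \<xi>"
  shows "(\<lambda>(s, x). \<xi> s x) \<in> borel_measurable (borel \<Otimes>\<^sub>M Om)" "0 \<le> C" "\<bar>\<xi> s x\<bar> \<le> C * ind s"
  using assms by (auto simp: mark_def)

lemma mark_ind: "mark 1 (\<lambda>s x. ind s)"
  using ind_bounds(1) by (auto simp: mark_def)

lemma total_measurable_pair:
  assumes "mark C \<xi>"
  shows "(\<lambda>(y, x). total \<xi> h y x) \<in> borel_measurable (borel \<Otimes>\<^sub>M Om)"
  unfolding total_def case_prod_beta'
proof (intro borel_measurable_sum)
  fix v assume "v \<in> below b h"
  then have v: "v \<in> nodes b" by (rule below_nodes)
  note [measurable] = mass_measurable[OF v] shift_measurable[OF v]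
  have "(\<lambda>p. (fst p * mass (snd p) v, shift v (snd p))) \<in> measurable (borel \<Otimes>\<^sub>M Om) (borel \<Otimes>\<^sub>M Om)" by measurable
  from measurable_compose[OF this markD(1)[OF assms]]
  show "(\<lambda>p. \<xi> (fst p * mass (snd p) v) (shift v (snd p))) \<in> borel_measurable (borel \<Otimes>\<^sub>M Om)" by simp
qed

lemma total_measurable:
  assumes "mark C \<xi>" and [measurable]: "f \<in> borel_measurable N" "g \<in> measurable N Om"
  shows "(\<lambda>x. total \<xi> h (f x) (g x)) \<in> borel_measurable N"
  using measurable_compose[OF measurable_Pair[OF assms(2,3)] total_measurable_pair[OF assms(1), of h]] by simp

lemma mean_measurable [measurable]:
  assumes "mark C \<xi>"
  shows "mean \<xi> h \<in> borel_measurable borel"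
  unfolding mean_def[abs_def] by (rule Om.borel_measurable_lebesgue_integral[OF total_measurable_pair[OF assms]])

lemma sum_ind_gen: "0 \<le> y \<Longrightarrow> (\<Sum>v\<in>gen b i. ind (y * mass x v)) \<le> y"
proof -
  assume y: "0 \<le> y"
  have "(\<Sum>v\<in>gen b i. ind (y * mass x v)) \<le> (\<Sum>v\<in>gen b i. y * mass x v)"
    using y by (intro sum_mono ind_bounds mult_nonneg_nonneg mass_nonneg)
  then show ?thesis by (simp add: sum_distrib_left[symmetric] sum_mass_gen)
qed

lemma total_le_total_ind:
  assumes "mark C \<xi>"
  shows "\<bar>total \<xi> h y x\<bar> \<le> C * total (\<lambda>s x. ind s) h y x"
  unfolding total_def sum_distrib_left by (rule order_trans[OF sum_abs]) (intro sum_mono markD[OF assms])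

lemma total_ind_le: "0 \<le> y \<Longrightarrow> total (\<lambda>s x. ind s) h y x \<le> real h * y"
proof -
  assume "0 \<le> y"
  then have "(\<Sum>i<h. \<Sum>v\<in>gen b i. ind (y * mass x v)) \<le> (\<Sum>i<h. y)" by (intro sum_mono sum_ind_gen)
  then show ?thesis by (simp add: total_def sum_below)
qed

lemma total_bound:
  assumes "mark C \<xi>" "0 \<le> y"
  shows "\<bar>total \<xi> h y x\<bar> \<le> C * (real h * y)"
  by (rule order_trans[OF total_le_total_ind[OF assms(1)] mult_left_mono[OF total_ind_le[OF assms(2)] markD(2)[OF assms(1)]]])

lemma total_integrable:
  assumes "mark C \<xi>" "0 \<le> y"
  shows "integrable Om (total \<xi> h y)"
  by (rule integrable_Om_bounded[where K="C * (real h * y)"])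
     (intro total_measurable[OF assms(1)] measurable_const measurable_ident_sets refl, simp, rule total_bound[OF assms])

text \<open>Masses multiply and shifts compose, so the remainder consists of totals of the subtrees
  rooted in generation \<open>n\<close>, which are independent given their root masses. The case
  \<open>n = 1\<close> gives the recursion of the means, large \<open>n\<close> the variance
  estimate.\<close>

lemma total_add:
  "total \<xi> (n + h) y x = total \<xi> n y x + (\<Sum>u\<in>gen b n. total \<xi> h (y * mass x u) (shift u x))"
proof -
  have "\<xi> (y * mass x (u @ w)) (shift (u @ w) x) = \<xi> (y * mass x u * mass (shift u x) w) (shift w (shift u x))"
    if "u \<in> gen b n" "w \<in> below b h" for u w
    using that by (simp add: mass_append below_nodes shift_shift gen_nodes mult.assoc)
  then show ?thesis unfolding total_def sum_below_add by simp
qed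

lemma integral_total_shift:
  assumes \<xi>: "mark C \<xi>" and y: "0 \<le> y" and u: "u \<in> nodes b"
  shows "(\<integral>x. total \<xi> h (y * mass x u) (shift u x) \<partial>Om) = (\<integral>x. mean \<xi> h (y * mass x u) \<partial>Om)"
  unfolding mean_def
proof (rule integral_shift[OF u, where f="\<lambda>s x. total \<xi> h (y * s) x" and K="C * (real h * y)"])
  show "(\<lambda>(s, x). total \<xi> h (y * s) x) \<in> borel_measurable (borel \<Otimes>\<^sub>M Om)"
    unfolding case_prod_beta' by (rule total_measurable[OF \<xi>]) measurable
  fix s x assume s: "0 \<le> (s::real)" "s \<le> 1"
  have "\<bar>total \<xi> h (y * s) x\<bar> \<le> C * (real h * (y * s))" using s y by (intro total_bound[OF \<xi>]) simp
  also have "\<dots> \<le> C * (real h * y)"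
    using s y markD(2)[OF \<xi>] by (intro mult_left_mono mult_left_le) auto
  finally show "\<bar>total \<xi> h (y * s) x\<bar> \<le> C * (real h * y)" .
qed

lemma total_shift_integrable:
  assumes \<xi>: "mark C \<xi>" and y: "0 \<le> y" and u: "u \<in> nodes b"
  shows "integrable Om (\<lambda>x. total \<xi> h (y * mass x u) (shift u x))"
proof (rule integrable_Om_bounded[where K="C * (real h * y)"])
  note [measurable] = mass_measurable[OF u] shift_measurable[OF u]
  show "(\<lambda>x. total \<xi> h (y * mass x u) (shift u x)) \<in> borel_measurable Om"
    by (intro total_measurable[OF \<xi>]) measurable
  fix x
  have "\<bar>total \<xi> h (y * mass x u) (shift u x)\<bar> \<le> C * (real h * (y * mass x u))"
    using y by (intro total_bound[OF \<xi>] mult_nonneg_nonneg mass_nonneg)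
  also have "\<dots> \<le> C * (real h * y)"
    using y markD(2)[OF \<xi>] mass_le_1 by (intro mult_left_mono mult_left_le) auto
  finally show "\<bar>total \<xi> h (y * mass x u) (shift u x)\<bar> \<le> C * (real h * y)" .
qed

text \<open>Since \<open>ind y = y * base y\<close>, the decomposition at the root is the recursion
  of \<open>pot base\<close> multiplied by \<open>y\<close>: a sum over children is a size-biased
  average once each child is divided by its mass.\<close>

lemma mean_ind: "0 \<le> y \<Longrightarrow> mean (\<lambda>s x. ind s) h y = y * pot base h y"
proof (induction h arbitrary: y)
  case 0 then show ?case by (simp add: mean_def total_def below_def)
next
  case (Suc h)
  let ?\<xi> = "\<lambda>s (x::node \<Rightarrow> 'a). ind s"
  have "mean ?\<xi> (Suc h) y = (\<integral>x. ind y + (\<Sum>j<b. total ?\<xi> h (y * mass x [j]) (shift [j] x)) \<partial>Om)"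
    unfolding mean_def
  proof (intro Bochner_Integration.integral_cong refl)
    show "total ?\<xi> (Suc h) y x = ind y + (\<Sum>j<b. total ?\<xi> h (y * mass x [j]) (shift [j] x))" for x
      using total_add[of ?\<xi> "Suc 0" h y x] by (simp add: sum_gen_1 total_def[of _ "Suc 0"] sum_below)
  qed
  also have "\<dots> = ind y + (\<integral>x. (\<Sum>j<b. total ?\<xi> h (y * mass x [j]) (shift [j] x)) \<partial>Om)"
    using Suc.prems
    by (subst Bochner_Integration.integral_add)
       (auto simp: Om.prob_space intro!: Bochner_Integration.integrable_sum total_shift_integrable[OF mark_ind])
  also have "(\<integral>x. (\<Sum>j<b. total ?\<xi> h (y * mass x [j]) (shift [j] x)) \<partial>Om) = (\<Sum>j<b. \<integral>x. mean ?\<xi> h (y * mass x [j]) \<partial>Om)"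
    using Suc.prems
    by (subst Bochner_Integration.integral_sum)
       (auto intro!: total_shift_integrable[OF mark_ind] sum.cong integral_total_shift[OF mark_ind])
  also have "\<dots> = (\<Sum>j<b. \<integral>x. y * (W (x []) j * pot base h (y * W (x []) j)) \<partial>Om)"
    using Suc.prems by (subst Suc.IH) (auto simp: mass_single W_nonneg mult.assoc)
  also have "\<dots> = (\<Sum>j<b. \<integral>a. y * (W a j * pot base h (y * W a j)) \<partial>L)"
  proof (intro sum.cong refl integral_root)
    have [measurable]: "pot base h \<in> borel_measurable borel" using bdd_borelD(1)[OF pot_bdd_borel[OF kernel_base]] .
    show "(\<lambda>a. y * (W a j * pot base h (y * W a j))) \<in> borel_measurable L" for j by measurable
  qed
  also have "\<dots> = y * avg (pot base h) y"
  proof -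
    have [measurable]: "pot base h \<in> borel_measurable borel" using bdd_borelD(1)[OF pot_bdd_borel[OF kernel_base]] .
    have "integrable L (\<lambda>a. W a j * pot base h (y * W a j))" for j
    proof (rule integrable_const_bound[where B=pot_bound])
      show "AE a in L. norm (W a j * pot base h (y * W a j)) \<le> pot_bound"
      proof (rule AE_I2)
        fix a
        have "\<bar>W a j\<bar> * \<bar>pot base h (y * W a j)\<bar> \<le> 1 * pot_bound"
          using W_nonneg[of a j] less_imp_le[OF W_less_1[of a j]]
          by (intro mult_mono bdd_borelD(2)[OF pot_bdd_borel[OF kernel_base]]) auto
        then show "norm (W a j * pot base h (y * W a j)) \<le> pot_bound" by (simp add: abs_mult)
      qed
    qed measurable
    then show ?thesis unfolding avg_def by (subst Bochner_Integration.integral_sum) (auto simp: sum_distrib_left)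
  qed
  finally show ?case by (simp add: ind_bounds(5) algebra_simps)
qed

text \<open>The factor is free of \<open>h\<close> because potentials are bounded; counting
  generation by generation gives only \<open>mean_abs_le\<close>.\<close>

lemma mean_bound:
  assumes "mark C \<xi>" "0 \<le> y"
  shows "\<bar>mean \<xi> h y\<bar> \<le> C * pot_bound * y"
proof -
  have "\<bar>mean \<xi> h y\<bar> \<le> (\<integral>x. \<bar>total \<xi> h y x\<bar> \<partial>Om)" unfolding mean_def by (rule integral_abs_bound)
  also have "\<dots> \<le> (\<integral>x. C * total (\<lambda>s x. ind s) h y x \<partial>Om)"
    by (intro integral_mono total_le_total_ind[OF assms(1)] integrable_abs integrable_mult_right
        total_integrable[OF assms] total_integrable[OF mark_ind assms(2)])
  also have "\<dots> = C * (y * pot base h y)" using mean_ind[OF assms(2)] by (simp add: mean_def)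
  also have "\<dots> \<le> C * (y * pot_bound)"
    using assms(2) markD(2)[OF assms(1)] by (intro mult_left_mono pot_le_bound kernel_base)
  finally show ?thesis by (simp add: mult_ac)
qed

lemma mark_scaled_ind:
  assumes [measurable]: "m \<in> borel_measurable Om" and m: "\<And>x. 0 \<le> m x" "\<And>x. m x \<le> 1"
  shows "mark 1 (\<lambda>s x. ind (s * m x))"
proof -
  have "(\<lambda>(s, x). ind (s * m x)) \<in> borel_measurable (borel \<Otimes>\<^sub>M Om)" by measurable
  moreover have "ind (s * m x) \<le> ind s" for s x
  proof (cases "s \<ge> 0")
    case True
    then have "s * m x \<le> s" using m by (simp add: mult_left_le)
    then show ?thesis by (simp add: ind_def)
  next
    case False
    then have "s * m x \<le> 0" using m by (simp add: mult_le_0_iff)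
    then show ?thesis by (simp add: ind_def)
  qed
  ultimately show ?thesis using ind_bounds(1) by (auto simp: mark_def)
qed

text \<open>The value \<open>m (shift v x)\<close> is independent of \<open>mass x v\<close>. Once
  it is frozen at \<open>m x'\<close>, the sum over \<open>v\<close> counts nodes of mass at least
  \<open>1\<close> in a tree started from \<open>y * m x'\<close>; Fubini's theorem interchanges
  freezing and summing.\<close>

lemma mean_scaled_ind:
  assumes [measurable]: "m \<in> borel_measurable Om" and m: "\<And>x. 0 \<le> m x" "\<And>x. m x \<le> 1" and y: "0 \<le> y"
  shows "mean (\<lambda>s x. ind (s * m x)) h y = (\<integral>x'. y * m x' * pot base h (y * m x') \<partial>Om)"
proof -
  have ib: "\<bar>ind s\<bar> \<le> 1" for s using ind_bounds[of s] by simp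
  have mm: "(\<lambda>x. ind (y * mass x v * m (shift v x))) \<in> borel_measurable Om" if "v \<in> nodes b" for v
  proof -
    note [measurable] = mass_measurable[OF that] shift_measurable[OF that]
    show ?thesis by measurable
  qed
  have mm2: "(\<lambda>p. ind (y * mass (fst p) v * m (snd p))) \<in> borel_measurable (Om \<Otimes>\<^sub>M Om)" if "v \<in> nodes b" for v
  proof -
    note [measurable] = mass_measurable[OF that]
    show ?thesis by measurable
  qed
  have "mean (\<lambda>s x. ind (s * m x)) h y = (\<Sum>v\<in>below b h. \<integral>x. ind (y * mass x v * m (shift v x)) \<partial>Om)"
    unfolding mean_def total_def
    by (intro Bochner_Integration.integral_sum integrable_Om_bounded[where K=1] mm ib) (auto dest: below_nodes)
  also have "\<dots> = (\<Sum>v\<in>below b h. \<integral>x. (\<integral>x'. ind (y * mass x v * m x') \<partial>Om) \<partial>Om)"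
  proof (intro sum.cong refl)
    fix v assume "v \<in> below b h"
    then have v: "v \<in> nodes b" by (rule below_nodes)
    show "(\<integral>x. ind (y * mass x v * m (shift v x)) \<partial>Om) = (\<integral>x. (\<integral>x'. ind (y * mass x v * m x') \<partial>Om) \<partial>Om)"
      by (rule integral_shift[OF v, where f="\<lambda>s x. ind (y * s * m x)" and K=1]) (measurable, rule ib)
  qed
  also have "\<dots> = (\<Sum>v\<in>below b h. \<integral>x'. (\<integral>x. ind (y * mass x v * m x') \<partial>Om) \<partial>Om)"
  proof (intro sum.cong refl OmOm.Fubini_integral[symmetric])
    fix v assume "v \<in> below b h"
    then have v: "v \<in> nodes b" by (rule below_nodes)
    show "integrable (Om \<Otimes>\<^sub>M Om) (\<lambda>(x, x'). ind (y * mass x v * m x'))"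
      using mm2[OF v] ib by (intro OmOm.integrable_const_bound[where B=1]) (auto simp: case_prod_beta')
  qed
  also have "\<dots> = (\<integral>x'. (\<Sum>v\<in>below b h. \<integral>x. ind (y * mass x v * m x') \<partial>Om) \<partial>Om)"
  proof (rule Bochner_Integration.integral_sum[symmetric])
    fix v assume "v \<in> below b h"
    then have v: "v \<in> nodes b" by (rule below_nodes)
    have "integrable (Om \<Otimes>\<^sub>M Om) (\<lambda>(x, x'). ind (y * mass x v * m x'))"
      using mm2[OF v] ib by (intro OmOm.integrable_const_bound[where B=1]) (auto simp: case_prod_beta')
    from OmOm.integrable_snd[OF this] show "integrable Om (\<lambda>x'. \<integral>x. ind (y * mass x v * m x') \<partial>Om)" by simp
  qed
  also have "\<dots> = (\<integral>x'. mean (\<lambda>s x. ind s) h (y * m x') \<partial>Om)"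
  proof (intro Bochner_Integration.integral_cong refl)
    fix x'
    show "(\<Sum>v\<in>below b h. \<integral>x. ind (y * mass x v * m x') \<partial>Om) = mean (\<lambda>s x. ind s) h (y * m x')"
      unfolding mean_def total_def mult.commute[of _ "m x'"] mult.assoc[symmetric]
    proof (rule Bochner_Integration.integral_sum[symmetric], rule integrable_Om_bounded[where K=1])
      fix v assume "v \<in> below b h"
      then have [measurable]: "(\<lambda>x. mass x v) \<in> borel_measurable Om" by (intro mass_measurable below_nodes)
      show "(\<lambda>x. ind (m x' * y * mass x v)) \<in> borel_measurable Om" by measurable
    qed (rule ib)
  qed
  also have "\<dots> = (\<integral>x'. y * m x' * pot base h (y * m x') \<partial>Om)"
    using m y by (subst mean_ind) auto
  finally show ?thesis .
qed

section \<open>Centred contributions of the subtrees of one generation\<close>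

definition fluct :: "(real \<Rightarrow> (node \<Rightarrow> 'a) \<Rightarrow> real) \<Rightarrow> nat \<Rightarrow> real \<Rightarrow> node \<Rightarrow> (node \<Rightarrow> 'a) \<Rightarrow> real" where
  "fluct \<xi> h y u x = total \<xi> h (y * mass x u) (shift u x) - mean \<xi> h (y * mass x u)"

lemma fluct_measurable:
  assumes "mark C \<xi>" "u \<in> nodes b"
  shows "fluct \<xi> h y u \<in> borel_measurable Om"
proof -
  note [measurable] = mass_measurable[OF assms(2)] shift_measurable[OF assms(2)] mean_measurable[OF assms(1), of h]
  show ?thesis
    unfolding fluct_def[abs_def] by (intro borel_measurable_diff total_measurable[OF assms(1)]) measurable
qed

lemma mean_abs_le:
  assumes \<xi>: "mark C \<xi>" and y: "0 \<le> y"
  shows "\<bar>mean \<xi> h y\<bar> \<le> C * (real h * y)"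
proof -
  have "\<bar>mean \<xi> h y\<bar> \<le> (\<integral>x. \<bar>total \<xi> h y x\<bar> \<partial>Om)" unfolding mean_def by (rule integral_abs_bound)
  also have "\<dots> \<le> (\<integral>x. C * (real h * y) \<partial>Om)"
    by (intro integral_mono integrable_abs total_integrable[OF \<xi> y] total_bound[OF \<xi> y] Om.integrable_const)
  finally show ?thesis by (simp add: Om.prob_space)
qed

lemma fluct_bound:
  assumes \<xi>: "mark C \<xi>" and y: "0 \<le> y"
  shows "\<bar>fluct \<xi> h y u x\<bar> \<le> 2 * C * real h * y * mass x u"
proof -
  have ym: "0 \<le> y * mass x u" using y mass_nonneg by simp
  show ?thesis
    unfolding fluct_def
    using total_bound[OF \<xi> ym, of h "shift u x"] mean_abs_le[OF \<xi> ym, of h] by (simp add: mult_ac)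
qed

text \<open>Resampling at and below \<open>u\<close> affects neither the factor of \<open>w\<close>
  nor the mass of \<open>u\<close>, and given these the factor of \<open>u\<close> is
  centred.\<close>

lemma fluct_orthogonal:
  assumes \<xi>: "mark C \<xi>" and y: "0 \<le> y" and u: "u \<in> gen b n" and w: "w \<in> gen b n" and ne: "u \<noteq> w"
  shows "(\<integral>x. fluct \<xi> h y u x * fluct \<xi> h y w x \<partial>Om) = 0"
proof -
  have un: "u \<in> nodes b" "w \<in> nodes b" "length w = length u" using u w by (auto simp: gen_def)
  define K where "K = 2 * C * real h * y"
  have K0: "0 \<le> K" using y markD(2)[OF \<xi>] by (simp add: K_def)
  have K: "\<bar>fluct \<xi> h y v x\<bar> \<le> K" for v x
  proof -
    have "\<bar>fluct \<xi> h y v x\<bar> \<le> K * mass x v" using fluct_bound[OF \<xi> y] by (simp add: K_def)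
    also have "\<dots> \<le> K" using mass_le_1 K0 by (rule mult_left_le)
    finally show ?thesis .
  qed
  have "(\<integral>x. fluct \<xi> h y u x * fluct \<xi> h y w x \<partial>Om)
      = (\<integral>x. (\<integral>x'. fluct \<xi> h y u (splice u x x') * fluct \<xi> h y w (splice u x x') \<partial>Om) \<partial>Om)"
    using K K0 un by (intro integral_splice[where K="K * K"] borel_measurable_times fluct_measurable[OF \<xi>])
      (auto simp: abs_mult intro!: mult_mono)
  also have "\<dots> = (\<integral>x. (\<integral>x'. (total \<xi> h (y * mass x u) x' - mean \<xi> h (y * mass x u)) * fluct \<xi> h y w x \<partial>Om) \<partial>Om)"
    using un ne by (intro Bochner_Integration.integral_cong refl)
      (simp add: fluct_def mass_splice shift_splice_same shift_splice_other)
  also have "\<dots> = (\<integral>x. 0 \<partial>Om)"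
  proof (intro Bochner_Integration.integral_cong refl)
    fix x
    have ym: "0 \<le> y * mass x u" using y mass_nonneg by simp
    have "(\<integral>x'. total \<xi> h (y * mass x u) x' - mean \<xi> h (y * mass x u) \<partial>Om) = 0"
      by (subst Bochner_Integration.integral_diff[OF total_integrable[OF \<xi> ym]]) (auto simp: mean_def Om.prob_space)
    then show "(\<integral>x'. (total \<xi> h (y * mass x u) x' - mean \<xi> h (y * mass x u)) * fluct \<xi> h y w x \<partial>Om) = 0"
      by simp
  qed
  finally show ?thesis by simp
qed

text \<open>The cross terms vanish. Each diagonal term is at most a constant times the squared mass
  of its node, and \<open>sum_mass_square\<close> evaluates the sum of these squares.\<close>

lemma fluct_second_moment:
  assumes \<xi>: "mark C \<xi>" and y: "0 \<le> y"
  shows "(\<integral>x. (\<Sum>u\<in>gen b n. fluct \<xi> h y u x)\<^sup>2 \<partial>Om) \<le> (2 * C * real h * y)\<^sup>2 * \<rho> ^ n"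
proof -
  define K where "K = 2 * C * real h * y"
  have K0: "0 \<le> K" using y markD(2)[OF \<xi>] by (simp add: K_def)
  have Km: "\<bar>fluct \<xi> h y v x\<bar> \<le> K * mass x v" for v x using fluct_bound[OF \<xi> y] by (simp add: K_def)
  have K: "\<bar>fluct \<xi> h y v x\<bar> \<le> K" for v x
    using order_trans[OF Km mult_left_le[OF mass_le_1 K0]] .
  have int: "integrable Om (\<lambda>x. fluct \<xi> h y u x * fluct \<xi> h y w x)" if "u \<in> nodes b" "w \<in> nodes b" for u w
    using K K0 that by (intro integrable_Om_bounded[where K="K * K"] borel_measurable_times fluct_measurable[OF \<xi>])
      (auto simp: abs_mult intro!: mult_mono)
  have "(\<integral>x. (\<Sum>u\<in>gen b n. fluct \<xi> h y u x)\<^sup>2 \<partial>Om)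
      = (\<integral>x. (\<Sum>u\<in>gen b n. \<Sum>w\<in>gen b n. fluct \<xi> h y u x * fluct \<xi> h y w x) \<partial>Om)"
    by (simp add: power2_eq_square sum_product)
  also have "\<dots> = (\<Sum>u\<in>gen b n. \<Sum>w\<in>gen b n. \<integral>x. fluct \<xi> h y u x * fluct \<xi> h y w x \<partial>Om)"
    by (subst Bochner_Integration.integral_sum, intro Bochner_Integration.integrable_sum int)
       (auto intro!: sum.cong Bochner_Integration.integral_sum int dest: gen_nodes)
  also have "\<dots> = (\<Sum>u\<in>gen b n. \<Sum>w\<in>gen b n. if u = w then (\<integral>x. (fluct \<xi> h y u x)\<^sup>2 \<partial>Om) else 0)"
    by (intro sum.cong refl) (auto simp: fluct_orthogonal[OF \<xi> y] power2_eq_square)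
  also have "\<dots> = (\<Sum>u\<in>gen b n. \<integral>x. (fluct \<xi> h y u x)\<^sup>2 \<partial>Om)" by simp
  also have "\<dots> \<le> (\<Sum>u\<in>gen b n. \<integral>x. K\<^sup>2 * (mass x u)\<^sup>2 \<partial>Om)"
  proof (intro sum_mono integral_mono)
    fix u assume "u \<in> gen b n"
    then have u: "u \<in> nodes b" by (rule gen_nodes)
    show "integrable Om (\<lambda>x. (fluct \<xi> h y u x)\<^sup>2)" using int[OF u u] by (simp add: power2_eq_square)
    show "integrable Om (\<lambda>x. K\<^sup>2 * (mass x u)\<^sup>2)"
      by (intro integrable_mult_right integrable_Om_bounded[where K=1] borel_measurable_power mass_measurable u)
         (auto intro!: power_le_one mass_nonneg mass_le_1)
    show "(fluct \<xi> h y u x)\<^sup>2 \<le> K\<^sup>2 * (mass x u)\<^sup>2" for x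
      using Km[of u x] unfolding power_mult_distrib[symmetric] by (metis abs_ge_zero power2_abs power_mono)
  qed
  also have "\<dots> = K\<^sup>2 * (\<integral>x. (\<Sum>u\<in>gen b n. (mass x u)\<^sup>2) \<partial>Om)"
    by (subst Bochner_Integration.integral_sum)
       (auto simp: sum_distrib_left intro!: integrable_Om_bounded[where K=1] borel_measurable_power mass_measurable
         power_le_one mass_nonneg mass_le_1 dest: gen_nodes)
  finally show ?thesis by (simp add: sum_mass_square K_def)
qed

end

section \<open>Almost sure sublinearity of centred totals\<close>

text \<open>The series of the \<open>Z k\<close> has a finite integral, so it converges almost
  everywhere and its terms tend to zero.\<close>

lemma AE_tendsto_0_of_summable_integral:
  fixes Z :: "nat \<Rightarrow> 'b \<Rightarrow> real"
  assumes int: "\<And>k. integrable M (Z k)" and nn: "\<And>k x. 0 \<le> Z k x"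
    and le: "\<And>k. (\<integral>x. Z k x \<partial>M) \<le> B k" and sum: "summable B"
  shows "AE x in M. (\<lambda>k. Z k x) \<longlonglongrightarrow> 0"
proof -
  have [measurable]: "Z k \<in> borel_measurable M" for k by (rule borel_measurable_integrable[OF int])
  have B: "0 \<le> B k" for k
  proof -
    have "0 \<le> (\<integral>x. Z k x \<partial>M)" using nn by (intro integral_nonneg_AE) simp
    then show ?thesis using le[of k] by linarith
  qed
  have "(\<integral>\<^sup>+x. (\<Sum>k. ennreal (Z k x)) \<partial>M) = (\<Sum>k. \<integral>\<^sup>+x. ennreal (Z k x) \<partial>M)"
    by (rule nn_integral_suminf) measurable
  also have "\<dots> = (\<Sum>k. ennreal (\<integral>x. Z k x \<partial>M))"
  proof (intro suminf_cong)
    show "(\<integral>\<^sup>+x. ennreal (Z k x) \<partial>M) = ennreal (\<integral>x. Z k x \<partial>M)" for k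
      by (rule nn_integral_eq_integral[OF int]) (simp add: nn)
  qed
  also have "\<dots> \<le> (\<Sum>k. ennreal (B k))" by (rule suminf_le) (simp_all add: ennreal_leI le)
  also have "\<dots> = ennreal (\<Sum>k. B k)" by (rule suminf_ennreal2[OF B sum])
  finally have "(\<integral>\<^sup>+x. (\<Sum>k. ennreal (Z k x)) \<partial>M) < top" by (rule le_less_trans) (rule ennreal_less_top)
  then have "(\<integral>\<^sup>+x. (\<Sum>k. ennreal (Z k x)) \<partial>M) \<noteq> \<infinity>" by simp
  then have "AE x in M. (\<Sum>k. ennreal (Z k x)) \<noteq> \<infinity>" by (intro nn_integral_PInf_AE) auto
  then show ?thesis
  proof eventually_elim
    case (elim x)
    then have "summable (\<lambda>k. Z k x)" using nn by (intro summable_suminf_not_top) auto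
    then show ?case by (rule summable_LIMSEQ_zero)
  qed
qed

lemma summable_square_power:
  fixes \<sigma> :: real assumes "0 \<le> \<sigma>" "\<sigma> < 1"
  shows "summable (\<lambda>k. (real k)\<^sup>2 * \<sigma> ^ k)"
proof (rule root_test_convergence)
  have "(\<lambda>n. (root n (real n))\<^sup>2 * \<sigma>) \<longlonglongrightarrow> 1\<^sup>2 * \<sigma>" by (intro tendsto_intros LIMSEQ_root)
  then have "(\<lambda>n. (root n (real n))\<^sup>2 * \<sigma>) \<longlonglongrightarrow> \<sigma>" by simp
  moreover have "\<forall>\<^sub>F n in sequentially. (root n (real n))\<^sup>2 * \<sigma> = root n (norm ((real n)\<^sup>2 * \<sigma> ^ n))"
    using eventually_gt_at_top[of 0]
  proof eventually_elim
    case (elim n)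
    have "norm ((real n)\<^sup>2 * \<sigma> ^ n) = (real n)\<^sup>2 * \<sigma> ^ n" using assms by simp
    then have "root n (norm ((real n)\<^sup>2 * \<sigma> ^ n)) = root n ((real n)\<^sup>2) * root n (\<sigma> ^ n)" by (simp only: real_root_mult)
    also have "\<dots> = (root n (real n))\<^sup>2 * \<sigma>"
      using elim assms by (simp only: real_root_power[OF elim, of "real n"] real_root_power_cancel)
    finally show ?case ..
  qed
  ultimately show "(\<lambda>n. root n (norm ((real n)\<^sup>2 * \<sigma> ^ n))) \<longlonglongrightarrow> \<sigma>" by (rule Lim_transform_eventually)
qed (use assms in simp)

lemma summable_square_power_div:
  fixes \<rho> :: real assumes "0 \<le> \<rho>" "\<rho> < 1" "K > 0"
  shows "summable (\<lambda>k. (real k)\<^sup>2 * \<rho> ^ (k div K))"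
proof -
  \<comment> \<open>Real powers are taken below, so the base has to be positive, while
    \<open>\<rho> = 0\<close> is permitted.\<close>
  define r where "r = max \<rho> (1 / 2)"
  have r: "0 < r" "r < 1" "\<rho> \<le> r" using assms by (auto simp: r_def)
  define \<sigma> where "\<sigma> = r powr (1 / K)"
  have \<sigma>: "0 \<le> \<sigma>" "\<sigma> < 1" using r assms(3) powr_less_mono2[of "1 / K" r 1] by (auto simp: \<sigma>_def)
  \<comment> \<open>Rounding \<open>k / K\<close> down loses at most one in the exponent; this is
    the factor \<open>1 / r\<close>.\<close>
  have "\<rho> ^ (k div K) \<le> \<sigma> ^ k / r" for k
  proof -
    have "real k = real (k mod K) + real (k div K) * real K"
      by (metis div_mult_mod_eq of_nat_add of_nat_mult add.commute)
    moreover have "real (k mod K) \<le> real K" using assms(3) by simp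
    ultimately have "real k \<le> (real (k div K) + 1) * real K" by (simp add: algebra_simps)
    then have e: "real k / real K - 1 \<le> real (k div K)" using assms(3) by (simp add: field_simps)
    have "\<rho> ^ (k div K) \<le> r ^ (k div K)" using assms r by (intro power_mono) auto
    also have "\<dots> = r powr (real (k div K))" using r by (simp add: powr_realpow)
    also have "\<dots> \<le> r powr (real k / real K - 1)" using r e by (intro powr_mono') auto
    also have "\<dots> = (r powr (1 / K)) powr real k / r" using r by (simp add: powr_diff powr_powr)
    also have "\<dots> = \<sigma> ^ k / r" using r unfolding \<sigma>_def by (subst powr_realpow) auto
    finally show ?thesis .
  qed
  then have "(real k)\<^sup>2 * \<rho> ^ (k div K) \<le> (real k)\<^sup>2 * \<sigma> ^ k / r" for k
    by (metis mult_left_mono times_divide_eq_right zero_le_power2)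
  then show ?thesis
    using assms by (intro summable_comparison_test'[OF summable_divide[OF summable_square_power[OF \<sigma>]], where N=0]) auto
qed

section \<open>Growth rates along geometric sequences\<close>

context splitting
begin

lemma b_ge_2: "b \<ge> 2"
proof (rule ccontr)
  assume "\<not> b \<ge> 2"
  then consider "b = 0" | "b = 1" by linarith
  then show False
  proof cases
    case 1 then show False using W_sum by simp
  next
    case 2 then show False using W_sum[of undefined] W_less_1[of undefined 0] by simp
  qed
qed

lemma card_below_le: "card (below b n) \<le> b ^ n"
proof -
  have "card (below b n) = (\<Sum>i<n. b ^ i)"
    using sum_below[of "\<lambda>_. 1::nat" b n] by (simp add: card_gen)
  also have "\<dots> \<le> b ^ n"
  proof (induction n)
    case (Suc n)
    then have "(\<Sum>i<Suc n. b ^ i) \<le> 2 * b ^ n" by simp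
    also have "\<dots> \<le> b * b ^ n" using b_ge_2 by (intro mult_right_mono) auto
    finally show ?case by simp
  qed simp
  finally show ?thesis .
qed

text \<open>Pieces of mass at least \<open>s0\<close> obey the hypothesis; their shares add up to at
  most one and the squared shares are smaller still. The lighter pieces may number
  \<open>b ^ n\<close>, but each costs only the constant of \<open>mean_bound\<close> at
  \<open>s0\<close>.\<close>

lemma sum_mean_bound:
  assumes \<xi>: "mark C \<xi>" and y: "0 \<le> y" and D: "0 \<le> D" and s0: "0 \<le> s0" and \<epsilon>: "0 \<le> \<epsilon>"
    and m: "\<And>s. s \<ge> s0 \<Longrightarrow> \<bar>mean \<xi> h s\<bar> \<le> \<epsilon> * s + D * s\<^sup>2 * \<rho> ^ h"
  shows "\<bar>\<Sum>u\<in>gen b n. mean \<xi> h (y * mass x u)\<bar> \<le> \<epsilon> * y + D * y\<^sup>2 * \<rho> ^ h + real (b ^ n) * (C * pot_bound * s0)"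
proof -
  let ?B = "C * pot_bound * s0"
  have B: "0 \<le> ?B" using markD(2)[OF \<xi>] pot_bound_pos s0 by simp
  have Dr: "0 \<le> D * y\<^sup>2 * \<rho> ^ h" using D \<rho>_nonneg by simp
  have "\<bar>mean \<xi> h (y * mass x u)\<bar> \<le> (\<epsilon> * y + D * y\<^sup>2 * \<rho> ^ h) * mass x u + ?B" for u
  proof (cases "y * mass x u \<ge> s0")
    case True
    have "D * (y * mass x u)\<^sup>2 * \<rho> ^ h = (D * y\<^sup>2 * \<rho> ^ h) * (mass x u * mass x u)"
      by (simp add: power2_eq_square)
    also have "\<dots> \<le> (D * y\<^sup>2 * \<rho> ^ h) * mass x u"
      using Dr mass_nonneg mass_le_1 by (intro mult_left_mono mult_left_le) auto
    finally show ?thesis using m[OF True] B by (simp add: algebra_simps)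
  next
    case False
    have "\<bar>mean \<xi> h (y * mass x u)\<bar> \<le> C * pot_bound * (y * mass x u)"
      using y mass_nonneg by (intro mean_bound[OF \<xi>]) simp
    also have "\<dots> \<le> ?B" using False markD(2)[OF \<xi>] pot_bound_pos by (intro mult_left_mono) auto
    finally show ?thesis using Dr \<epsilon> y mass_nonneg by (simp add: add_increasing)
  qed
  then have "\<bar>\<Sum>u\<in>gen b n. mean \<xi> h (y * mass x u)\<bar> \<le> (\<Sum>u\<in>gen b n. (\<epsilon> * y + D * y\<^sup>2 * \<rho> ^ h) * mass x u + ?B)"
    by (intro order_trans[OF sum_abs] sum_mono)
  also have "\<dots> = \<epsilon> * y + D * y\<^sup>2 * \<rho> ^ h + real (b ^ n) * ?B"
    by (simp add: sum.distrib sum_distrib_left[symmetric] sum_mass_gen card_gen)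
  finally show ?thesis .
qed

text \<open>\<open>K\<close> bounds the branching: the square makes \<open>b ^ (k div K)\<close> at
  most the square root of \<open>q ^ k\<close>. \<open>H\<close> bounds the decay: the exponent
  \<open>3\<close> leaves \<open>(1 / q) ^ k\<close> after multiplication by
  \<open>(q ^ k)\<^sup>2\<close>.\<close>

definition good_rate :: "real \<Rightarrow> nat \<Rightarrow> nat \<Rightarrow> bool" where
  "good_rate q K H \<longleftrightarrow> q > 1 \<and> K > 0 \<and> (real b)\<^sup>2 \<le> q ^ K \<and> \<rho> ^ H \<le> (1 / q) ^ 3"

lemma good_rate_exists: assumes "q > 1" shows "\<exists>K H. good_rate q K H"
proof -
  obtain K where K: "(real b)\<^sup>2 < q ^ K" using real_arch_pow[OF assms] by blast
  have "1 \<le> (real b)\<^sup>2" using b_ge_2 by (intro one_le_power) simp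
  then have "K > 0" using K by (cases K) auto
  have "(1 / q) ^ 3 > 0" using assms by simp
  then obtain H where "\<rho> ^ H < (1 / q) ^ 3" using real_arch_pow_inv[OF _ \<rho>_less_1] by blast
  then show ?thesis using K \<open>K > 0\<close> assms by (intro exI[of _ K] exI[of _ H]) (auto simp: good_rate_def)
qed

lemma good_rateD:
  assumes "good_rate q K H"
  shows "q > 1" "K > 0"
  using assms unfolding good_rate_def by blast+

text \<open>After \<open>k div K\<close> generations the tree started from mass \<open>q ^ k\<close> has split into independent pieces,
  still at most \<open>sqrt q ^ k\<close> many; after \<open>H * k\<close> further generations it is almost surely extinct for
  large \<open>k\<close>.\<close>

definition level :: "nat \<Rightarrow> nat \<Rightarrow> nat \<Rightarrow> nat" where "level K H k = k div K + H * k"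

lemma power_rate:
  assumes "good_rate q K H"
  shows "q ^ k * \<rho> ^ (H * k) \<le> (1 / q) ^ k" "(q ^ k)\<^sup>2 * \<rho> ^ level K H k \<le> (1 / q) ^ k"
    "real (b ^ (k div K)) / q ^ k \<le> (1 / sqrt q) ^ k"
proof -
  have q: "q > 1" and \<rho>H: "\<rho> ^ H \<le> (1 / q) ^ 3" and bK: "(real b)\<^sup>2 \<le> q ^ K"
    using assms unfolding good_rate_def by blast+
  have qk: "q ^ k \<ge> 1" using q by (intro one_le_power) simp
  have "\<rho> ^ (H * k) = (\<rho> ^ H) ^ k" by (rule power_mult)
  also have "\<dots> \<le> ((1 / q) ^ 3) ^ k" by (rule power_mono[OF \<rho>H]) (simp add: \<rho>_nonneg)
  also have "\<dots> = ((1 / q) ^ k) ^ 3" by (simp only: power_mult[symmetric] mult.commute)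
  also have "\<dots> = 1 / (q ^ k) ^ 3" by (simp only: power_one_over)
  finally have "(q ^ k)\<^sup>2 * \<rho> ^ (H * k) \<le> (q ^ k)\<^sup>2 * (1 / (q ^ k) ^ 3)"
    by (intro mult_left_mono) auto
  also have "\<dots> = 1 / q ^ k" using qk by (simp add: power2_eq_square power3_eq_cube)
  also have "\<dots> = (1 / q) ^ k" by (simp only: power_one_over)
  finally have 1: "(q ^ k)\<^sup>2 * \<rho> ^ (H * k) \<le> (1 / q) ^ k" .
  have "q ^ k * 1 \<le> q ^ k * q ^ k" using qk by (intro mult_left_mono) auto
  then have "q ^ k * \<rho> ^ (H * k) \<le> (q ^ k)\<^sup>2 * \<rho> ^ (H * k)"
    using \<rho>_nonneg by (intro mult_right_mono) (auto simp: power2_eq_square)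
  then show "q ^ k * \<rho> ^ (H * k) \<le> (1 / q) ^ k" using 1 by linarith
  have "\<rho> ^ level K H k \<le> \<rho> ^ (H * k)"
    using \<rho>_nonneg \<rho>_less_1 by (intro power_decreasing) (auto simp: level_def)
  then have "(q ^ k)\<^sup>2 * \<rho> ^ level K H k \<le> (q ^ k)\<^sup>2 * \<rho> ^ (H * k)" by (intro mult_left_mono) auto
  then show "(q ^ k)\<^sup>2 * \<rho> ^ level K H k \<le> (1 / q) ^ k" using 1 by linarith
  define r where "r = sqrt q ^ k"
  have r: "r > 0" "r * r = q ^ k"
  proof -
    have "r * r = (sqrt q * sqrt q) ^ k" unfolding r_def by (rule power_mult_distrib[symmetric])
    also have "sqrt q * sqrt q = q" using q by simp
    finally show "r * r = q ^ k" .
  qed (use q in \<open>simp add: r_def\<close>)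
  have "(real (b ^ (k div K)))\<^sup>2 = ((real b)\<^sup>2) ^ (k div K)"
    unfolding of_nat_power by (simp only: power_mult[symmetric] mult.commute)
  also have "\<dots> \<le> (q ^ K) ^ (k div K)" by (rule power_mono[OF bK]) simp
  also have "\<dots> = q ^ (K * (k div K))" by (rule power_mult[symmetric])
  also have "\<dots> \<le> q ^ k" using q by (intro power_increasing) auto
  also have "\<dots> = r\<^sup>2" using r by (simp only: power2_eq_square)
  finally have "real (b ^ (k div K)) \<le> r" by (rule power2_le_imp_le) (rule less_imp_le[OF r(1)])
  then have "real (b ^ (k div K)) / q ^ k \<le> r / q ^ k" by (rule divide_right_mono) (use qk in linarith)
  also have "\<dots> = 1 / r" using r(1) by (simp add: r(2)[symmetric])
  also have "\<dots> = (1 / sqrt q) ^ k" unfolding r_def by (simp only: power_one_over)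
  finally show "real (b ^ (k div K)) / q ^ k \<le> (1 / sqrt q) ^ k" .
qed

text \<open>The total has three parts: early generations, which contain too few nodes to matter;
  centred contributions of the pieces, whose scaled second moments are summable; and means of the
  pieces, controlled by the hypothesis. Only the second part produces a null set, so the accuracy in
  the hypothesis may be chosen after that set is fixed.\<close>

lemma total_sublinear_AE:
  assumes \<xi>: "mark C \<xi>" and gr: "good_rate q K H"
    and m: "\<And>\<epsilon>. \<epsilon> > 0 \<Longrightarrow> \<exists>s0\<ge>0. \<exists>D\<ge>0. \<forall>h. \<forall>s\<ge>s0. \<bar>mean \<xi> h s\<bar> \<le> \<epsilon> * s + D * s\<^sup>2 * \<rho> ^ h"
  shows "AE x in Om. (\<lambda>k. total \<xi> (level K H k) (q ^ k) x / q ^ k) \<longlonglongrightarrow> 0"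
proof -
  have q: "q > 1" "K > 0" by (fact good_rateD[OF gr])+
  define A where "A k x = (\<Sum>u\<in>gen b (k div K). fluct \<xi> (H * k) (q ^ k) u x) / q ^ k" for k x
  have "AE x in Om. (\<lambda>k. (A k x)\<^sup>2) \<longlonglongrightarrow> 0"
  proof (rule AE_tendsto_0_of_summable_integral)
    show "summable (\<lambda>k. (2 * C * real H)\<^sup>2 * ((real k)\<^sup>2 * \<rho> ^ (k div K)))"
      by (intro summable_mult summable_square_power_div \<rho>_nonneg \<rho>_less_1 q)
    fix k
    have qk: "0 \<le> q ^ k" using q by simp
    have "(\<integral>x. (A k x)\<^sup>2 \<partial>Om) = (\<integral>x. (\<Sum>u\<in>gen b (k div K). fluct \<xi> (H * k) (q ^ k) u x)\<^sup>2 \<partial>Om) / (q ^ k)\<^sup>2"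
      by (simp add: A_def power_divide)
    also have "\<dots> \<le> ((2 * C * real (H * k) * q ^ k)\<^sup>2 * \<rho> ^ (k div K)) / (q ^ k)\<^sup>2"
      by (intro divide_right_mono fluct_second_moment[OF \<xi> qk]) simp
    also have "\<dots> = (2 * C * real H)\<^sup>2 * ((real k)\<^sup>2 * \<rho> ^ (k div K))"
      using q by (simp add: power_mult_distrib)
    finally show "(\<integral>x. (A k x)\<^sup>2 \<partial>Om) \<le> (2 * C * real H)\<^sup>2 * ((real k)\<^sup>2 * \<rho> ^ (k div K))" .
    show "integrable Om (\<lambda>x. (A k x)\<^sup>2)"
    proof (rule integrable_Om_bounded[where K="(2 * C * real (H * k))\<^sup>2"])
      show "(\<lambda>x. (A k x)\<^sup>2) \<in> borel_measurable Om" unfolding A_def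
        by (intro borel_measurable_power borel_measurable_divide borel_measurable_sum fluct_measurable[OF \<xi>] gen_nodes) auto
      fix x
      have "\<bar>\<Sum>u\<in>gen b (k div K). fluct \<xi> (H * k) (q ^ k) u x\<bar> \<le> (\<Sum>u\<in>gen b (k div K). 2 * C * real (H * k) * q ^ k * mass x u)"
        by (intro order_trans[OF sum_abs] sum_mono fluct_bound[OF \<xi> qk])
      also have "\<dots> = 2 * C * real (H * k) * q ^ k" by (simp add: sum_distrib_left[symmetric] sum_mass_gen)
      finally have "\<bar>A k x\<bar> \<le> 2 * C * real (H * k)" using q by (simp add: A_def abs_divide pos_divide_le_eq)
      then show "\<bar>(A k x)\<^sup>2\<bar> \<le> (2 * C * real (H * k))\<^sup>2" by (metis abs_ge_zero abs_power2 power2_abs power_mono)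
    qed
  qed auto
  then show ?thesis
  proof eventually_elim
    case (elim x)
    have "(\<lambda>k. sqrt ((A k x)\<^sup>2)) \<longlonglongrightarrow> sqrt 0" by (intro tendsto_real_sqrt elim)
    then have A0: "(\<lambda>k. \<bar>A k x\<bar>) \<longlonglongrightarrow> 0" by simp
    have iq: "(\<lambda>k. (1 / q) ^ k) \<longlonglongrightarrow> 0" "(\<lambda>k. (1 / sqrt q) ^ k) \<longlonglongrightarrow> 0"
      using q by (intro LIMSEQ_power_zero; simp)+
    show ?case
    proof (rule tendstoI)
      fix e :: real assume e: "e > 0"
      obtain s0 D where sD: "s0 \<ge> 0" "D \<ge> 0" "\<And>h s. s \<ge> s0 \<Longrightarrow> \<bar>mean \<xi> h s\<bar> \<le> (e / 2) * s + D * s\<^sup>2 * \<rho> ^ h"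
        using m[of "e / 2"] e by auto
      let ?E = "C * pot_bound * s0"
      have E: "?E \<ge> 0" using markD(2)[OF \<xi>] pot_bound_pos sD by simp
      have "(\<lambda>k. C * (1 / sqrt q) ^ k + \<bar>A k x\<bar> + (e / 2 + D * (1 / q) ^ k + ?E * (1 / sqrt q) ^ k)) \<longlonglongrightarrow> C * 0 + 0 + (e / 2 + D * 0 + ?E * 0)"
        by (intro tendsto_intros iq A0)
      then have "\<forall>\<^sub>F k in sequentially. C * (1 / sqrt q) ^ k + \<bar>A k x\<bar> + (e / 2 + D * (1 / q) ^ k + ?E * (1 / sqrt q) ^ k) < e"
        by (rule order_tendstoD(2)) (use e in simp)
      then show "\<forall>\<^sub>F k in sequentially. dist (total \<xi> (level K H k) (q ^ k) x / q ^ k) 0 < e"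
      proof eventually_elim
        case (elim k)
        let ?n = "k div K" and ?h = "H * k" and ?y = "q ^ k"
        have y: "?y > 0" using q by simp
        have "total \<xi> (level K H k) ?y x = total \<xi> ?n ?y x + ?y * A k x + (\<Sum>u\<in>gen b ?n. mean \<xi> ?h (?y * mass x u))"
        proof -
          have "?y * A k x = (\<Sum>u\<in>gen b ?n. fluct \<xi> ?h ?y u x)"
            unfolding A_def by (rule nonzero_mult_div_cancel_left[THEN trans[OF times_divide_eq_right]]) (use y in linarith)
          then show ?thesis by (simp add: level_def total_add fluct_def sum_subtractf)
        qed
        moreover have "\<bar>total \<xi> ?n ?y x\<bar> \<le> C * real (b ^ ?n)"
        proof -
          have "\<bar>\<xi> s z\<bar> \<le> C" for s z
            using markD(3)[OF \<xi>, of s z] mult_left_le[OF ind_bounds(2) markD(2)[OF \<xi>], of s] by linarith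
          then have "\<bar>total \<xi> ?n ?y x\<bar> \<le> (\<Sum>v\<in>below b ?n. C)"
            unfolding total_def by (intro order_trans[OF sum_abs] sum_mono)
          also have "\<dots> \<le> real (b ^ ?n) * C"
            using card_below_le[of ?n] markD(2)[OF \<xi>] by (auto intro!: mult_right_mono simp del: of_nat_power)
          finally show ?thesis by (simp add: mult.commute)
        qed
        moreover have "\<bar>\<Sum>u\<in>gen b ?n. mean \<xi> ?h (?y * mass x u)\<bar> \<le> e / 2 * ?y + D * ?y\<^sup>2 * \<rho> ^ ?h + real (b ^ ?n) * ?E"
          using y e sD by (intro sum_mean_bound[OF \<xi>]) auto
        ultimately have "\<bar>total \<xi> (level K H k) ?y x\<bar> \<le> C * real (b ^ ?n) + \<bar>?y * A k x\<bar> + (e / 2 * ?y + D * ?y\<^sup>2 * \<rho> ^ ?h + real (b ^ ?n) * ?E)"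
          by linarith
        then have "\<bar>total \<xi> (level K H k) ?y x\<bar> / ?y \<le> (C * real (b ^ ?n) + \<bar>?y * A k x\<bar> + (e / 2 * ?y + D * ?y\<^sup>2 * \<rho> ^ ?h + real (b ^ ?n) * ?E)) / ?y"
          using y by (intro divide_right_mono) auto
        also have "\<dots> = C * (real (b ^ ?n) / ?y) + \<bar>A k x\<bar> + (e / 2 + D * (?y * \<rho> ^ ?h) + ?E * (real (b ^ ?n) / ?y))"
        proof -
          have "q \<noteq> 0" using q by simp
          then show ?thesis using y by (simp add: add_divide_distrib abs_mult power2_eq_square)
        qed
        also have "\<dots> \<le> C * (1 / sqrt q) ^ k + \<bar>A k x\<bar> + (e / 2 + D * (1 / q) ^ k + ?E * (1 / sqrt q) ^ k)"
          by (intro add_mono mult_left_mono power_rate[OF gr] markD(2)[OF \<xi>] sD E order_refl)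
        also have "\<dots> < e" by (rule elim)
        finally show ?case using y by (simp add: dist_real_def abs_divide)
      qed
    qed
  qed
qed

text \<open>Because \<open>ind s \<le> s\<^sup>2\<close>, the expected number of nodes at the chosen
  level with mass at least \<open>1\<close> is bounded by an expected sum of squares, which is
  summable in \<open>k\<close>. A count that tends to zero is eventually below one, hence
  zero.\<close>

lemma extinct_AE:
  assumes gr: "good_rate q K H"
  shows "AE x in Om. \<forall>\<^sub>F k in sequentially. \<forall>v\<in>gen b (level K H k). q ^ k * mass x v < 1"
proof -
  have q: "q > 1" by (fact good_rateD[OF gr])+
  define Z where "Z k x = (\<Sum>v\<in>gen b (level K H k). ind (q ^ k * mass x v))" for k x
  have "AE x in Om. (\<lambda>k. Z k x) \<longlonglongrightarrow> 0"
  proof (rule AE_tendsto_0_of_summable_integral)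
    show "summable (\<lambda>k. (1 / q) ^ k)" using q by (intro summable_geometric) simp
    fix k
    have m: "(\<lambda>x. mass x v) \<in> borel_measurable Om" if "v \<in> gen b (level K H k)" for v
      by (rule mass_measurable[OF gen_nodes[OF that]])
    show nn: "0 \<le> Z k x" for x unfolding Z_def by (intro sum_nonneg ind_bounds)
    have "Z k \<in> borel_measurable Om" unfolding Z_def[abs_def]
      by (intro borel_measurable_sum measurable_compose[OF _ ind_measurable] borel_measurable_times m) auto
    then show int: "integrable Om (Z k)"
      using nn sum_ind_gen[of "q ^ k"] q by (intro integrable_Om_bounded[where K="q ^ k"]) (auto simp: Z_def)
    have i2: "integrable Om (\<lambda>x. \<Sum>v\<in>gen b (level K H k). (mass x v)\<^sup>2)"
      by (intro Bochner_Integration.integrable_sum integrable_Om_bounded[where K=1] borel_measurable_power m)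
         (auto intro!: power_le_one mass_nonneg mass_le_1)
    have "(\<integral>x. Z k x \<partial>Om) \<le> (\<integral>x. (q ^ k)\<^sup>2 * (\<Sum>v\<in>gen b (level K H k). (mass x v)\<^sup>2) \<partial>Om)"
    proof (intro integral_mono int integrable_mult_right i2)
      show "Z k x \<le> (q ^ k)\<^sup>2 * (\<Sum>v\<in>gen b (level K H k). (mass x v)\<^sup>2)" for x
        unfolding Z_def sum_distrib_left power_mult_distrib[symmetric]
        using q mass_nonneg by (intro sum_mono ind_bounds) auto
    qed
    also have "\<dots> \<le> (1 / q) ^ k" using power_rate(2)[OF gr] by (simp add: sum_mass_square)
    finally show "(\<integral>x. Z k x \<partial>Om) \<le> (1 / q) ^ k" .
  qed
  then show ?thesis
  proof eventually_elim
    case (elim x)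
    have "\<forall>\<^sub>F k in sequentially. Z k x < 1" using order_tendstoD(2)[OF elim, of 1] by simp
    then show ?case
    proof eventually_elim
      case (elim k)
      show ?case
      proof
        fix v assume v: "v \<in> gen b (level K H k)"
        have "ind (q ^ k * mass x v) \<le> Z k x" unfolding Z_def by (intro member_le_sum v ind_bounds) simp
        then show "q ^ k * mass x v < 1" using elim by (auto simp: ind_def split: if_splits)
      qed
    qed
  qed
qed

section \<open>Means of the characteristics for coverings and for dilations\<close>

lemma pot_base_diff_le:
  assumes "0 \<le> s" "0 \<le> t" "t \<le> s"
  shows "\<bar>pot base h t - pot base h s\<bar> \<le> \<bar>potential base t - potential base s\<bar> + s * \<rho> ^ h / (1 - \<rho>)"
proof -
  have "t * \<rho> ^ h / (1 - \<rho>) \<le> s * \<rho> ^ h / (1 - \<rho>)"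
    using assms \<rho>_nonneg \<rho>_less_1 by (intro divide_right_mono mult_right_mono) auto
  then show ?thesis
    using potential_tail[OF kernel_base assms(1), of h] potential_tail[OF kernel_base assms(2), of h]
      pot_le_potential[OF kernel_base, of h s] pot_le_potential[OF kernel_base, of h t] by linarith
qed

lemma mark_deviation:
  assumes [measurable]: "m \<in> borel_measurable Om" and m: "\<And>x. 0 \<le> m x" "\<And>x. m x \<le> 1"
  shows "mark 1 (\<lambda>s x. ind (s * m x) - (\<integral>x. m x \<partial>Om) * ind s)"
proof -
  let ?p = "\<integral>x. m x \<partial>Om"
  have p: "0 \<le> ?p" "?p \<le> 1"
  proof -
    show "0 \<le> ?p" using m by (intro integral_nonneg_AE) auto
    have "?p \<le> (\<integral>x. 1 \<partial>Om)" using m by (intro integral_mono integrable_Om_bounded[where K=1]) auto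
    then show "?p \<le> 1" by (simp add: Om.prob_space)
  qed
  note mk = mark_scaled_ind[OF assms]
  have "(\<lambda>(s, x). ind (s * m x) - ?p * ind s) \<in> borel_measurable (borel \<Otimes>\<^sub>M Om)" by measurable
  moreover have "\<bar>ind (s * m x) - ?p * ind s\<bar> \<le> ind s" for s x
  proof -
    have "0 \<le> ?p * ind s" "?p * ind s \<le> 1 * ind s" using p ind_bounds(1)[of s] mult_right_mono[OF p(2) ind_bounds(1)[of s]] by auto
    then show ?thesis using markD(3)[OF mk, of s x] ind_bounds(1)[of "s * m x"] by linarith
  qed
  ultimately show ?thesis by (simp add: mark_def)
qed

text \<open>The mean equals \<open>s\<close> times the integral of
  \<open>m x * (pot base h (s * m x) - pot base h s)\<close>. Up to the tail in
  \<open>potential_tail\<close>, which supplies the term with \<open>D\<close>, the potentials may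
  be inserted; their difference vanishes as \<open>s\<close> grows for each \<open>x\<close> with
  \<open>m x > 0\<close>, and elsewhere the factor \<open>m x\<close> is zero. Dominated convergence
  concludes.\<close>

lemma mean_deviation:
  assumes [measurable]: "m \<in> borel_measurable Om" and m: "\<And>x. 0 \<le> m x" "\<And>x. m x \<le> 1" and \<epsilon>: "\<epsilon> > 0"
  shows "\<exists>s0\<ge>0. \<exists>D\<ge>0. \<forall>h. \<forall>s\<ge>s0.
    \<bar>mean (\<lambda>s x. ind (s * m x) - (\<integral>x. m x \<partial>Om) * ind s) h s\<bar> \<le> \<epsilon> * s + D * s\<^sup>2 * \<rho> ^ h"
proof -
  let ?p = "\<integral>x. m x \<partial>Om" and ?F = "potential base"
  have Fm [measurable]: "?F \<in> borel_measurable borel" and Fb: "\<bar>?F y\<bar> \<le> pot_bound" for y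
    using bdd_borelD[OF potential_bdd_borel[OF kernel_base]] by auto
  have pm [measurable]: "pot base h \<in> borel_measurable borel" and pb: "\<bar>pot base h y\<bar> \<le> pot_bound" for h y
    using bdd_borelD[OF pot_bdd_borel[OF kernel_base]] by auto
  define g where "g s = (\<integral>x. m x * \<bar>?F (s * m x) - ?F s\<bar> \<partial>Om)" for s
  have bd: "\<bar>m x * (u - v)\<bar> \<le> 2 * pot_bound" if "\<bar>u\<bar> \<le> pot_bound" "\<bar>v\<bar> \<le> pot_bound" for x u v
  proof -
    have "\<bar>m x\<bar> * \<bar>u - v\<bar> \<le> 1 * (2 * pot_bound)" using m that by (intro mult_mono) auto
    then show ?thesis by (simp add: abs_mult)
  qed
  have gint: "integrable Om (\<lambda>x. m x * \<bar>?F (s * m x) - ?F s\<bar>)" for s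
    using bd[OF Fb Fb] m by (intro integrable_Om_bounded[where K="2 * pot_bound"]) (auto simp: abs_mult)
  have "(g \<longlongrightarrow> (\<integral>x. 0 \<partial>Om)) at_top"
    unfolding g_def[abs_def]
  proof (rule integral_dominated_convergence_at_top[where w="\<lambda>_. 2 * pot_bound"])
    show "AE x in Om. ((\<lambda>s. m x * \<bar>?F (s * m x) - ?F s\<bar>) \<longlongrightarrow> 0) at_top"
    proof (rule AE_I2)
      fix x
      show "((\<lambda>s. m x * \<bar>?F (s * m x) - ?F s\<bar>) \<longlongrightarrow> 0) at_top"
      proof (cases "m x = 0")
        case False
        then have "m x > 0" using m(1)[of x] by simp
        from tendsto_mult_right_zero[OF tendsto_rabs_zero[OF potential_base_scaling[OF this]], of "m x"]
        show ?thesis .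
      qed simp
    qed
    show "\<forall>\<^sub>F s in at_top. AE x in Om. norm (m x * \<bar>?F (s * m x) - ?F s\<bar>) \<le> 2 * pot_bound"
      using bd[OF Fb Fb] m by (intro always_eventually allI AE_I2) (auto simp: abs_mult)
  qed auto
  then have "\<forall>\<^sub>F s in at_top. g s < \<epsilon>" using order_tendstoD(2)[of g 0 at_top \<epsilon>] \<epsilon> by simp
  then obtain s1 where s1: "\<And>s. s \<ge> s1 \<Longrightarrow> g s < \<epsilon>" by (auto simp: eventually_at_top_linorder)
  have "\<bar>mean (\<lambda>s x. ind (s * m x) - ?p * ind s) h s\<bar> \<le> \<epsilon> * s + 1 / (1 - \<rho>) * s\<^sup>2 * \<rho> ^ h" if s: "s \<ge> max 0 s1" for s h
  proof -
    have s0: "0 \<le> s" using s by simp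
    have "mean (\<lambda>s x. ind (s * m x) - ?p * ind s) h s = (\<integral>x. total (\<lambda>s x. ind (s * m x)) h s x - ?p * total (\<lambda>s x. ind s) h s x \<partial>Om)"
      by (simp add: mean_def total_def sum_subtractf sum_distrib_left)
    also have "\<dots> = mean (\<lambda>s x. ind (s * m x)) h s - ?p * mean (\<lambda>s x. ind s) h s"
      unfolding mean_def
      by (subst Bochner_Integration.integral_diff)
         (auto intro!: total_integrable[OF mark_scaled_ind[OF assms(1) m] s0] total_integrable[OF mark_ind s0])
    also have "\<dots> = (\<integral>x. s * m x * pot base h (s * m x) \<partial>Om) - (\<integral>x. m x * (s * pot base h s) \<partial>Om)"
      using s0 by (simp add: mean_scaled_ind[OF assms(1) m] mean_ind)
    also have "\<dots> = s * (\<integral>x. m x * pot base h (s * m x) - m x * pot base h s \<partial>Om)"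
    proof -
      have pm1: "\<bar>m x * pot base h t\<bar> \<le> 1 * pot_bound" for x t
        unfolding abs_mult using m pb by (intro mult_mono) auto
      have "integrable Om (\<lambda>x. m x * pot base h (s * m x))" "integrable Om (\<lambda>x. m x * pot base h s)"
        using pm1 by (intro integrable_Om_bounded[where K=pot_bound]; simp)+
      moreover have "(\<integral>x. s * m x * pot base h (s * m x) \<partial>Om) = s * (\<integral>x. m x * pot base h (s * m x) \<partial>Om)"
        by (simp add: mult.assoc)
      moreover have "(\<integral>x. m x * (s * pot base h s) \<partial>Om) = s * (\<integral>x. m x * pot base h s \<partial>Om)" by simp
      ultimately show ?thesis by (simp only: Bochner_Integration.integral_diff right_diff_distrib)
    qed
    finally have eq: "\<bar>mean (\<lambda>s x. ind (s * m x) - ?p * ind s) h s\<bar> = s * \<bar>\<integral>x. m x * (pot base h (s * m x) - pot base h s) \<partial>Om\<bar>"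
      using s0 by (simp add: abs_mult right_diff_distrib)
    have "\<bar>\<integral>x. m x * (pot base h (s * m x) - pot base h s) \<partial>Om\<bar> \<le> (\<integral>x. \<bar>m x * (pot base h (s * m x) - pot base h s)\<bar> \<partial>Om)"
      by (rule integral_abs_bound)
    also have "\<dots> \<le> (\<integral>x. m x * \<bar>?F (s * m x) - ?F s\<bar> + s * \<rho> ^ h / (1 - \<rho>) \<partial>Om)"
    proof (rule integral_mono)
      show "integrable Om (\<lambda>x. \<bar>m x * (pot base h (s * m x) - pot base h s)\<bar>)"
        using bd[OF pb pb] by (intro integrable_Om_bounded[where K="2 * pot_bound"]) auto
      show "integrable Om (\<lambda>x. m x * \<bar>?F (s * m x) - ?F s\<bar> + s * \<rho> ^ h / (1 - \<rho>))"
        by (intro Bochner_Integration.integrable_add gint Om.integrable_const)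
      fix x
      have c: "0 \<le> s * \<rho> ^ h / (1 - \<rho>)" using s0 \<rho>_nonneg \<rho>_less_1 by simp
      have "\<bar>m x * (pot base h (s * m x) - pot base h s)\<bar> \<le> m x * (\<bar>?F (s * m x) - ?F s\<bar> + s * \<rho> ^ h / (1 - \<rho>))"
        unfolding abs_mult abs_of_nonneg[OF m(1)]
        using s0 m by (intro mult_left_mono pot_base_diff_le m) (auto intro: mult_left_le)
      also have "\<dots> \<le> m x * \<bar>?F (s * m x) - ?F s\<bar> + s * \<rho> ^ h / (1 - \<rho>)"
        unfolding distrib_left using mult_right_mono[OF m(2) c] by simp
      finally show "\<bar>m x * (pot base h (s * m x) - pot base h s)\<bar> \<le> m x * \<bar>?F (s * m x) - ?F s\<bar> + s * \<rho> ^ h / (1 - \<rho>)" .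
    qed
    also have "\<dots> = g s + s * \<rho> ^ h / (1 - \<rho>)"
      by (subst Bochner_Integration.integral_add[OF gint]) (auto simp: g_def Om.prob_space)
    also have "\<dots> \<le> \<epsilon> + s * \<rho> ^ h / (1 - \<rho>)" using s1[of s] s by simp
    finally have "s * \<bar>\<integral>x. m x * (pot base h (s * m x) - pot base h s) \<partial>Om\<bar> \<le> s * (\<epsilon> + s * \<rho> ^ h / (1 - \<rho>))"
      using s0 by (rule mult_left_mono)
    then show ?thesis unfolding eq by (simp add: distrib_left power2_eq_square mult_ac)
  qed
  then show ?thesis using \<rho>_less_1 by (intro exI[of _ "max 0 s1"] conjI exI[of _ "1 / (1 - \<rho>)"] allI impI) auto
qed

text \<open>The total of this characteristic is the tree size at \<open>y\<close> minus
  \<open>q\<close> times that at \<open>y / q\<close>; it compares consecutive terms of a geometric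
  sequence.\<close>

lemma mark_dilation: assumes "q > 1" shows "mark q (\<lambda>s x. ind s - q * ind (s / q))"
proof -
  have "(\<lambda>(s, x). ind s - q * ind (s / q)) \<in> borel_measurable (borel \<Otimes>\<^sub>M Om)" by measurable
  then show ?thesis using assms by (auto simp: mark_def ind_def)
qed

lemma mean_dilation:
  assumes q: "q > 1" and \<epsilon>: "\<epsilon> > 0"
  shows "\<exists>s0\<ge>0. \<exists>D\<ge>0. \<forall>h. \<forall>s\<ge>s0. \<bar>mean (\<lambda>s x. ind s - q * ind (s / q)) h s\<bar> \<le> \<epsilon> * s + D * s\<^sup>2 * \<rho> ^ h"
proof -
  let ?F = "potential base"
  have "1 / q > 0" using q by simp
  from tendstoD[OF potential_base_scaling[OF this] \<epsilon>]
  obtain s1 where s1: "\<And>s. s \<ge> s1 \<Longrightarrow> \<bar>?F (s / q) - ?F s\<bar> < \<epsilon>"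
    by (auto simp: eventually_at_top_linorder dist_real_def)
  have "\<bar>mean (\<lambda>s x. ind s - q * ind (s / q)) h s\<bar> \<le> \<epsilon> * s + 1 / (1 - \<rho>) * s\<^sup>2 * \<rho> ^ h" if s: "s \<ge> max 0 s1" for s h
  proof -
    have s0: "0 \<le> s" "0 \<le> s / q" "s / q \<le> s" using s q mult_left_mono[of 1 q s] by (auto simp: pos_divide_le_eq)
    have "mean (\<lambda>s x. ind s - q * ind (s / q)) h s = (\<integral>x. total (\<lambda>s x. ind s) h s x - q * total (\<lambda>s x. ind s) h (s / q) x \<partial>Om)"
      by (simp add: mean_def total_def sum_subtractf sum_distrib_left)
    also have "\<dots> = mean (\<lambda>s x. ind s) h s - q * mean (\<lambda>s x. ind s) h (s / q)"
      unfolding mean_def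
      by (subst Bochner_Integration.integral_diff)
         (auto intro!: total_integrable[OF mark_ind] s0)
    also have "\<dots> = s * (pot base h s - pot base h (s / q))"
      using s0 q by (simp add: mean_ind right_diff_distrib)
    finally have "\<bar>mean (\<lambda>s x. ind s - q * ind (s / q)) h s\<bar> = s * \<bar>pot base h (s / q) - pot base h s\<bar>"
      using s0 by (simp add: abs_mult abs_minus_commute)
    also have "\<dots> \<le> s * (\<epsilon> + s * \<rho> ^ h / (1 - \<rho>))"
      using pot_base_diff_le[OF s0, of h] s1[of s] s by (intro mult_left_mono s0) auto
    finally show ?thesis by (simp add: distrib_left power2_eq_square mult_ac)
  qed
  then show ?thesis using \<rho>_less_1 by (intro exI[of _ "max 0 s1"] conjI exI[of _ "1 / (1 - \<rho>)"] allI impI) auto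
qed

end

section \<open>Convergence of empirical means\<close>

text \<open>The probability space is arbitrary so that the estimate applies both to the limit law
  and to the uniform law on the nodes of one fixed tree.\<close>

lemma expectation_finite_approx:
  fixes f :: "'s \<Rightarrow> real"
  assumes Q: "prob_space Q" and F: "finite F"
    and X: "\<And>S. S \<in> F \<Longrightarrow> {\<omega> \<in> space Q. X \<omega> = S} \<in> sets Q"
    and fX [measurable]: "(\<lambda>\<omega>. f (X \<omega>)) \<in> borel_measurable Q" and K: "\<And>s. \<bar>f s\<bar> \<le> K"
  shows "\<bar>(\<integral>\<omega>. f (X \<omega>) \<partial>Q) - (\<Sum>S\<in>F. f S * measure Q {\<omega> \<in> space Q. X \<omega> = S})\<bar>
    \<le> K * (1 - (\<Sum>S\<in>F. measure Q {\<omega> \<in> space Q. X \<omega> = S}))"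
proof -
  interpret Q: prob_space Q by (rule Q)
  define I where "I S = (indicat_real {\<omega> \<in> space Q. X \<omega> = S})" for S
  have Im [measurable]: "I S \<in> borel_measurable Q" if "S \<in> F" for S
    using X[OF that] by (simp add: I_def)
  have Ii: "integrable Q (I S)" if "S \<in> F" for S
    using X[OF that] by (simp add: I_def Q.emeasure_eq_measure)
  have Iint: "(\<integral>\<omega>. I S \<omega> \<partial>Q) = measure Q {\<omega> \<in> space Q. X \<omega> = S}" if "S \<in> F" for S
    using X[OF that] by (simp add: I_def)
  have fXi: "integrable Q (\<lambda>\<omega>. f (X \<omega>))"
    using K by (intro Q.integrable_const_bound[where B=K]) auto
  have sI: "(\<Sum>S\<in>F. g S * I S \<omega>) = (if X \<omega> \<in> F then g (X \<omega>) else 0)" if "\<omega> \<in> space Q" for \<omega> and g :: "'s \<Rightarrow> real"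
  proof -
    have "(\<Sum>S\<in>F. g S * I S \<omega>) = (\<Sum>S\<in>F. if X \<omega> = S then g S else 0)"
      using that by (intro sum.cong refl) (auto simp: I_def)
    then show ?thesis using F by simp
  qed
  have gi: "integrable Q (\<lambda>\<omega>. \<Sum>S\<in>F. g S * I S \<omega>)" for g :: "'s \<Rightarrow> real"
    by (intro Bochner_Integration.integrable_sum integrable_mult_right Ii)
  have gint: "(\<integral>\<omega>. (\<Sum>S\<in>F. g S * I S \<omega>) \<partial>Q) = (\<Sum>S\<in>F. g S * measure Q {\<omega> \<in> space Q. X \<omega> = S})" for g :: "'s \<Rightarrow> real"
    by (subst Bochner_Integration.integral_sum) (auto intro!: integrable_mult_right Ii sum.cong simp: Iint)
  have "(\<integral>\<omega>. f (X \<omega>) \<partial>Q) - (\<Sum>S\<in>F. f S * measure Q {\<omega> \<in> space Q. X \<omega> = S})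
      = (\<integral>\<omega>. f (X \<omega>) - (\<Sum>S\<in>F. f S * I S \<omega>) \<partial>Q)"
    by (simp add: Bochner_Integration.integral_diff[OF fXi gi] gint)
  also have "\<bar>(\<integral>\<omega>. f (X \<omega>) - (\<Sum>S\<in>F. f S * I S \<omega>) \<partial>Q)\<bar> \<le> (\<integral>\<omega>. \<bar>f (X \<omega>) - (\<Sum>S\<in>F. f S * I S \<omega>)\<bar> \<partial>Q)"
    by (rule integral_abs_bound)
  also have "\<dots> \<le> (\<integral>\<omega>. K * (1 - (\<Sum>S\<in>F. 1 * I S \<omega>)) \<partial>Q)"
  proof (rule integral_mono)
    fix \<omega> assume w: "\<omega> \<in> space Q"
    show "\<bar>f (X \<omega>) - (\<Sum>S\<in>F. f S * I S \<omega>)\<bar> \<le> K * (1 - (\<Sum>S\<in>F. 1 * I S \<omega>))"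
      unfolding sI[OF w] using K[of "X \<omega>"] by auto
  qed (intro integrable_abs integrable_mult_right Bochner_Integration.integrable_diff fXi gi Q.integrable_const)+
  also have "\<dots> = K * (1 - (\<Sum>S\<in>F. measure Q {\<omega> \<in> space Q. X \<omega> = S}))"
    using gint[of "\<lambda>_. 1"] gi[of "\<lambda>_. 1"] by (simp add: Q.prob_space)
  finally show ?thesis .
qed

lemma (in prob_space) finite_subset_prob_close_to_1:
  assumes R: "countable R" and X: "\<And>S. S \<in> R \<Longrightarrow> {\<omega> \<in> space M. X \<omega> = S} \<in> sets M"
    and ae: "AE \<omega> in M. X \<omega> \<in> R" and e: "e > 0"
  shows "\<exists>F\<subseteq>R. finite F \<and> (\<Sum>S\<in>F. prob {\<omega> \<in> space M. X \<omega> = S}) > 1 - e"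
proof -
  have "R \<noteq> {}" using ae AE_False by auto
  define F where "F n = from_nat_into R ` {..<n}" for n :: nat
  have FR: "F n \<subseteq> R" for n using from_nat_into[OF \<open>R \<noteq> {}\<close>] by (auto simp: F_def)
  define E where "E n = (\<Union>S\<in>F n. {\<omega> \<in> space M. X \<omega> = S})" for n
  have Em: "E n \<in> sets M" for n
    unfolding E_def using FR X by (intro sets.finite_UN) (auto simp: F_def)
  have "incseq E" by (force simp: incseq_def E_def F_def)
  have "(\<lambda>n. prob (E n)) \<longlonglongrightarrow> prob (\<Union>n. E n)"
    by (rule finite_Lim_measure_incseq) (use Em \<open>incseq E\<close> in auto)
  also have "prob (\<Union>n. E n) = 1"
  proof (subst prob_eq_1)
    show "(\<Union>n. E n) \<in> sets M" using Em by auto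
    show "AE \<omega> in M. \<omega> \<in> (\<Union>n. E n)" using ae AE_space
    proof eventually_elim
      case (elim \<omega>)
      then obtain n where "from_nat_into R n = X \<omega>" using from_nat_into_surj[OF R] by blast
      then have "X \<omega> \<in> F (Suc n)" by (force simp: F_def)
      then show ?case using elim by (auto simp: E_def)
    qed
  qed
  finally have "\<forall>\<^sub>F n in sequentially. prob (E n) > 1 - e" using e by (intro order_tendstoD(1)) auto
  then obtain n where "prob (E n) > 1 - e" by (auto simp: eventually_sequentially)
  moreover have "prob (E n) = (\<Sum>S\<in>F n. prob {\<omega> \<in> space M. X \<omega> = S})"
    unfolding E_def using FR X
    by (intro finite_measure_finite_Union) (auto simp: F_def disjoint_family_on_def)
  ultimately show ?thesis using FR by (intro exI[of _ "F n"]) (auto simp: F_def)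
qed

text \<open>No mass can escape: finitely many values carry almost all of the limit law, hence
  eventually almost all of the empirical frequencies, and on these values convergence is
  termwise.\<close>

lemma (in prob_space) empirical_mean_tendsto:
  fixes f :: "'s \<Rightarrow> real" and T :: "'i \<Rightarrow> 'n set"
  assumes R: "countable R" and X: "\<And>S. S \<in> R \<Longrightarrow> {\<omega> \<in> space M. X \<omega> = S} \<in> sets M"
    and ae: "AE \<omega> in M. X \<omega> \<in> R"
    and fin: "\<forall>\<^sub>F y in G. finite (T y) \<and> T y \<noteq> {}"
    and lim: "\<And>S. S \<in> R \<Longrightarrow> ((\<lambda>y. real (card {v \<in> T y. st y v = S}) / real (card (T y))) \<longlongrightarrow> prob {\<omega> \<in> space M. X \<omega> = S}) G"
    and fX: "(\<lambda>\<omega>. f (X \<omega>)) \<in> borel_measurable M" and K: "\<And>s. \<bar>f s\<bar> \<le> K"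
  shows "((\<lambda>y. (\<Sum>v\<in>T y. f (st y v)) / real (card (T y))) \<longlongrightarrow> (\<integral>\<omega>. f (X \<omega>) \<partial>M)) G"
proof (rule tendstoI)
  fix e :: real assume e: "e > 0"
  have K0: "0 \<le> K" using K[of undefined] by linarith
  \<comment> \<open>The errors are \<open>K * e'\<close> from each of the two tails and
    \<open>e'\<close> from the finite sum, together less than \<open>e\<close>.\<close>
  define e' where "e' = e / (4 * K + 4)"
  have K4: "4 * K + 4 > 0" using K0 by simp
  have e': "e' > 0" using e K4 by (simp add: e'_def)
  have e'2: "4 * (K * e') + 4 * e' = e"
  proof -
    have "(4 * K + 4) * e' = e" using K4 by (simp add: e'_def)
    then show ?thesis by (simp add: algebra_simps)
  qed
  obtain F where F: "F \<subseteq> R" "finite F" "(\<Sum>S\<in>F. prob {\<omega> \<in> space M. X \<omega> = S}) > 1 - e'"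
    using finite_subset_prob_close_to_1[OF R X ae e'] by auto
  let ?p = "\<lambda>S. prob {\<omega> \<in> space M. X \<omega> = S}"
  let ?a = "\<lambda>y S. real (card {v \<in> T y. st y v = S}) / real (card (T y))"
  have l1: "((\<lambda>y. \<Sum>S\<in>F. ?a y S) \<longlongrightarrow> (\<Sum>S\<in>F. ?p S)) G" using F by (intro tendsto_sum lim) auto
  have l2: "((\<lambda>y. \<Sum>S\<in>F. f S * ?a y S) \<longlongrightarrow> (\<Sum>S\<in>F. f S * ?p S)) G" using F by (intro tendsto_sum tendsto_mult lim tendsto_const) auto
  show "\<forall>\<^sub>F y in G. dist ((\<Sum>v\<in>T y. f (st y v)) / real (card (T y))) (\<integral>\<omega>. f (X \<omega>) \<partial>M) < e"
    using fin order_tendstoD(1)[OF l1 F(3)] tendstoD[OF l2 e']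
  proof eventually_elim
    case (elim y)
    define Q where "Q = measure_pmf (pmf_of_set (T y))"
    have ne: "T y \<noteq> {}" "finite (T y)" using elim by auto
    have Qm: "measure Q {v \<in> space Q. st y v = S} = ?a y S" for S
      unfolding Q_def using ne by (simp add: measure_pmf_of_set Int_def)
    have Qi: "(\<integral>v. f (st y v) \<partial>Q) = (\<Sum>v\<in>T y. f (st y v)) / real (card (T y))"
      unfolding Q_def using ne by (simp add: integral_pmf_of_set)
    have 1: "\<bar>(\<integral>v. f (st y v) \<partial>Q) - (\<Sum>S\<in>F. f S * ?a y S)\<bar> \<le> K * (1 - (\<Sum>S\<in>F. ?a y S))"
      using expectation_finite_approx[of Q F "st y" f K] F(2) K unfolding Qm by (auto simp: Q_def prob_space_measure_pmf)
    have 2: "\<bar>(\<integral>\<omega>. f (X \<omega>) \<partial>M) - (\<Sum>S\<in>F. f S * ?p S)\<bar> \<le> K * (1 - (\<Sum>S\<in>F. ?p S))"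
      using expectation_finite_approx[of M F X f K, OF prob_space_axioms F(2) _ fX K] X F(1) by auto
    have "K * (1 - (\<Sum>S\<in>F. ?a y S)) \<le> K * e'" using elim K0 by (intro mult_left_mono) auto
    moreover have "K * (1 - (\<Sum>S\<in>F. ?p S)) \<le> K * e'" using F(3) K0 by (intro mult_left_mono) auto
    moreover have "0 \<le> K * e'" using K0 e' by simp
    ultimately show ?case using 1 2 elim e' e'2 e unfolding Qi dist_real_def by linarith
  qed
qed

text \<open>For \<open>y\<close> between \<open>q ^ k\<close> and \<open>q ^ Suc k\<close>,
  monotonicity traps the quotient between \<open>r k / s k\<close> and
  \<open>r (Suc k) * s k\<close>, whose limits are \<open>p / q\<close> and \<open>p * q\<close>.
  The hypothesis \<open>lc\<close> supplies the limit \<open>q\<close> of the growth factor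
  \<open>s\<close> of \<open>c\<close>.\<close>

lemma geometric_ratio_tendsto:
  fixes a c :: "real \<Rightarrow> real" and B :: real
  assumes B: "B > 0" and p: "0 \<le> p" "p \<le> 1"
    and amono: "\<And>s t. 0 \<le> s \<Longrightarrow> s \<le> t \<Longrightarrow> a s \<le> a t" and cmono: "\<And>s t. 0 \<le> s \<Longrightarrow> s \<le> t \<Longrightarrow> c s \<le> c t"
    and a0: "\<And>s. 0 \<le> a s" and low: "\<And>y. y \<ge> 1 \<Longrightarrow> y \<le> B * c y"
    and la: "\<And>n. (\<lambda>k. (a ((1 + 1 / real (Suc n)) ^ k) - p * c ((1 + 1 / real (Suc n)) ^ k)) / (1 + 1 / real (Suc n)) ^ k) \<longlonglongrightarrow> 0"
    and lc: "\<And>n. (\<lambda>k. (c ((1 + 1 / real (Suc n)) ^ k) - (1 + 1 / real (Suc n)) * c ((1 + 1 / real (Suc n)) ^ k / (1 + 1 / real (Suc n)))) / (1 + 1 / real (Suc n)) ^ k) \<longlonglongrightarrow> 0"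
  shows "((\<lambda>y. a y / c y) \<longlongrightarrow> p) at_top"
proof (rule tendstoI)
  fix e :: real assume e: "e > 0"
  \<comment> \<open>As \<open>p \<le> 1\<close>, a ratio \<open>q < 1 + e\<close> puts both
    \<open>p / q\<close> and \<open>p * q\<close> within \<open>e\<close> of
    \<open>p\<close>.\<close>
  obtain n where n: "inverse (real (Suc n)) < e" using reals_Archimedean[OF e] by blast
  define q where "q = 1 + 1 / real (Suc n)"
  have q: "q > 1" "q - 1 < e" using n by (auto simp: q_def inverse_eq_divide)
  have la: "(\<lambda>k. (a (q ^ k) - p * c (q ^ k)) / q ^ k) \<longlonglongrightarrow> 0" using la[of n] by (simp add: q_def)
  have lc: "(\<lambda>k. (c (q ^ k) - q * c (q ^ k / q)) / q ^ k) \<longlonglongrightarrow> 0" using lc[of n] by (simp add: q_def)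
  have qk: "q ^ k \<ge> 1" for k using q by (intro one_le_power) simp
  have cpos: "c y > 0" if "y \<ge> 1" for y
  proof -
    have "0 < B * c y" using low[OF that] that by linarith
    then show ?thesis using B by (simp add: zero_less_mult_iff)
  qed
  have ck: "q ^ k \<le> B * c (q ^ k)" "c (q ^ k) > 0" for k using low[OF qk] cpos[OF qk] by auto
  define r where "r k = a (q ^ k) / c (q ^ k)" for k
  define s where "s k = c (q ^ Suc k) / c (q ^ k)" for k
  \<comment> \<open>By \<open>low\<close>, the denominators \<open>c (q ^ k)\<close> are at least
    \<open>q ^ k / B\<close>, so limits scaled by \<open>q ^ k\<close> become limits scaled by
    \<open>c (q ^ k)\<close>.\<close>
  have r: "r \<longlonglongrightarrow> p"
  proof -
    have "(\<lambda>k. r k - p) \<longlonglongrightarrow> 0"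
    proof (rule Lim_null_comparison)
      show "(\<lambda>k. B * \<bar>(a (q ^ k) - p * c (q ^ k)) / q ^ k\<bar>) \<longlonglongrightarrow> 0"
        by (rule tendsto_mult_right_zero[OF tendsto_rabs_zero[OF la]])
      show "\<forall>\<^sub>F k in sequentially. norm (r k - p) \<le> B * \<bar>(a (q ^ k) - p * c (q ^ k)) / q ^ k\<bar>"
      proof (intro always_eventually allI)
        fix k
        have "r k - p = (a (q ^ k) - p * c (q ^ k)) / c (q ^ k)" using ck(2)[of k] by (simp add: r_def field_simps)
        then have "norm (r k - p) = \<bar>a (q ^ k) - p * c (q ^ k)\<bar> * (1 / c (q ^ k))" using ck(2)[of k] by (simp add: abs_divide)
        also have "\<dots> \<le> \<bar>a (q ^ k) - p * c (q ^ k)\<bar> * (B / q ^ k)"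
          using ck[of k] qk[of k] by (intro mult_left_mono) (simp_all add: field_simps)
        also have "\<dots> = B * \<bar>(a (q ^ k) - p * c (q ^ k)) / q ^ k\<bar>" using qk[of k] by (simp add: abs_divide)
        finally show "norm (r k - p) \<le> B * \<bar>(a (q ^ k) - p * c (q ^ k)) / q ^ k\<bar>" .
      qed
    qed
    then show ?thesis by (rule LIM_zero_cancel)
  qed
  have s: "s \<longlonglongrightarrow> q"
  proof -
    have lc': "(\<lambda>k. (c (q ^ Suc k) - q * c (q ^ k)) / q ^ Suc k) \<longlonglongrightarrow> 0"
      using LIMSEQ_Suc[OF lc] q by simp
    have "(\<lambda>k. s k - q) \<longlonglongrightarrow> 0"
    proof (rule Lim_null_comparison)
      show "(\<lambda>k. B * q * \<bar>(c (q ^ Suc k) - q * c (q ^ k)) / q ^ Suc k\<bar>) \<longlonglongrightarrow> 0"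
        by (rule tendsto_mult_right_zero[OF tendsto_rabs_zero[OF lc']])
      show "\<forall>\<^sub>F k in sequentially. norm (s k - q) \<le> B * q * \<bar>(c (q ^ Suc k) - q * c (q ^ k)) / q ^ Suc k\<bar>"
      proof (intro always_eventually allI)
        fix k
        have "s k - q = (c (q ^ Suc k) - q * c (q ^ k)) / c (q ^ k)" using ck(2)[of k] by (simp add: s_def field_simps)
        then have "norm (s k - q) = \<bar>c (q ^ Suc k) - q * c (q ^ k)\<bar> * (1 / c (q ^ k))" using ck(2)[of k] by (simp add: abs_divide)
        also have "\<dots> \<le> \<bar>c (q ^ Suc k) - q * c (q ^ k)\<bar> * (B * q / q ^ Suc k)"
          using ck[of k] qk[of k] q by (intro mult_left_mono) (simp_all add: field_simps)
        also have "\<dots> = B * q * (\<bar>c (q ^ Suc k) - q * c (q ^ k)\<bar> / q ^ Suc k)" by simp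
        also have "\<bar>c (q ^ Suc k) - q * c (q ^ k)\<bar> / q ^ Suc k = \<bar>(c (q ^ Suc k) - q * c (q ^ k)) / q ^ Suc k\<bar>"
          using qk[of "Suc k"] by (simp only: abs_divide)
        finally show "norm (s k - q) \<le> B * q * \<bar>(c (q ^ Suc k) - q * c (q ^ k)) / q ^ Suc k\<bar>" .
      qed
    qed
    then show ?thesis by (rule LIM_zero_cancel)
  qed
  have up: "(\<lambda>k. r (Suc k) * s k) \<longlonglongrightarrow> p * q" by (intro tendsto_mult LIMSEQ_Suc[OF r] s)
  have lo: "(\<lambda>k. r k / s k) \<longlonglongrightarrow> p / q" using q by (intro tendsto_divide r s) simp
  have pq: "p * q < p + e" "p / q > p - e"
  proof -
    have "p * (q - 1) \<le> 1 * (q - 1)" using p q by (intro mult_right_mono) auto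
    then show "p * q < p + e" using q by (simp add: algebra_simps)
    have "p / q = p - p * ((q - 1) / q)" using q by (simp add: field_simps)
    moreover have "p * ((q - 1) / q) \<le> 1 * (q - 1)" using p q by (intro mult_mono) (auto simp: divide_le_eq)
    ultimately show "p / q > p - e" using q by simp
  qed
  obtain k0 where k0: "\<And>k. k \<ge> k0 \<Longrightarrow> r (Suc k) * s k < p + e" "\<And>k. k \<ge> k0 \<Longrightarrow> r k / s k > p - e"
    using eventually_conj[OF order_tendstoD(2)[OF up pq(1)] order_tendstoD(1)[OF lo pq(2)]]
    by (auto simp: eventually_sequentially)
  have "dist (a y / c y) p < e" if y: "y \<ge> q ^ k0" for y
  proof -
    have y1: "y \<ge> 1" using y qk[of k0] by linarith
    define k where "k = nat \<lfloor>log q y\<rfloor>"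
    have lg: "0 \<le> log q y" using q y1 by simp
    have "real k \<le> log q y" "log q y < real k + 1" using lg unfolding k_def by linarith+
    then have "q powr real k \<le> y" "y < q powr (real k + 1)" using q y1 by (auto simp: le_log_iff log_less_iff)
    moreover have "q powr (real k + 1) = q ^ Suc k" using q by (simp add: powr_add powr_realpow)
    ultimately have k: "q ^ k \<le> y" "y < q ^ Suc k" using q by (auto simp: powr_realpow)
    have "k \<ge> k0"
    proof (rule ccontr)
      assume "\<not> k \<ge> k0"
      then have "q ^ Suc k \<le> q ^ k0" using q by (intro power_increasing) auto
      then show False using k y by linarith
    qed
    have q0: "0 \<le> q ^ k" "0 \<le> y" using qk[of k] y1 by auto
    have cm: "c (q ^ k) \<le> c y" "c y \<le> c (q ^ Suc k)" "a (q ^ k) \<le> a y" "a y \<le> a (q ^ Suc k)"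
      using q0 k by (auto intro!: cmono amono)
    have "a y / c y \<le> a (q ^ Suc k) / c (q ^ k)"
      using cm ck(2)[of k] a0[of y] cpos[OF y1] by (intro frac_le a0) auto
    also have "\<dots> = r (Suc k) * s k" using ck(2)[of "Suc k"] unfolding r_def s_def by simp
    also have "\<dots> < p + e" using k0 \<open>k \<ge> k0\<close> by simp
    finally have 1: "a y / c y < p + e" .
    have "a (q ^ k) / c (q ^ Suc k) \<le> a y / c y"
      using cm ck(2)[of k] a0[of y] cpos[OF y1] by (intro frac_le a0) auto
    moreover have "a (q ^ k) / c (q ^ Suc k) = r k / s k" using ck(2)[of k] unfolding r_def s_def by simp
    ultimately have "a y / c y > p - e" using k0(2)[OF \<open>k \<ge> k0\<close>] by linarith
    then show ?thesis using 1 by (simp add: dist_real_def abs_less_iff)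
  qed
  then show "\<forall>\<^sub>F y in at_top. dist (a y / c y) p < e" by (auto simp: eventually_at_top_linorder)
qed

context splitting
begin

section \<open>Fringe trees of the canonical fragmentation tree\<close>

definition ftree :: "(node \<Rightarrow> 'a) \<Rightarrow> real \<Rightarrow> tree" where
  "ftree x y = {v \<in> nodes b. 1 \<le> y * mass x v}"

definition covering :: "(node \<Rightarrow> 'a) \<Rightarrow> real \<Rightarrow> tree \<Rightarrow> node set" where
  "covering x y A = {v \<in> ftree x y. A \<subseteq> subtree_at (ftree x y) v}"

definition min_mass :: "tree \<Rightarrow> (node \<Rightarrow> 'a) \<Rightarrow> real" where
  "min_mass A x = Min (mass x ` A)"

lemma ftree_nodes: "ftree x y \<subseteq> nodes b"
  by (auto simp: ftree_def)

lemma Nil_in_ftree [simp]: "[] \<in> ftree x y \<longleftrightarrow> 1 \<le> y"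
  by (simp add: ftree_def)

lemma mass_append_le: "u @ w \<in> nodes b \<Longrightarrow> mass x (u @ w) \<le> mass x u"
  by (simp add: mass_append mult_left_le mass_nonneg mass_le_1)

lemma ftree_prefix: "0 \<le> y \<Longrightarrow> u @ w \<in> ftree x y \<Longrightarrow> u \<in> ftree x y"
  using mult_left_mono[OF mass_append_le[of u w x], of y] by (auto simp: ftree_def)

lemma ftree_mono: "y \<le> y' \<Longrightarrow> ftree x y \<subseteq> ftree x y'"
  using mult_right_mono[OF _ mass_nonneg, of y y' x] by (auto simp: ftree_def intro: order_trans)

lemma subtree_at_ftree: "v \<in> nodes b \<Longrightarrow> subtree_at (ftree x y) v = ftree (shift v x) (y * mass x v)"
  by (auto simp: subtree_at_def ftree_def mass_append mult.assoc)

lemma rooted_ftree: "1 \<le> y \<Longrightarrow> finite (ftree x y) \<Longrightarrow> rooted_tree (ftree x y)"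
  by (auto simp: rooted_tree_def intro: ftree_prefix[of y])

lemma min_mass_bounds:
  assumes "finite A" "A \<noteq> {}"
  shows "0 \<le> min_mass A x" "min_mass A x \<le> 1"
  using assms mass_nonneg mass_le_1 by (auto simp: min_mass_def Min_ge_iff Min_le_iff)

lemma min_mass_measurable:
  assumes "finite A" "A \<subseteq> nodes b"
  shows "min_mass A \<in> borel_measurable Om"
  unfolding min_mass_def[abs_def] using assms by (intro borel_measurable_Min mass_measurable) auto

lemma subset_ftree_iff:
  assumes "finite A" "A \<noteq> {}" "A \<subseteq> nodes b" "0 \<le> s"
  shows "A \<subseteq> ftree x s \<longleftrightarrow> 1 \<le> s * min_mass A x"
proof
  assume *: "A \<subseteq> ftree x s"
  have "min_mass A x \<in> mass x ` A" unfolding min_mass_def using assms by (intro Min_in) auto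
  then show "1 \<le> s * min_mass A x" using * by (auto simp: ftree_def)
next
  assume *: "1 \<le> s * min_mass A x"
  show "A \<subseteq> ftree x s"
  proof
    fix a assume a: "a \<in> A"
    then have "min_mass A x \<le> mass x a" unfolding min_mass_def using assms by (intro Min_le) auto
    then have "s * min_mass A x \<le> s * mass x a" using assms by (intro mult_left_mono)
    then show "a \<in> ftree x s" using * a assms by (auto simp: ftree_def)
  qed
qed

text \<open>With \<open>[] \<in> A\<close>, covering \<open>A\<close> already forces
  \<open>v\<close> into the tree, so a single inequality on masses decides membership.\<close>

lemma covering_eq:
  assumes "finite A" "[] \<in> A" "A \<subseteq> nodes b" "0 \<le> y"
  shows "covering x y A = {v \<in> nodes b. 1 \<le> y * mass x v * min_mass A (shift v x)}"
proof -
  have "A \<subseteq> subtree_at (ftree x y) v \<longleftrightarrow> 1 \<le> y * mass x v * min_mass A (shift v x)" if "v \<in> nodes b" for v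
    unfolding subtree_at_ftree[OF that] using assms mass_nonneg by (intro subset_ftree_iff) auto
  moreover have "v \<in> ftree x y" if "A \<subseteq> subtree_at (ftree x y) v" for v
    using assms(2) that by (auto simp: subtree_at_def)
  ultimately show ?thesis using ftree_nodes[of x y] by (auto simp: covering_def)
qed

lemma covering_mono: "0 \<le> y \<Longrightarrow> y \<le> y' \<Longrightarrow> covering x y A \<subseteq> covering x y' A"
  using ftree_mono[of y y' x] by (auto simp: covering_def subtree_at_def)

lemma covering_subset: "covering x y A \<subseteq> ftree x y"
  by (auto simp: covering_def)

definition extinct_at :: "(node \<Rightarrow> 'a) \<Rightarrow> real \<Rightarrow> nat \<Rightarrow> bool" where
  "extinct_at x y h \<longleftrightarrow> (\<forall>v\<in>gen b h. y * mass x v < 1)"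

lemma ftree_below:
  assumes "extinct_at x y h" "0 \<le> y"
  shows "ftree x y \<subseteq> below b h"
proof
  fix v assume v: "v \<in> ftree x y"
  have vn: "v \<in> nodes b" using v by (simp add: ftree_def)
  show "v \<in> below b h"
  proof (rule ccontr)
    assume "v \<notin> below b h"
    then have "length v \<ge> h" using vn by (simp add: below_def)
    then have "take h v \<in> gen b h" using vn by (simp add: gen_def nodes_take)
    moreover have "take h v \<in> ftree x y" using ftree_prefix[OF assms(2), of "take h v" "drop h v" x] v by simp
    ultimately show False using assms(1) by (auto simp: extinct_at_def ftree_def)
  qed
qed

text \<open>Once the tree is extinct at generation \<open>h\<close>, truncation loses nothing and
  the total is an actual count of nodes.\<close>

lemma total_scaled_ind:
  assumes "finite A" "[] \<in> A" "A \<subseteq> nodes b" "0 \<le> y" "extinct_at x y h"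
  shows "total (\<lambda>s x. ind (s * min_mass A x)) h y x = real (card (covering x y A))"
proof -
  have "covering x y A \<subseteq> below b h" using covering_subset ftree_below[OF assms(5,4)] by blast
  then have "{v \<in> below b h. 1 \<le> y * mass x v * min_mass A (shift v x)} = covering x y A"
    unfolding covering_eq[OF assms(1-4)] by (auto dest: below_nodes)
  moreover have "total (\<lambda>s x. ind (s * min_mass A x)) h y x = real (card {v \<in> below b h. 1 \<le> y * mass x v * min_mass A (shift v x)})"
    unfolding total_def ind_def by (simp add: sum.If_cases Int_def)
  ultimately show ?thesis by simp
qed

lemma total_ind:
  assumes "0 \<le> y" "extinct_at x y h"
  shows "total (\<lambda>s x. ind s) h y x = real (card (ftree x y))"
proof -
  have "min_mass {[]} z = 1" for z by (simp add: min_mass_def)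
  moreover have "covering x y {[]} = ftree x y" by (auto simp: covering_def subtree_at_def)
  ultimately show ?thesis using total_scaled_ind[of "{[]}" y x h] assms by simp
qed

text \<open>One null set serves all \<open>y\<close>: the trees increase with \<open>y\<close>, and
  extinction along the powers of \<open>2\<close> bounds each of them.\<close>

lemma finite_ftree_AE: "AE x in Om. \<forall>y. finite (ftree x y)"
proof -
  obtain K H where g: "good_rate 2 K H" using good_rate_exists[of 2] by auto
  show ?thesis using extinct_AE[OF g]
  proof eventually_elim
    case (elim x)
    show ?case
    proof
      fix y :: real
      obtain k where k: "\<forall>v\<in>gen b (level K H k). 2 ^ k * mass x v < 1" "y \<le> 2 ^ k"
      proof -
        obtain k1 where k1: "\<And>k. k \<ge> k1 \<Longrightarrow> \<forall>v\<in>gen b (level K H k). 2 ^ k * mass x v < 1"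
          using elim by (auto simp: eventually_sequentially)
        obtain k2 where "y < 2 ^ k2" using real_arch_pow[of 2 y] by auto
        moreover have "(2::real) ^ k2 \<le> 2 ^ max k1 k2" by (intro power_increasing) auto
        ultimately have "y \<le> 2 ^ max k1 k2" by linarith
        then show ?thesis using k1[of "max k1 k2"] that[of "max k1 k2"] by simp
      qed
      then have "extinct_at x (2 ^ k) (level K H k)" by (simp add: extinct_at_def)
      from ftree_below[OF this] have "finite (ftree x (2 ^ k))" by (auto intro: finite_subset)
      then show "finite (ftree x y)" using ftree_mono[OF k(2)] by (rule finite_subset[rotated])
    qed
  qed
qed

lemma covering_deviation_AE:
  assumes A: "finite A" "[] \<in> A" "A \<subseteq> nodes b" and q: "q > 1"
  shows "AE x in Om. (\<lambda>k. (real (card (covering x (q ^ k) A)) - (\<integral>x. min_mass A x \<partial>Om) * real (card (ftree x (q ^ k)))) / q ^ k) \<longlonglongrightarrow> 0"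
proof -
  obtain K H where g: "good_rate q K H" using good_rate_exists[OF q] by auto
  let ?p = "\<integral>x. min_mass A x \<partial>Om"
  have mm: "min_mass A \<in> borel_measurable Om" "0 \<le> min_mass A x" "min_mass A x \<le> 1" for x
    using min_mass_measurable[of A] min_mass_bounds[of A x] A by auto
  have "AE x in Om. (\<lambda>k. total (\<lambda>s x. ind (s * min_mass A x) - ?p * ind s) (level K H k) (q ^ k) x / q ^ k) \<longlonglongrightarrow> 0"
    by (rule total_sublinear_AE[OF mark_deviation[OF mm] g mean_deviation[OF mm]])
  with extinct_AE[OF g] show ?thesis
  proof eventually_elim
    case (elim x)
    have "\<forall>\<^sub>F k in sequentially. total (\<lambda>s x. ind (s * min_mass A x) - ?p * ind s) (level K H k) (q ^ k) x / q ^ k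
        = (real (card (covering x (q ^ k) A)) - ?p * real (card (ftree x (q ^ k)))) / q ^ k"
      using elim(1)
    proof eventually_elim
      case (elim k)
      then have ex: "extinct_at x (q ^ k) (level K H k)" by (simp add: extinct_at_def)
      have q0: "0 \<le> q ^ k" using q by simp
      have "total (\<lambda>s x. ind (s * min_mass A x) - ?p * ind s) (level K H k) (q ^ k) x
        = total (\<lambda>s x. ind (s * min_mass A x)) (level K H k) (q ^ k) x - ?p * total (\<lambda>s x. ind s) (level K H k) (q ^ k) x"
        by (simp add: total_def sum_subtractf sum_distrib_left)
      then show ?case by (simp add: total_scaled_ind[OF A q0 ex] total_ind[OF q0 ex])
    qed
    then show ?case by (rule Lim_transform_eventually[OF elim(2)])
  qed
qed

lemma size_dilation_AE:
  assumes q: "q > 1"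
  shows "AE x in Om. (\<lambda>k. (real (card (ftree x (q ^ k))) - q * real (card (ftree x (q ^ k / q)))) / q ^ k) \<longlonglongrightarrow> 0"
proof -
  obtain K H where g: "good_rate q K H" using good_rate_exists[OF q] by auto
  have "AE x in Om. (\<lambda>k. total (\<lambda>s x. ind s - q * ind (s / q)) (level K H k) (q ^ k) x / q ^ k) \<longlonglongrightarrow> 0"
    by (rule total_sublinear_AE[OF mark_dilation[OF q] g mean_dilation[OF q]])
  with extinct_AE[OF g] show ?thesis
  proof eventually_elim
    case (elim x)
    have "\<forall>\<^sub>F k in sequentially. total (\<lambda>s x. ind s - q * ind (s / q)) (level K H k) (q ^ k) x / q ^ k
        = (real (card (ftree x (q ^ k))) - q * real (card (ftree x (q ^ k / q)))) / q ^ k"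
      using elim(1)
    proof eventually_elim
      case (elim k)
      then have ex: "extinct_at x (q ^ k) (level K H k)" by (simp add: extinct_at_def)
      have q0: "0 \<le> q ^ k" "0 \<le> q ^ k / q" using q by auto
      have "q ^ k / q \<le> q ^ k" using q mult_left_mono[of 1 q "q ^ k"] by (simp add: pos_divide_le_eq)
      then have ex2: "extinct_at x (q ^ k / q) (level K H k)"
        using ex mult_right_mono[OF _ mass_nonneg, of "q ^ k / q" "q ^ k"] unfolding extinct_at_def by (meson le_less_trans)
      have "total (\<lambda>s x. ind s - q * ind (s / q)) (level K H k) (q ^ k) x
        = total (\<lambda>s x. ind s) (level K H k) (q ^ k) x - q * total (\<lambda>s x. ind s) (level K H k) (q ^ k / q) x"
        by (simp add: total_def sum_subtractf sum_distrib_left)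
      then show ?case by (simp add: total_ind[OF q0(1) ex] total_ind[OF q0(2) ex2])
    qed
    then show ?case by (rule Lim_transform_eventually[OF elim(2)])
  qed
qed

text \<open>A tree has at most \<open>b\<close> children per node outside it, each of mass below the threshold, and
  together they carry the whole initial mass.\<close>

lemma ftree_size_ge:
  assumes y: "1 \<le> y" and fin: "finite (ftree x y)"
  shows "y \<le> real b * real (card (ftree x y))"
proof -
  let ?T = "ftree x y"
  define f where "f v = (if v \<in> ?T then mass x v else 0)" for v
  define g where "g v = (if v \<in> ?T then real b / y else 0)" for v
  have step: "f v \<le> (\<Sum>j<b. f (v @ [j])) + g v" if v: "v \<in> nodes b" for v
  proof (cases "v \<in> ?T")
    case True
    have "mass x (v @ [j]) \<le> f (v @ [j]) + 1 / y" if "j < b" for j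
      using that v y by (auto simp: f_def ftree_def mass_nonneg not_le field_simps)
    then have "(\<Sum>j<b. mass x (v @ [j])) \<le> (\<Sum>j<b. f (v @ [j]) + 1 / y)" by (intro sum_mono) auto
    then have "mass x v \<le> (\<Sum>j<b. f (v @ [j])) + real b / y"
      by (simp add: mass_snoc sum_distrib_left[symmetric] W_sum sum.distrib)
    then show ?thesis using True by (simp add: f_def g_def)
  next
    case False
    then show ?thesis by (auto simp: f_def g_def mass_nonneg intro!: sum_nonneg)
  qed
  have ind: "1 \<le> (\<Sum>v\<in>gen b n. f v) + (\<Sum>v\<in>below b n. g v)" for n
  proof (induction n)
    case 0 then show ?case using y by (simp add: f_def sum_below)
  next
    case (Suc n)
    have "(\<Sum>v\<in>gen b n. f v) \<le> (\<Sum>v\<in>gen b n. (\<Sum>j<b. f (v @ [j])) + g v)"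
      by (intro sum_mono step gen_nodes)
    then show ?case using Suc by (simp add: sum_gen_Suc sum_below sum.distrib)
  qed
  define N where "N = Suc (Max (length ` ?T))"
  have len: "length v < N" if "v \<in> ?T" for v
    unfolding N_def using that fin by (simp add: less_Suc_eq_le)
  have "f v = 0" if "v \<in> gen b N" for v
    using that len[of v] by (auto simp: f_def gen_def)
  then have "1 \<le> (\<Sum>v\<in>below b N. g v)" using ind[of N] by simp
  also have "(\<Sum>v\<in>below b N. g v) = (\<Sum>v\<in>?T. real b / y)"
    unfolding g_def using len ftree_nodes[of x y] by (intro sum.mono_neutral_cong_right finite_below) (auto simp: below_def)
  finally show ?thesis using y by (simp add: field_simps)
qed

lemma covering_ratio_AE:
  assumes A: "finite A" "[] \<in> A" "A \<subseteq> nodes b"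
  shows "AE x in Om. ((\<lambda>y. real (card (covering x y A)) / real (card (ftree x y))) \<longlongrightarrow> (\<integral>x. min_mass A x \<partial>Om)) at_top"
proof -
  \<comment> \<open>Countably many ratios tending to \<open>1\<close>, so that the exceptional sets
    unite to a null set.\<close>
  let ?q = "\<lambda>n. 1 + 1 / real (Suc n)"
  let ?p = "\<integral>x. min_mass A x \<partial>Om"
  have mm: "min_mass A \<in> borel_measurable Om" "0 \<le> min_mass A x" "min_mass A x \<le> 1" for x
    using min_mass_measurable[of A] min_mass_bounds[of A x] A by auto
  have p: "0 \<le> ?p" "?p \<le> 1"
  proof -
    show "0 \<le> ?p" using mm by (intro integral_nonneg_AE) auto
    have "?p \<le> (\<integral>x. 1 \<partial>Om)" using mm by (intro integral_mono integrable_Om_bounded[where K=1]) auto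
    then show "?p \<le> 1" by (simp add: Om.prob_space)
  qed
  have "AE x in Om. \<forall>n. (\<lambda>k. (real (card (covering x (?q n ^ k) A)) - ?p * real (card (ftree x (?q n ^ k)))) / ?q n ^ k) \<longlonglongrightarrow> 0"
    unfolding AE_all_countable by (intro allI covering_deviation_AE A) simp
  moreover have "AE x in Om. \<forall>n. (\<lambda>k. (real (card (ftree x (?q n ^ k))) - ?q n * real (card (ftree x (?q n ^ k / ?q n)))) / ?q n ^ k) \<longlonglongrightarrow> 0"
    unfolding AE_all_countable by (intro allI size_dilation_AE) simp
  ultimately show ?thesis using finite_ftree_AE
  proof eventually_elim
    case (elim x)
    show ?case
    proof (rule geometric_ratio_tendsto[where B="real b"])
      show "real b > 0" using b_ge_2 by simp
      show "real (card (covering x s A)) \<le> real (card (covering x t A))" if "0 \<le> s" "s \<le> t" for s t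
        using covering_mono[OF that] finite_subset[OF covering_subset] elim(3) by (auto intro!: card_mono)
      show "real (card (ftree x s)) \<le> real (card (ftree x t))" if "0 \<le> s" "s \<le> t" for s t
        using ftree_mono[OF that(2)] elim(3) by (auto intro!: card_mono)
    qed (use p elim ftree_size_ge in auto)
  qed
qed

end

section \<open>Recovering a finite tree from containment events\<close>

lemma countable_rooted_trees: "countable {S. rooted_tree S}"
  by (rule countable_subset[OF _ countable_Collect_finite]) (auto simp: rooted_tree_def)

text \<open>A preimage is a countable union of events \<open>X = S\<close>, or the complement of one
  if the Borel set contains the default value \<open>0\<close>.\<close>

lemma measurable_countable_support:
  fixes f :: "'s \<Rightarrow> real"
  assumes R: "countable R" and X: "\<And>S. S \<in> R \<Longrightarrow> {\<omega> \<in> space N. X \<omega> = S} \<in> sets N"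
    and f: "\<And>S. S \<notin> R \<Longrightarrow> f S = 0"
  shows "(\<lambda>\<omega>. f (X \<omega>)) \<in> borel_measurable N"
proof (rule measurableI)
  fix B :: "real set" assume "B \<in> sets borel"
  have U: "(\<Union>S\<in>R'. {\<omega> \<in> space N. X \<omega> = S}) \<in> sets N" if "R' \<subseteq> R" for R'
    using that X countable_subset[OF that R] by (intro sets.countable_UN') auto
  show "(\<lambda>\<omega>. f (X \<omega>)) -` B \<inter> space N \<in> sets N"
  proof (cases "0 \<in> B")
    case True
    then have "(\<lambda>\<omega>. f (X \<omega>)) -` B \<inter> space N = space N - (\<Union>S\<in>{S \<in> R. f S \<notin> B}. {\<omega> \<in> space N. X \<omega> = S})"
      using f by auto
    then show ?thesis using U[of "{S \<in> R. f S \<notin> B}"] by auto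
  next
    case False
    then have "(\<lambda>\<omega>. f (X \<omega>)) -` B \<inter> space N = (\<Union>S\<in>{S \<in> R. f S \<in> B}. {\<omega> \<in> space N. X \<omega> = S})"
      using f by auto metis
    then show ?thesis using U[of "{S \<in> R. f S \<in> B}"] by auto
  qed
qed simp

definition boundary :: "nat \<Rightarrow> tree \<Rightarrow> tree" where
  "boundary b S = {u @ [j] |u j. u \<in> S \<and> j < b \<and> u @ [j] \<notin> S}"

lemma finite_boundary: assumes "finite S" shows "finite (boundary b S)"
proof (rule finite_subset)
  show "boundary b S \<subseteq> (\<lambda>(u, j). u @ [j]) ` (S \<times> {..<b})" by (auto simp: boundary_def)
qed (use assms in simp)

lemma boundary_nodes: "S \<subseteq> nodes b \<Longrightarrow> boundary b S \<subseteq> nodes b"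
  by (auto simp: boundary_def)

text \<open>A word of \<open>T\<close> outside \<open>S\<close> has a shortest prefix outside
  \<open>S\<close>, and this prefix lies in the boundary. Thus equality with a finite tree is a
  condition on finitely many words.\<close>

lemma tree_eq_iff_boundary:
  assumes S: "[] \<in> S" and T: "T \<subseteq> nodes b" "\<And>u j. u @ [j] \<in> T \<Longrightarrow> u \<in> T"
  shows "T = S \<longleftrightarrow> S \<subseteq> T \<and> boundary b S \<inter> T = {}"
proof
  assume *: "S \<subseteq> T \<and> boundary b S \<inter> T = {}"
  have "w \<in> T \<Longrightarrow> w \<in> S" for w
  proof (induction w rule: rev_induct)
    case (snoc j u)
    then have "u \<in> S" "j < b" using T by auto
    then show ?case using snoc.prems * by (auto simp: boundary_def)
  qed (use S in simp)
  then show "T = S" using * by auto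
qed (auto simp: boundary_def)

lemma sets_eq_tree:
  assumes "\<And>u. u \<in> nodes b \<Longrightarrow> {\<omega> \<in> space N. u \<in> X \<omega>} \<in> sets N" and "\<And>\<omega>. \<omega> \<in> space N \<Longrightarrow> X \<omega> \<subseteq> nodes b"
  shows "{\<omega> \<in> space N. X \<omega> = S} \<in> sets N"
proof (cases "S \<subseteq> nodes b")
  case True
  have "{\<omega> \<in> space N. X \<omega> = S} = {\<omega> \<in> space N. \<forall>u. u \<in> nodes b \<longrightarrow> (u \<in> X \<omega> \<longleftrightarrow> u \<in> S)}"
    using assms(2) True by blast
  also have "\<dots> \<in> sets N"
  proof (rule sets.sets_Collect_countable_All)
    show "{\<omega> \<in> space N. u \<in> nodes b \<longrightarrow> (u \<in> X \<omega> \<longleftrightarrow> u \<in> S)} \<in> sets N" for u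
      using assms(1)[of u] sets.sets_Collect_neg[of N "\<lambda>\<omega>. u \<in> X \<omega>"]
      by (cases "u \<in> nodes b"; cases "u \<in> S") auto
  qed
  finally show ?thesis .
next
  case False
  then have "{\<omega> \<in> space N. X \<omega> = S} = {}" using assms(2) by blast
  then show ?thesis by (simp only: sets.empty_sets)
qed

context splitting
begin

text \<open>Forbidding one more word \<open>w\<close> subtracts the configurations that contain it,
  for node counts and for probabilities alike; the induction therefore generalizes over
  \<open>A\<close>.\<close>

lemma fringe_inclusion_exclusion:
  assumes N: "prob_space N"
    and meas: "\<And>u. u \<in> nodes b \<Longrightarrow> {\<omega> \<in> space N. u \<in> X \<omega>} \<in> sets N"
    and fin: "\<And>y. finite (ftree x y)"
    and lim: "\<And>A. finite A \<Longrightarrow> [] \<in> A \<Longrightarrow> A \<subseteq> nodes b \<Longrightarrow>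
      ((\<lambda>y. real (card (covering x y A)) / real (card (ftree x y))) \<longlongrightarrow> measure N {\<omega> \<in> space N. A \<subseteq> X \<omega>}) at_top"
    and B: "finite B" "B \<subseteq> nodes b" and A: "finite A" "[] \<in> A" "A \<subseteq> nodes b"
  shows "((\<lambda>y. real (card {v \<in> ftree x y. A \<subseteq> subtree_at (ftree x y) v \<and> B \<inter> subtree_at (ftree x y) v = {}}) / real (card (ftree x y)))
    \<longlongrightarrow> measure N {\<omega> \<in> space N. A \<subseteq> X \<omega> \<and> B \<inter> X \<omega> = {}}) at_top"
  using B A
proof (induction B arbitrary: A rule: finite_induct)
  case empty
  then show ?case using lim[of A] by (simp add: covering_def)
next
  case (insert w B)
  interpret N: prob_space N by (rule N)
  let ?C = "\<lambda>y A B. {v \<in> ftree x y. A \<subseteq> subtree_at (ftree x y) v \<and> B \<inter> subtree_at (ftree x y) v = {}}"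
  let ?E = "\<lambda>A B. {\<omega> \<in> space N. A \<subseteq> X \<omega> \<and> B \<inter> X \<omega> = {}}"
  have Em: "?E A B \<in> sets N" if "finite A" "A \<subseteq> nodes b" "finite B" "B \<subseteq> nodes b" for A B
  proof -
    have "?E A B = {\<omega> \<in> space N. (\<forall>u\<in>A. u \<in> X \<omega>) \<and> (\<forall>u\<in>B. u \<notin> X \<omega>)}" by auto
    also have "\<dots> \<in> sets N"
      using that meas by (intro sets.sets_Collect_conj sets.sets_Collect_finite_All sets.sets_Collect_neg) auto
    finally show ?thesis .
  qed
  have cC: "real (card (?C y A (insert w B))) = real (card (?C y A B)) - real (card (?C y (insert w A) B))" for y
  proof -
    have "?C y A B = ?C y A (insert w B) \<union> ?C y (insert w A) B" by auto
    moreover have "?C y A (insert w B) \<inter> ?C y (insert w A) B = {}" by auto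
    ultimately have "card (?C y A B) = card (?C y A (insert w B)) + card (?C y (insert w A) B)"
      using fin[of y] card_Un_disjoint[of "?C y A (insert w B)" "?C y (insert w A) B"] by simp
    then show ?thesis by simp
  qed
  have cE: "measure N (?E A (insert w B)) = measure N (?E A B) - measure N (?E (insert w A) B)"
  proof -
    have "?E A B = ?E A (insert w B) \<union> ?E (insert w A) B" by auto
    moreover have "measure N (?E A (insert w B) \<union> ?E (insert w A) B) = measure N (?E A (insert w B)) + measure N (?E (insert w A) B)"
      by (rule N.finite_measure_Union[OF Em Em]) (use insert in auto)
    ultimately show ?thesis by simp
  qed
  show ?case unfolding cC cE diff_divide_distrib using insert by (intro tendsto_diff insert.IH) auto
qed

text \<open>The random tree \<open>X\<close> enters through its containment probabilities, which
  determine its law on finite trees. Only countably many finite sets \<open>A\<close> occur, so a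
  single null set precedes all the limits.\<close>

lemma fringe_limit_AE:
  fixes N :: "'w measure" and X :: "'w \<Rightarrow> tree" and f :: "tree \<Rightarrow> real"
  assumes N: "prob_space N"
    and meas: "\<And>u. u \<in> nodes b \<Longrightarrow> {\<omega> \<in> space N. u \<in> X \<omega>} \<in> sets N"
    and Xn: "\<And>\<omega>. \<omega> \<in> space N \<Longrightarrow> X \<omega> \<subseteq> nodes b" and Xr: "AE \<omega> in N. rooted_tree (X \<omega>)"
    and cov: "\<And>A. finite A \<Longrightarrow> [] \<in> A \<Longrightarrow> A \<subseteq> nodes b \<Longrightarrow> measure N {\<omega> \<in> space N. A \<subseteq> X \<omega>} = (\<integral>x. min_mass A x \<partial>Om)"
    and f: "\<And>S. \<bar>f S\<bar> \<le> K" "\<And>S. \<not> rooted_tree S \<Longrightarrow> f S = 0"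
  shows "AE x in Om. ((\<lambda>y. (\<Sum>v\<in>ftree x y. f (subtree_at (ftree x y) v)) / real (card (ftree x y)))
    \<longlongrightarrow> (\<integral>\<omega>. f (X \<omega>) \<partial>N)) at_top"
proof -
  interpret N: prob_space N by (rule N)
  have Xm: "{\<omega> \<in> space N. X \<omega> = S} \<in> sets N" for S
    by (rule sets_eq_tree[OF meas Xn])
  have "AE x in Om. \<forall>A\<in>{A. finite A \<and> [] \<in> A \<and> A \<subseteq> nodes b}.
      ((\<lambda>y. real (card (covering x y A)) / real (card (ftree x y))) \<longlongrightarrow> measure N {\<omega> \<in> space N. A \<subseteq> X \<omega>}) at_top"
  proof (subst AE_ball_countable)
    show "countable {A :: tree. finite A \<and> [] \<in> A \<and> A \<subseteq> nodes b}"
      by (rule countable_subset[OF _ countable_Collect_finite]) auto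
    show "\<forall>A\<in>{A. finite A \<and> [] \<in> A \<and> A \<subseteq> nodes b}. AE x in Om.
      ((\<lambda>y. real (card (covering x y A)) / real (card (ftree x y))) \<longlongrightarrow> measure N {\<omega> \<in> space N. A \<subseteq> X \<omega>}) at_top"
      using covering_ratio_AE cov by auto
  qed
  then show ?thesis using finite_ftree_AE
  proof eventually_elim
    case (elim x)
    have fin: "finite (ftree x y)" for y using elim by simp
    have st: "subtree_at (ftree x y) v \<subseteq> nodes b" "\<And>u j. u @ [j] \<in> subtree_at (ftree x y) v \<Longrightarrow> u \<in> subtree_at (ftree x y) v"
      if "v \<in> ftree x y" "0 \<le> y" for y v
      using that ftree_prefix[OF that(2)] ftree_nodes[of x y] by (auto simp: subtree_at_def)
    have single: "((\<lambda>y. real (card {v \<in> ftree x y. subtree_at (ftree x y) v = S}) / real (card (ftree x y)))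
        \<longlongrightarrow> N.prob {\<omega> \<in> space N. X \<omega> = S}) at_top" if S: "S \<in> {S. rooted_tree S}" for S
    proof (cases "S \<subseteq> nodes b")
      case True
      have Sr: "finite S" "[] \<in> S" using S by (auto simp: rooted_tree_def)
      have probeq: "N.prob {\<omega> \<in> space N. X \<omega> = S} = N.prob {\<omega> \<in> space N. S \<subseteq> X \<omega> \<and> boundary b S \<inter> X \<omega> = {}}"
      proof (rule N.finite_measure_eq_AE)
        show "AE \<omega> in N. \<omega> \<in> {\<omega> \<in> space N. X \<omega> = S} \<longleftrightarrow> \<omega> \<in> {\<omega> \<in> space N. S \<subseteq> X \<omega> \<and> boundary b S \<inter> X \<omega> = {}}"
          using Xr AE_space
        proof eventually_elim
          case (elim \<omega>)
          then have pre: "u @ [j] \<in> X \<omega> \<Longrightarrow> u \<in> X \<omega>" for u j unfolding rooted_tree_def by blast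
          have "X \<omega> = S \<longleftrightarrow> S \<subseteq> X \<omega> \<and> boundary b S \<inter> X \<omega> = {}"
            by (rule tree_eq_iff_boundary[OF Sr(2) Xn[OF elim(2)]]) (rule pre)
          then show ?case using elim(2) by blast
        qed
        have "{\<omega> \<in> space N. S \<subseteq> X \<omega> \<and> boundary b S \<inter> X \<omega> = {}}
            = {\<omega> \<in> space N. (\<forall>u\<in>S. u \<in> X \<omega>) \<and> (\<forall>u\<in>boundary b S. u \<notin> X \<omega>)}" by auto
        also have "\<dots> \<in> sets N"
          using True Sr meas boundary_nodes[OF True] finite_boundary[OF Sr(1)]
          by (intro sets.sets_Collect_conj sets.sets_Collect_finite_All sets.sets_Collect_neg) auto
        finally show "{\<omega> \<in> space N. S \<subseteq> X \<omega> \<and> boundary b S \<inter> X \<omega> = {}} \<in> sets N" .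
      qed (rule Xm)
      have setq: "{v \<in> ftree x y. S \<subseteq> subtree_at (ftree x y) v \<and> boundary b S \<inter> subtree_at (ftree x y) v = {}}
          = {v \<in> ftree x y. subtree_at (ftree x y) v = S}" if "y \<ge> 0" for y
      proof -
        have "subtree_at (ftree x y) v = S \<longleftrightarrow> S \<subseteq> subtree_at (ftree x y) v \<and> boundary b S \<inter> subtree_at (ftree x y) v = {}"
          if v: "v \<in> ftree x y" for v
          by (rule tree_eq_iff_boundary[OF Sr(2) st(1)[OF v \<open>y \<ge> 0\<close>]]) (rule st(2)[OF v \<open>y \<ge> 0\<close>])
        then show ?thesis by blast
      qed
      have evq: "\<forall>\<^sub>F y in at_top. real (card {v \<in> ftree x y. S \<subseteq> subtree_at (ftree x y) v \<and> boundary b S \<inter> subtree_at (ftree x y) v = {}}) / real (card (ftree x y))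
          = real (card {v \<in> ftree x y. subtree_at (ftree x y) v = S}) / real (card (ftree x y))"
        using eventually_ge_at_top[of "0::real"] by eventually_elim (simp only: setq)
      have limq: "((\<lambda>y. real (card {v \<in> ftree x y. S \<subseteq> subtree_at (ftree x y) v \<and> boundary b S \<inter> subtree_at (ftree x y) v = {}}) / real (card (ftree x y)))
        \<longlongrightarrow> N.prob {\<omega> \<in> space N. S \<subseteq> X \<omega> \<and> boundary b S \<inter> X \<omega> = {}}) at_top"
        by (rule fringe_inclusion_exclusion[OF N meas fin])
           (use elim True Sr boundary_nodes[OF True] finite_boundary[OF Sr(1)] in auto)
      show ?thesis unfolding probeq by (rule Lim_transform_eventually[OF limq evq])
    next
      case False
      have e1: "{\<omega> \<in> space N. X \<omega> = S} = {}" using Xn False by auto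
      have e2: "{v \<in> ftree x y. subtree_at (ftree x y) v = S} = {}" for y
        using False ftree_nodes[of x y] by (auto simp: subtree_at_def)
      show ?thesis unfolding e1 e2 by simp
    qed
    have ne: "\<forall>\<^sub>F y in at_top. finite (ftree x y) \<and> ftree x y \<noteq> {}"
      using eventually_ge_at_top[of "1::real"] by eventually_elim (use fin Nil_in_ftree in blast)
    show ?case
      by (rule N.empirical_mean_tendsto[OF countable_rooted_trees Xm _ ne single
          measurable_countable_support[OF countable_rooted_trees Xm] f(1)]) (use Xr f(2) in auto)
  qed
qed

end

section \<open>The subtree at a uniformly random node\<close>

lemma measurable_tree_space:
  assumes "\<And>u. {\<omega> \<in> space M. u \<in> X \<omega>} \<in> sets M"
  shows "X \<in> measurable M tree_space"
  unfolding tree_space_def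
  by (rule measurable_sigma_sets[of _ UNIV "range (\<lambda>u. {T. u \<in> T})"])
     (use assms in \<open>auto simp: sets_measure_of vimage_def Int_def conj_commute\<close>)

lemma space_tree_space [simp]: "space tree_space = UNIV"
  by (simp add: tree_space_def)

lemma sets_node_in_tree: "{T. u \<in> T} \<in> sets tree_space"
  unfolding tree_space_def by (simp add: sets_measure_of)

lemma sets_tree_eq:
  fixes X :: "'w \<Rightarrow> tree"
  assumes "\<And>u. {\<omega> \<in> space M. u \<in> X \<omega>} \<in> sets M"
  shows "{\<omega> \<in> space M. X \<omega> = S} \<in> sets M"
proof -
  have "{\<omega> \<in> space M. X \<omega> = S} = {\<omega> \<in> space M. \<forall>u. u \<in> X \<omega> \<longleftrightarrow> u \<in> S}" by auto
  also have "\<dots> \<in> sets M"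
  proof (rule sets.sets_Collect_countable_All)
    show "{\<omega> \<in> space M. u \<in> X \<omega> \<longleftrightarrow> u \<in> S} \<in> sets M" for u
      using assms[of u] sets.sets_Collect_neg[of M "\<lambda>\<omega>. u \<in> X \<omega>"] by (cases "u \<in> S") auto
  qed
  finally show ?thesis .
qed

text \<open>For infinite \<open>T\<close> the cardinality is \<open>0\<close> and the quotient takes
  the default value \<open>0\<close>; this brings it under
  \<open>measurable_countable_support\<close>.\<close>

definition fringe_mean :: "(tree \<Rightarrow> real) \<Rightarrow> tree \<Rightarrow> real" where
  "fringe_mean f T = (\<Sum>u\<in>T. f (subtree_at T u)) / real (card T)"

lemma fringe_mean_indicator:
  "finite T \<Longrightarrow> fringe_mean (indicat_real P) T = real (num_nodes_with P T) / real (card T)"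
  by (simp add: fringe_mean_def num_nodes_with_def indicator_def sum.If_cases Int_def)

lemma fringe_mean_bound:
  assumes "\<And>S. \<bar>f S\<bar> \<le> K" "0 \<le> K" shows "\<bar>fringe_mean f T\<bar> \<le> K"
proof (cases "card T = 0")
  case False
  have "\<bar>\<Sum>u\<in>T. f (subtree_at T u)\<bar> \<le> (\<Sum>u\<in>T. K)" by (intro order_trans[OF sum_abs] sum_mono assms)
  then show ?thesis using False by (simp add: fringe_mean_def abs_divide pos_divide_le_eq mult.commute)
qed (use assms in \<open>simp add: fringe_mean_def\<close>)

lemma fringe_mean_measurable:
  assumes "\<And>u. {\<omega> \<in> space M. u \<in> X \<omega>} \<in> sets M"
  shows "(\<lambda>\<omega>. fringe_mean f (X \<omega>)) \<in> borel_measurable M"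
  by (rule measurable_countable_support[OF countable_Collect_finite sets_tree_eq[OF assms]])
     (auto simp: fringe_mean_def)

locale random_fringe = prob_space M for M :: "'w measure" +
  fixes X :: "'w \<Rightarrow> tree" and v :: "'w \<Rightarrow> node"
  assumes X_node: "\<And>u. {\<omega> \<in> space M. u \<in> X \<omega>} \<in> sets M"
    and X_rooted: "AE \<omega> in M. rooted_tree (X \<omega>)"
    and v_unif: "uniform_random_node M X v"
begin

lemma v_measurable: "v \<in> measurable M (count_space UNIV)"
  using v_unif by (simp add: uniform_random_node_def)

lemma sets_v_eq: "{\<omega> \<in> space M. v \<omega> = u} \<in> sets M"
  using measurable_sets[OF v_measurable, of "{u}"] by (simp add: vimage_def Int_def conj_commute)

lemma fringe_node: "{\<omega> \<in> space M. w \<in> subtree_at (X \<omega>) (v \<omega>)} \<in> sets M"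
proof -
  have "{\<omega> \<in> space M. w \<in> subtree_at (X \<omega>) (v \<omega>)} = {\<omega> \<in> space M. \<exists>u. v \<omega> = u \<and> u @ w \<in> X \<omega>}"
    by (auto simp: subtree_at_def)
  also have "\<dots> \<in> sets M"
    by (intro sets.sets_Collect_countable_Ex sets.sets_Collect_conj sets_v_eq X_node)
  finally show ?thesis .
qed

lemma fringe_function_measurable:
  assumes "countable R" "\<And>S. S \<notin> R \<Longrightarrow> (f S :: real) = 0"
  shows "(\<lambda>\<omega>. f (subtree_at (X \<omega>) (v \<omega>))) \<in> borel_measurable M"
  by (rule measurable_countable_support[OF assms(1) sets_tree_eq[OF fringe_node] assms(2)])

text \<open>The definition of a uniform node prescribes probabilities only for words in
  \<open>S\<close>, but these already exhaust the probability of \<open>X = S\<close>.\<close>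

lemma v_in_tree_AE:
  assumes S: "rooted_tree S"
  shows "AE \<omega> in M. X \<omega> = S \<longrightarrow> v \<omega> \<in> S"
proof -
  have fin: "finite S" "S \<noteq> {}" using S by (auto simp: rooted_tree_def)
  let ?E = "\<lambda>u. {\<omega> \<in> space M. X \<omega> = S \<and> v \<omega> = u}"
  have Em: "?E u \<in> sets M" for u by (intro sets.sets_Collect_conj sets_v_eq sets_tree_eq X_node)
  have "prob (\<Union>u\<in>S. ?E u) = (\<Sum>u\<in>S. prob (?E u))"
    using fin Em by (intro finite_measure_finite_Union) (auto simp: disjoint_family_on_def)
  also have "\<dots> = (\<Sum>u\<in>S. prob {\<omega> \<in> space M. X \<omega> = S} / real (card S))"
    using v_unif S by (auto simp: uniform_random_node_def)
  also have "\<dots> = prob {\<omega> \<in> space M. X \<omega> = S}" using fin by simp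
  finally have eq: "prob (\<Union>u\<in>S. ?E u) = prob {\<omega> \<in> space M. X \<omega> = S}" .
  have U: "(\<Union>u\<in>S. ?E u) \<in> sets M" using fin Em by auto
  have "prob ({\<omega> \<in> space M. X \<omega> = S} - (\<Union>u\<in>S. ?E u)) = 0"
    by (subst finite_measure_Diff[OF sets_tree_eq[OF X_node] U]) (auto simp: eq)
  then have "AE \<omega> in M. \<omega> \<notin> {\<omega> \<in> space M. X \<omega> = S} - (\<Union>u\<in>S. ?E u)"
    using U sets_tree_eq[OF X_node] by (intro AE_not_in) (auto simp: null_sets_def emeasure_eq_measure)
  then show ?thesis using AE_space by eventually_elim auto
qed

text \<open>The difference of the two integrands integrates to zero over each event \<open>X = S\<close>, and finitely
  many of these events exhaust the space up to arbitrarily small probability.\<close>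

lemma fringe_mean_integral:
  fixes f :: "tree \<Rightarrow> real"
  assumes R: "countable R" "\<And>S. S \<notin> R \<Longrightarrow> f S = 0" and K: "\<And>S. \<bar>f S\<bar> \<le> K"
    and B: "{\<omega> \<in> space M. X \<omega> \<in> B} \<in> sets M"
  shows "(\<integral>\<omega>. indicat_real B (X \<omega>) * f (subtree_at (X \<omega>) (v \<omega>)) \<partial>M)
    = (\<integral>\<omega>. indicat_real B (X \<omega>) * fringe_mean f (X \<omega>) \<partial>M)"
proof -
  have K0: "0 \<le> K" using K[of "{}"] by linarith
  define Y where "Y \<omega> = f (subtree_at (X \<omega>) (v \<omega>))" for \<omega>
  define D where "D \<omega> = indicat_real B (X \<omega>) * (Y \<omega> - fringe_mean f (X \<omega>))" for \<omega>
  have Bm [measurable]: "(\<lambda>\<omega>. indicat_real B (X \<omega>)) \<in> borel_measurable M"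
  proof -
    have "(\<lambda>\<omega>. if X \<omega> \<in> B then 1 else 0 :: real) \<in> borel_measurable M"
      using B by (intro measurable_If) auto
    then show ?thesis by (simp add: indicator_def of_bool_def)
  qed
  have Ym [measurable]: "Y \<in> borel_measurable M" unfolding Y_def[abs_def] by (rule fringe_function_measurable[OF R])
  have fm [measurable]: "(\<lambda>\<omega>. fringe_mean f (X \<omega>)) \<in> borel_measurable M" by (rule fringe_mean_measurable[OF X_node])
  have YK: "\<bar>Y \<omega>\<bar> \<le> K" for \<omega> by (simp add: Y_def K)
  have fK: "\<bar>fringe_mean f T\<bar> \<le> K" for T by (rule fringe_mean_bound[OF K K0])
  have iB: "\<bar>indicat_real B T\<bar> \<le> 1" for T by (simp add: indicator_def)
  have int1: "integrable M (\<lambda>\<omega>. indicat_real B (X \<omega>) * Y \<omega>)"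
  proof (rule integrable_const_bound[where B=K])
    show "AE \<omega> in M. norm (indicat_real B (X \<omega>) * Y \<omega>) \<le> K" using YK K0 by (auto simp: abs_mult indicator_def)
  qed measurable
  have int2: "integrable M (\<lambda>\<omega>. indicat_real B (X \<omega>) * fringe_mean f (X \<omega>))"
  proof (rule integrable_const_bound[where B=K])
    show "AE \<omega> in M. norm (indicat_real B (X \<omega>) * fringe_mean f (X \<omega>)) \<le> K"
      using fK K0 by (auto simp: abs_mult indicator_def)
  qed measurable
  have Dm [measurable]: "D \<in> borel_measurable M" unfolding D_def[abs_def] by measurable
  have DK: "\<bar>D \<omega>\<bar> \<le> 2 * K" for \<omega>
    using YK[of \<omega>] fK[of "X \<omega>"] K0 unfolding D_def by (auto simp: indicator_def)
  have zero: "(\<integral>\<omega>. indicat_real {\<omega> \<in> space M. X \<omega> = S} \<omega> * D \<omega> \<partial>M) = 0" if S: "rooted_tree S" for S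
  proof -
    have fin: "finite S" "S \<noteq> {}" using S by (auto simp: rooted_tree_def)
    let ?E = "\<lambda>u. {\<omega> \<in> space M. X \<omega> = S \<and> v \<omega> = u}"
    have Em: "?E u \<in> sets M" for u by (intro sets.sets_Collect_conj sets_v_eq sets_tree_eq X_node)
    let ?c = "\<lambda>u. indicat_real B S * (f (subtree_at S u) - fringe_mean f S)"
    have "(\<integral>\<omega>. indicat_real {\<omega> \<in> space M. X \<omega> = S} \<omega> * D \<omega> \<partial>M) = (\<integral>\<omega>. (\<Sum>u\<in>S. ?c u * indicat_real (?E u) \<omega>) \<partial>M)"
    proof (rule integral_cong_AE)
      show "(\<lambda>\<omega>. indicat_real {\<omega> \<in> space M. X \<omega> = S} \<omega> * D \<omega>) \<in> borel_measurable M"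
        using sets_tree_eq[OF X_node] by measurable
      show "(\<lambda>\<omega>. \<Sum>u\<in>S. ?c u * indicat_real (?E u) \<omega>) \<in> borel_measurable M"
        using Em by (intro borel_measurable_sum borel_measurable_times borel_measurable_indicator) auto
      show "AE \<omega> in M. indicat_real {\<omega> \<in> space M. X \<omega> = S} \<omega> * D \<omega> = (\<Sum>u\<in>S. ?c u * indicat_real (?E u) \<omega>)"
        using v_in_tree_AE[OF S] AE_space
      proof eventually_elim
        case (elim \<omega>)
        show ?case
        proof (cases "X \<omega> = S")
          case True
          have "(\<Sum>u\<in>S. ?c u * indicat_real (?E u) \<omega>) = (\<Sum>u\<in>S. if v \<omega> = u then ?c u else 0)"
            using True elim by (intro sum.cong refl) (auto simp: indicator_def)
          also have "\<dots> = ?c (v \<omega>)" using True elim fin by simp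
          finally show ?thesis using True elim by (simp add: D_def Y_def)
        qed simp
      qed
    qed
    also have "\<dots> = (\<Sum>u\<in>S. ?c u * prob (?E u))"
      using Em by (subst Bochner_Integration.integral_sum)
        (auto intro!: integrable_mult_right integrable_real_indicator simp: emeasure_eq_measure)
    also have "\<dots> = (\<Sum>u\<in>S. ?c u * (prob {\<omega> \<in> space M. X \<omega> = S} / real (card S)))"
      using v_unif S by (intro sum.cong refl) (auto simp: uniform_random_node_def)
    also have "\<dots> = (\<Sum>u\<in>S. ?c u) * (prob {\<omega> \<in> space M. X \<omega> = S} / real (card S))"
      by (rule sum_distrib_right[symmetric])
    also have "(\<Sum>u\<in>S. ?c u) = 0"
      using fin by (simp add: sum_distrib_left[symmetric] sum_subtractf fringe_mean_def)
    finally show ?thesis by simp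
  qed
  have bnd: "\<bar>\<integral>\<omega>. D \<omega> \<partial>M\<bar> \<le> 2 * K * e" if e: "e > 0" for e
  proof -
    obtain F where F: "F \<subseteq> {S. rooted_tree S}" "finite F" "(\<Sum>S\<in>F. prob {\<omega> \<in> space M. X \<omega> = S}) > 1 - e"
      using finite_subset_prob_close_to_1[OF countable_rooted_trees sets_tree_eq[OF X_node] _ e] X_rooted by auto
    define I where "I \<omega> = (\<Sum>S\<in>F. indicat_real {\<omega> \<in> space M. X \<omega> = S} \<omega>)" for \<omega>
    have Ieq: "I \<omega> = indicat_real F (X \<omega>)" if "\<omega> \<in> space M" for \<omega>
    proof -
      have "I \<omega> = (\<Sum>S\<in>F. if X \<omega> = S then 1 else 0)" unfolding I_def
        using that by (intro sum.cong refl) (auto simp: indicator_def)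
      then show ?thesis using F(2) by (simp add: indicator_def)
    qed
    have Ii: "integrable M I" unfolding I_def[abs_def]
      using sets_tree_eq[OF X_node] by (intro Bochner_Integration.integrable_sum integrable_real_indicator) (auto simp: emeasure_eq_measure)
    have [measurable]: "I \<in> borel_measurable M" using Ii by (rule borel_measurable_integrable)
    have "(\<integral>\<omega>. I \<omega> * D \<omega> \<partial>M) = (\<Sum>S\<in>F. \<integral>\<omega>. indicat_real {\<omega> \<in> space M. X \<omega> = S} \<omega> * D \<omega> \<partial>M)"
      unfolding I_def sum_distrib_right
    proof (rule Bochner_Integration.integral_sum)
      show "integrable M (\<lambda>\<omega>. indicat_real {\<omega> \<in> space M. X \<omega> = S} \<omega> * D \<omega>)" for S
        using DK sets_tree_eq[OF X_node, of S] K0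
        by (intro integrable_const_bound[where B="2 * K"] borel_measurable_times borel_measurable_indicator Dm)
          (auto simp: abs_mult indicator_def)
    qed
    also have "\<dots> = 0" using zero F(1) by (intro sum.neutral) auto
    finally have ID: "(\<integral>\<omega>. I \<omega> * D \<omega> \<partial>M) = 0" .
    have Di: "integrable M D" using DK by (intro integrable_const_bound[where B="2 * K"]) auto
    have IDi: "integrable M (\<lambda>\<omega>. I \<omega> * D \<omega>)"
    proof (rule integrable_const_bound[where B="2 * K"])
      show "AE \<omega> in M. norm (I \<omega> * D \<omega>) \<le> 2 * K" using DK K0 by (auto simp: Ieq abs_mult indicator_def)
    qed measurable
    have "(\<integral>\<omega>. D \<omega> \<partial>M) = (\<integral>\<omega>. D \<omega> - I \<omega> * D \<omega> \<partial>M)"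
      using ID by (simp add: Bochner_Integration.integral_diff[OF Di IDi])
    also have "\<bar>\<integral>\<omega>. D \<omega> - I \<omega> * D \<omega> \<partial>M\<bar> \<le> (\<integral>\<omega>. \<bar>D \<omega> - I \<omega> * D \<omega>\<bar> \<partial>M)" by (rule integral_abs_bound)
    also have "\<dots> \<le> (\<integral>\<omega>. 2 * K * (1 - I \<omega>) \<partial>M)"
    proof (rule integral_mono)
      show "\<bar>D \<omega> - I \<omega> * D \<omega>\<bar> \<le> 2 * K * (1 - I \<omega>)" if "\<omega> \<in> space M" for \<omega>
        using DK[of \<omega>] by (simp add: Ieq[OF that] indicator_def)
    qed (intro integrable_abs Bochner_Integration.integrable_diff integrable_mult_right integrable_const Di IDi Ii)+
    also have "\<dots> = 2 * K * (1 - (\<integral>\<omega>. I \<omega> \<partial>M))" using Ii by (simp add: prob_space)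
    also have "(\<integral>\<omega>. I \<omega> \<partial>M) = (\<Sum>S\<in>F. prob {\<omega> \<in> space M. X \<omega> = S})"
      unfolding I_def using sets_tree_eq[OF X_node]
      by (subst Bochner_Integration.integral_sum) (auto simp: emeasure_eq_measure intro!: integrable_real_indicator)
    also have "2 * K * (1 - (\<Sum>S\<in>F. prob {\<omega> \<in> space M. X \<omega> = S})) \<le> 2 * K * e" using F(3) K0 by (intro mult_left_mono) auto
    finally show ?thesis .
  qed
  have "\<bar>\<integral>\<omega>. D \<omega> \<partial>M\<bar> \<le> 0"
  proof (rule field_le_epsilon)
    fix e :: real assume e: "e > 0"
    have K1: "2 * K + 1 > 0" using K0 by simp
    have "2 * K * (e / (2 * K + 1)) = e * ((2 * K) / (2 * K + 1))" by simp
    also have "\<dots> \<le> e * 1" using e K0 by (intro mult_left_mono) auto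
    finally show "\<bar>\<integral>\<omega>. D \<omega> \<partial>M\<bar> \<le> 0 + e" using bnd[of "e / (2 * K + 1)"] e K1 by simp
  qed
  then have "(\<integral>\<omega>. indicat_real B (X \<omega>) * Y \<omega> - indicat_real B (X \<omega>) * fringe_mean f (X \<omega>) \<partial>M) = 0"
    by (simp add: D_def right_diff_distrib)
  then show ?thesis unfolding Bochner_Integration.integral_diff[OF int1 int2] unfolding Y_def by simp
qed

text \<open>Every event of the sigma-algebra generated by \<open>X\<close> has the form
  \<open>X \<in> B\<close>, so \<open>fringe_mean_integral\<close> is the defining identity of the
  conditional expectation.\<close>

lemma cond_prob_fringe:
  assumes P: "countable P"
  shows "AE \<omega> in M. cond_prob_tree M (\<lambda>\<omega>. subtree_at (X \<omega>) (v \<omega>)) P X \<omega>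
    = real (num_nodes_with P (X \<omega>)) / real (card (X \<omega>))"
proof -
  let ?F = "vimage_algebra (space M) X tree_space"
  have Xm: "X \<in> measurable M tree_space" by (rule measurable_tree_space[OF X_node])
  have sF: "sets ?F = {X -` B \<inter> space M | B. B \<in> sets tree_space}"
    by (rule sets_vimage_algebra2) simp
  have "subalgebra M ?F"
    unfolding subalgebra_def using Xm by (auto simp: sF measurable_sets)
  then interpret F: finite_measure_subalgebra M ?F by unfold_locales
  have fP: "indicat_real P S = 0" if "S \<notin> P" for S using that by simp
  note fm = fringe_function_measurable[OF P, of "indicat_real P", OF fP]
  have XF: "{\<omega> \<in> space ?F. u \<in> X \<omega>} \<in> sets ?F" for u
    unfolding sF using sets_node_in_tree[of u] by (auto simp: vimage_def Int_def conj_commute)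
  have "AE \<omega> in M. real_cond_exp M ?F (\<lambda>\<omega>. indicat_real P (subtree_at (X \<omega>) (v \<omega>))) \<omega> = fringe_mean (indicat_real P) (X \<omega>)"
  proof (rule F.real_cond_exp_charact)
    show "integrable M (\<lambda>\<omega>. indicat_real P (subtree_at (X \<omega>) (v \<omega>)))"
      using fm by (intro integrable_const_bound[where B=1]) (auto simp: indicator_def)
    show "integrable M (\<lambda>\<omega>. fringe_mean (indicat_real P) (X \<omega>))"
      using fringe_mean_bound[of "indicat_real P" 1]
      by (intro integrable_const_bound[where B=1] fringe_mean_measurable X_node) (auto simp: indicator_def)
    show "(\<lambda>\<omega>. fringe_mean (indicat_real P) (X \<omega>)) \<in> borel_measurable ?F"
      by (rule fringe_mean_measurable[OF XF])
    fix A assume "A \<in> sets ?F"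
    then obtain B where B: "B \<in> sets tree_space" "A = X -` B \<inter> space M" using sF by auto
    have Bm: "{\<omega> \<in> space M. X \<omega> \<in> B} \<in> sets M"
      using measurable_sets[OF Xm B(1)] by (simp add: vimage_def Int_def conj_commute)
    have iA: "(\<integral>\<omega>\<in>A. g \<omega> \<partial>M) = (\<integral>\<omega>. indicat_real B (X \<omega>) * g \<omega> \<partial>M)" for g :: "'w \<Rightarrow> real"
      unfolding set_lebesgue_integral_def by (intro Bochner_Integration.integral_cong refl) (auto simp: B(2) indicator_def)
    show "(\<integral>\<omega>\<in>A. indicat_real P (subtree_at (X \<omega>) (v \<omega>)) \<partial>M) = (\<integral>\<omega>\<in>A. fringe_mean (indicat_real P) (X \<omega>) \<partial>M)"
      unfolding iA by (rule fringe_mean_integral[OF P, where K=1]) (simp_all add: Bm indicator_def)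
  qed
  then show ?thesis using X_rooted unfolding cond_prob_tree_def
    by eventually_elim (simp add: fringe_mean_indicator rooted_tree_def)
qed

end

section \<open>Transfer to a fragmentation process\<close>

definition regular_split :: "nat \<Rightarrow> (nat \<Rightarrow> real) \<Rightarrow> bool" where
  "regular_split b a \<longleftrightarrow> (\<forall>j<b. 0 \<le> a j \<and> a j < 1) \<and> (\<Sum>j<b. a j) = 1"

text \<open>Redefining the splitting vector on a null set makes its almost sure properties sure.\<close>

definition regularized :: "nat \<Rightarrow> (nat \<Rightarrow> real) \<Rightarrow> nat \<Rightarrow> real" where
  "regularized b a j = (if j < b then if regular_split b a then a j else if j < 2 then 1 / 2 else 0 else 0)"

lemma rooted_subtree_at:
  assumes T: "rooted_tree T" and v: "v \<in> T"
  shows "rooted_tree (subtree_at T v)"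
  unfolding rooted_tree_def
proof (intro conjI allI impI)
  have "finite ((@) v -` T)" using T by (intro finite_vimageI) (simp_all add: rooted_tree_def inj_def)
  then show "finite (subtree_at T v)" by (simp add: subtree_at_def vimage_def)
  show "[] \<in> subtree_at T v" using v by (simp add: subtree_at_def)
  fix u j assume "u @ [j] \<in> subtree_at T v"
  then have "(v @ u) @ [j] \<in> T" by (simp add: subtree_at_def)
  then have "v @ u \<in> T" using T unfolding rooted_tree_def by blast
  then show "u \<in> subtree_at T v" by (simp add: subtree_at_def)
qed

context fragmentation
begin

lemma coordinate_measurable: "j < b \<Longrightarrow> (\<lambda>a. a j) \<in> borel_measurable L"
  unfolding measurable_cong_sets[OF sets_law refl] vec_space_def
  by (rule measurable_component_singleton) simp

lemma sets_regular: "{a \<in> space L. regular_split b a} \<in> sets L"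
proof -
  have "(\<lambda>a. \<Sum>j<b. a j) \<in> borel_measurable L"
    using coordinate_measurable by (intro borel_measurable_sum) auto
  then have s1: "{a \<in> space L. (\<Sum>j<b. a j) = 1} \<in> sets L" by measurable
  have s2: "{a \<in> space L. \<forall>j\<in>{..<b}. 0 \<le> a j \<and> a j < 1} \<in> sets L"
  proof (rule sets.sets_Collect_finite_All)
    fix j assume "j \<in> {..<b}"
    then have [measurable]: "(\<lambda>a. a j) \<in> borel_measurable L" by (intro coordinate_measurable) auto
    show "{a \<in> space L. 0 \<le> a j \<and> a j < 1} \<in> sets L" by measurable
  qed simp
  show ?thesis using sets.sets_Collect_conj[OF s1 s2] unfolding regular_split_def lessThan_iff Ball_def .
qed

lemma regular_AE: "AE a in L. regular_split b a"
proof -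
  have "AE a in L. \<forall>j\<in>{..<b}. a j < 1"
  proof (rule AE_finite_allI)
    show "AE a in L. a j < 1" if "j \<in> {..<b}" for j using law_less_1 that by simp
  qed simp
  then show ?thesis using law_bounds law_sum
  proof eventually_elim
    case (elim a)
    then show ?case unfolding regular_split_def by blast
  qed
qed

lemma splitting_regularized:
  assumes "non_lattice b L"
  shows "splitting L b (regularized b)"
proof -
  interpret Lp: prob_space L by (rule law_prob_space)
  show ?thesis
  proof
    show "(\<lambda>a. regularized b a j) \<in> borel_measurable L" for j
    proof (cases "j < b")
      case True
      have "(\<lambda>a. if regular_split b a then a j else if j < 2 then 1 / 2 else 0) \<in> borel_measurable L"
        using coordinate_measurable[OF True] sets_regular by (intro measurable_If) auto
      then show ?thesis using True by (simp add: regularized_def)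
    qed (simp add: regularized_def)
    show "0 \<le> regularized b a j" "regularized b a j < 1" for a j
      by (auto simp: regularized_def regular_split_def)
    show "(\<Sum>j<b. regularized b a j) = 1" for a
    proof (cases "regular_split b a")
      case False
      \<comment> \<open>The replacement vector puts mass \<open>1 / 2\<close> on the first two
        children, which exist because \<open>b \<ge> 2\<close>.\<close>
      have "(\<Sum>j<b. regularized b a j) = (\<Sum>j<b. if j \<in> {0, 1} then 1 / 2 else 0)"
        using False by (intro sum.cong refl) (auto simp: regularized_def)
      also have "\<dots> = (\<Sum>j\<in>{0::nat, 1}. 1 / 2)"
        by (rule sum.mono_neutral_cong_right) (use b_ge_2 in auto)
      finally show ?thesis by simp
    qed (simp add: regularized_def regular_split_def)
    show "\<not> (\<exists>r::real. 0 < r \<and> r < 1 \<and> (\<forall>j<b. AE a in L. regularized b a j = 0 \<or> (\<exists>k\<ge>1. regularized b a j = r ^ k)))"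
    proof
      assume "\<exists>r::real. 0 < r \<and> r < 1 \<and> (\<forall>j<b. AE a in L. regularized b a j = 0 \<or> (\<exists>k\<ge>1. regularized b a j = r ^ k))"
      then obtain r :: real where r: "0 < r" "r < 1"
        "\<And>j. j < b \<Longrightarrow> AE a in L. regularized b a j = 0 \<or> (\<exists>k\<ge>1. regularized b a j = r ^ k)" by blast
      have "AE a in L. a j = 0 \<or> (\<exists>k\<ge>1. a j = r ^ k)" if "j < b" for j
        using regular_AE r(3)[OF that] by eventually_elim (use that in \<open>simp add: regularized_def\<close>)
      then show False using assms r(1,2) unfolding non_lattice_def by blast
    qed
  qed
qed

end

section \<open>Almost sure identification with the canonical process\<close>

locale nonlattice_fragmentation = fragmentation M b L V
  for M :: "'w measure" and b L V +
  assumes nonlat: "non_lattice b L"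

sublocale nonlattice_fragmentation \<subseteq> sp: splitting L b "regularized b"
  by (rule splitting_regularized[OF nonlat])

context nonlattice_fragmentation
begin

definition vectors :: "'w \<Rightarrow> node \<Rightarrow> nat \<Rightarrow> real" where
  "vectors \<omega> = (\<lambda>u\<in>nodes b. split_vec b V u \<omega>)"

lemma split_vec_measurable: "u \<in> nodes b \<Longrightarrow> split_vec b V u \<in> measurable M (vec_space b)"
  using indep_copies unfolding indep_vars_def by blast

lemma sets_Om: "sets sp.Om = sets (PiM (nodes b) (\<lambda>_. vec_space b))"
  unfolding sp.Om_def by (rule sets_PiM_cong) (auto simp: sets_law)

lemma vectors_measurable [measurable]: "vectors \<in> measurable M sp.Om"
  unfolding measurable_cong_sets[OF refl sets_Om] vectors_def[abs_def]
  by (intro measurable_restrict split_vec_measurable)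

text \<open>Independent copies have a product law; this carries almost sure statements from the
  canonical space to \<open>M\<close>.\<close>

lemma distr_vectors: "distr M sp.Om vectors = sp.Om"
proof -
  have "distr M (PiM (nodes b) (\<lambda>_. vec_space b)) (\<lambda>\<omega>. \<lambda>u\<in>nodes b. split_vec b V u \<omega>)
      = PiM (nodes b) (\<lambda>u. distr M (vec_space b) (split_vec b V u))"
  proof (subst indep_vars_iff_distr_eq_PiM'[symmetric])
    show "nodes b \<noteq> {}" using nodes_Nil by blast
  qed (simp_all add: split_vec_measurable indep_copies)
  also have "\<dots> = sp.Om" unfolding sp.Om_def using distr_copies by (intro PiM_cong) auto
  finally have "distr M (PiM (nodes b) (\<lambda>_. vec_space b)) vectors = sp.Om" by (simp add: vectors_def[abs_def])
  then show ?thesis by (subst distr_cong[OF refl sets_Om refl])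
qed

lemma AE_vectors:
  assumes "AE x in sp.Om. Q x" shows "AE \<omega> in M. Q (vectors \<omega>)"
proof -
  have "AE x in distr M sp.Om vectors. Q x" unfolding distr_vectors by (rule assms)
  then show ?thesis by (rule AE_distrD[OF vectors_measurable])
qed

text \<open>There are only countably many nodes, so almost surely no splitting vector is altered by
  the regularization.\<close>

lemma node_mass_AE: "AE \<omega> in M. \<forall>u\<in>nodes b. \<forall>y. node_mass V y \<omega> u = y * sp.mass (vectors \<omega>) u"
proof -
  have "AE \<omega> in M. regular_split b (split_vec b V u \<omega>)" if "u \<in> nodes b" for u
  proof -
    have "distr M (vec_space b) (split_vec b V u) = L" using distr_copies that by blast
    then have "AE a in distr M (vec_space b) (split_vec b V u). regular_split b a" using regular_AE by (rule ssubst)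
    then show ?thesis by (rule AE_distrD[OF split_vec_measurable[OF that]])
  qed
  then have "AE \<omega> in M. \<forall>u\<in>nodes b. regular_split b (split_vec b V u \<omega>)"
    by (subst AE_ball_countable) auto
  then show ?thesis
  proof eventually_elim
    case (elim \<omega>)
    show ?case
    proof (intro ballI allI)
      fix u y assume u: "u \<in> nodes b"
      have "V (take i u) (u ! i) \<omega> = regularized b (vectors \<omega> (take i u)) (u ! i)" if "i < length u" for i
      proof -
        have "u ! i < b" using that u by (auto simp: nodes_def subset_eq)
        then show ?thesis using elim nodes_take[OF u] by (simp add: vectors_def regularized_def split_vec_def)
      qed
      then show "node_mass V y \<omega> u = y * sp.mass (vectors \<omega>) u"
        by (simp add: node_mass_def sp.mass_def)
    qed
  qed
qed

lemma node_mass_scale: "node_mass V y \<omega> u = y * node_mass V 1 \<omega> u"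
  by (simp add: node_mass_def)

lemma node_mass_measurable:
  assumes "u \<in> nodes b" shows "(\<lambda>\<omega>. node_mass V 1 \<omega> u) \<in> borel_measurable M"
proof -
  have "(\<lambda>\<omega>. V (take i u) (u ! i) \<omega>) \<in> borel_measurable M" if i: "i < length u" for i
  proof -
    have j: "u ! i < b" using that assms by (auto simp: nodes_def subset_eq)
    then have "(\<lambda>a. a (u ! i)) \<in> borel_measurable (vec_space b)"
      unfolding vec_space_def by (intro measurable_component_singleton) simp
    from measurable_compose[OF split_vec_measurable[OF nodes_take[OF assms]] this, of i]
    show ?thesis using j by (simp add: split_vec_def)
  qed
  then show ?thesis by (simp add: node_mass_def)
qed

text \<open>The trees agree for all \<open>y\<close> outside one null set, as a limit over
  uncountably many \<open>y\<close> demands.\<close>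

lemma frag_tree_AE: "AE \<omega> in M. \<forall>y. frag_tree b V y 1 \<omega> = sp.ftree (vectors \<omega>) y"
  using node_mass_AE by eventually_elim (auto simp: frag_tree_def sp.ftree_def)

lemma frag_tree_nodes: "frag_tree b V x0 x1 \<omega> \<subseteq> nodes b"
  by (auto simp: frag_tree_def)

text \<open>The maps \<open>f\<close>, \<open>g\<close>, \<open>h\<close> cover at once a fixed
  ratio, the random threshold, and joint measurability in the ratio and the sample point.\<close>

lemma sets_node_in_frag_tree:
  assumes f: "f \<in> measurable N M" and [measurable]: "g \<in> borel_measurable N" "h \<in> borel_measurable N"
  shows "{x \<in> space N. u \<in> frag_tree b V (g x) (h x) (f x)} \<in> sets N"
proof (cases "u \<in> nodes b")
  case True
  note [measurable] = measurable_compose[OF f node_mass_measurable[OF True]]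
  have eq: "u \<in> frag_tree b V (g x) (h x) (f x) \<longleftrightarrow> h x \<le> g x * node_mass V 1 (f x) u" for x
    unfolding node_mass_scale[of "g x" "f x" u, symmetric] using True by (simp add: frag_tree_def)
  show ?thesis unfolding eq by measurable
qed (simp add: frag_tree_def)

lemma frag_tree_rooted_AE: "AE \<omega> in M. \<forall>y\<ge>1. rooted_tree (frag_tree b V y 1 \<omega>)"
  using frag_tree_AE AE_vectors[OF sp.finite_ftree_AE] by eventually_elim (auto intro: sp.rooted_ftree)

lemma random_fringe_frag_tree:
  assumes "1 \<le> y" "uniform_random_node M (frag_tree b V y 1) v"
  shows "random_fringe M (frag_tree b V y 1) v"
proof
  show "{\<omega> \<in> space M. u \<in> frag_tree b V y 1 \<omega>} \<in> sets M" for u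
    by (rule sets_node_in_frag_tree[OF measurable_ident_sets]) auto
  show "AE \<omega> in M. rooted_tree (frag_tree b V y 1 \<omega>)"
    using frag_tree_rooted_AE by eventually_elim (use assms in auto)
qed (rule assms)

end

section \<open>The tree with an independent uniform threshold\<close>

locale fragmentation_threshold = nonlattice_fragmentation M b L V
  for M :: "'w measure" and b L V +
  fixes U :: "'w \<Rightarrow> real"
  assumes U_meas [measurable]: "U \<in> borel_measurable M"
    and U_unif: "distr M borel U = uniform_measure lborel {0<..<1}"
    and U_indep: "indep_set
      (sets (vimage_algebra (space M) (\<lambda>\<omega>. \<lambda>u\<in>nodes b. split_vec b V u \<omega>)
        (PiM (nodes b) (\<lambda>_. vec_space b))))
      (sets (vimage_algebra (space M) U borel))"
begin

abbreviation Tbar :: "'w \<Rightarrow> tree" where "Tbar \<equiv> (\<lambda>\<omega>. frag_tree b V 1 (U \<omega>) \<omega>)"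

lemma joint_law: "distr M (sp.Om \<Otimes>\<^sub>M borel) (\<lambda>\<omega>. (vectors \<omega>, U \<omega>)) = sp.Om \<Otimes>\<^sub>M distr M borel U"
proof (rule pair_measure_eqI[symmetric])
  interpret D: prob_space "distr M borel U" by (rule prob_space_distr) simp
  show "sigma_finite_measure sp.Om" "sigma_finite_measure (distr M borel U)" by unfold_locales
  show "sets (sp.Om \<Otimes>\<^sub>M distr M borel U) = sets (distr M (sp.Om \<Otimes>\<^sub>M borel) (\<lambda>\<omega>. (vectors \<omega>, U \<omega>)))"
    by (simp add: sets_pair_measure_cong[OF refl sets_distr])
  fix A B assume A: "A \<in> sets sp.Om" and B: "B \<in> sets (distr M borel U)"
  then have B': "B \<in> sets borel" by simp
  have i: "indep_set (sigma_sets (space M) {vectors -` A \<inter> space M |A. A \<in> sets sp.Om})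
    (sigma_sets (space M) {U -` A \<inter> space M |A. A \<in> sets borel})"
    using U_indep unfolding sets_vimage_algebra sets_Om vectors_def[abs_def] .
  have "prob ((vectors -` A \<inter> space M) \<inter> (U -` B \<inter> space M)) = prob (vectors -` A \<inter> space M) * prob (U -` B \<inter> space M)"
    by (rule indep_setD[OF i]) (use A B' in auto)
  moreover have "(vectors -` A \<inter> space M) \<inter> (U -` B \<inter> space M) = (\<lambda>\<omega>. (vectors \<omega>, U \<omega>)) -` (A \<times> B) \<inter> space M" by auto
  moreover have "emeasure sp.Om A = emeasure M (vectors -` A \<inter> space M)"
    by (subst distr_vectors[symmetric]) (rule emeasure_distr[OF vectors_measurable A])
  moreover have "emeasure (distr M borel U) B = emeasure M (U -` B \<inter> space M)" by (rule emeasure_distr[OF U_meas B'])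
  moreover have "emeasure (distr M (sp.Om \<Otimes>\<^sub>M borel) (\<lambda>\<omega>. (vectors \<omega>, U \<omega>))) (A \<times> B)
      = emeasure M ((\<lambda>\<omega>. (vectors \<omega>, U \<omega>)) -` (A \<times> B) \<inter> space M)"
    using A B' by (intro emeasure_distr) auto
  ultimately show "emeasure sp.Om A * emeasure (distr M borel U) B
      = emeasure (distr M (sp.Om \<Otimes>\<^sub>M borel) (\<lambda>\<omega>. (vectors \<omega>, U \<omega>))) (A \<times> B)"
    by (simp add: emeasure_eq_measure ennreal_mult')
qed

lemma prob_U_le: assumes "0 \<le> c" "c \<le> 1" shows "prob {\<omega> \<in> space M. U \<omega> \<le> c} = c"
proof -
  have "prob {\<omega> \<in> space M. U \<omega> \<le> c} = measure (distr M borel U) {..c}"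
    by (subst measure_distr) (auto simp: vimage_def Int_def conj_commute)
  also have "\<dots> = measure lborel ({0<..<1} \<inter> {..c}) / measure lborel {0<..<1::real}"
    unfolding U_unif by (rule measure_uniform_measure) auto
  also have "{0<..<1} \<inter> {..c} = (if c = 1 then {0<..<1} else {0<..c})" using assms by auto
  finally show ?thesis using assms by auto
qed

lemma U_bounds_AE: "AE \<omega> in M. 0 < U \<omega> \<and> U \<omega> < 1"
proof -
  have "AE u in distr M borel U. 0 < u \<and> u < 1" unfolding U_unif by (subst AE_uniform_measure) auto
  then show ?thesis by (rule AE_distrD[OF U_meas])
qed

lemma Tbar_eq_AE: "AE \<omega> in M. Tbar \<omega> = sp.ftree (vectors \<omega>) (1 / U \<omega>)"
  using node_mass_AE U_bounds_AE
  by eventually_elim (auto simp: frag_tree_def sp.ftree_def pos_le_divide_eq pos_divide_le_eq field_simps)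

lemma sets_node_in_Tbar: "{\<omega> \<in> space M. u \<in> Tbar \<omega>} \<in> sets M"
  by (rule sets_node_in_frag_tree[OF measurable_ident_sets]) auto

lemma Tbar_rooted_AE: "AE \<omega> in M. rooted_tree (Tbar \<omega>)"
  using Tbar_eq_AE U_bounds_AE AE_vectors[OF sp.finite_ftree_AE]
  by eventually_elim (simp add: sp.rooted_ftree)

text \<open>Almost surely, \<open>A\<close> is contained in the tree iff \<open>U\<close> is at most
  the least mass on \<open>A\<close>. That mass lies between \<open>0\<close> and \<open>1\<close>,
  so it is itself the conditional probability of the event given the vectors.\<close>

lemma prob_subset_Tbar:
  assumes A: "finite A" "[] \<in> A" "A \<subseteq> nodes b"
  shows "prob {\<omega> \<in> space M. A \<subseteq> Tbar \<omega>} = (\<integral>x. sp.min_mass A x \<partial>sp.Om)"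
proof -
  have mm: "sp.min_mass A \<in> borel_measurable sp.Om" "0 \<le> sp.min_mass A x" "sp.min_mass A x \<le> 1" for x
    using sp.min_mass_measurable[of A] sp.min_mass_bounds[of A x] A by auto
  note [measurable] = mm(1)
  interpret D: prob_space "distr M borel U" by (rule prob_space_distr) simp
  interpret P: pair_prob_space sp.Om "distr M borel U" ..
  let ?h = "\<lambda>(x, u). indicat_real {u. u \<le> sp.min_mass A x} (u::real)"
  have hm: "?h \<in> borel_measurable (sp.Om \<Otimes>\<^sub>M borel)"
  proof -
    have "(\<lambda>p. if snd p \<le> sp.min_mass A (fst p) then 1 else 0 :: real) \<in> borel_measurable (sp.Om \<Otimes>\<^sub>M borel)"
      by measurable
    then show ?thesis by (simp add: indicator_def of_bool_def case_prod_beta')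
  qed
  have hm': "?h \<in> borel_measurable (sp.Om \<Otimes>\<^sub>M distr M borel U)"
    using hm by (subst measurable_cong_sets[OF sets_pair_measure_cong[OF refl sets_distr] refl])
  have "prob {\<omega> \<in> space M. A \<subseteq> Tbar \<omega>} = prob {\<omega> \<in> space M. U \<omega> \<le> sp.min_mass A (vectors \<omega>)}"
  proof (rule finite_measure_eq_AE)
    have "{\<omega> \<in> space M. A \<subseteq> Tbar \<omega>} = {\<omega> \<in> space M. \<forall>u\<in>A. u \<in> Tbar \<omega>}" by auto
    also have "\<dots> \<in> sets M" using A by (intro sets.sets_Collect_finite_All sets_node_in_Tbar)
    finally show "{\<omega> \<in> space M. A \<subseteq> Tbar \<omega>} \<in> sets M" .
    show "{\<omega> \<in> space M. U \<omega> \<le> sp.min_mass A (vectors \<omega>)} \<in> sets M" by measurable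
    show "AE \<omega> in M. \<omega> \<in> {\<omega> \<in> space M. A \<subseteq> Tbar \<omega>} \<longleftrightarrow> \<omega> \<in> {\<omega> \<in> space M. U \<omega> \<le> sp.min_mass A (vectors \<omega>)}"
      using Tbar_eq_AE U_bounds_AE
    proof eventually_elim
      case (elim \<omega>)
      have "A \<subseteq> Tbar \<omega> \<longleftrightarrow> 1 \<le> 1 / U \<omega> * sp.min_mass A (vectors \<omega>)"
        unfolding elim(1) using A elim(2) by (intro sp.subset_ftree_iff) auto
      then show ?case using elim(2) by (auto simp: field_simps)
    qed
  qed
  also have "\<dots> = (\<integral>\<omega>. ?h (vectors \<omega>, U \<omega>) \<partial>M)"
  proof -
    have "(\<integral>\<omega>. ?h (vectors \<omega>, U \<omega>) \<partial>M) = (\<integral>\<omega>. indicat_real {\<omega> \<in> space M. U \<omega> \<le> sp.min_mass A (vectors \<omega>)} \<omega> \<partial>M)"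
      by (intro Bochner_Integration.integral_cong refl) (auto simp: indicator_def)
    also have "\<dots> = prob {\<omega> \<in> space M. U \<omega> \<le> sp.min_mass A (vectors \<omega>)}" by (subst Bochner_Integration.integral_indicator) (auto simp: emeasure_eq_measure)
    finally show ?thesis ..
  qed
  also have "\<dots> = (\<integral>p. ?h p \<partial>(sp.Om \<Otimes>\<^sub>M distr M borel U))"
    unfolding joint_law[symmetric] by (rule integral_distr[symmetric, OF _ hm]) measurable
  also have "\<dots> = (\<integral>x. (\<integral>u. ?h (x, u) \<partial>distr M borel U) \<partial>sp.Om)"
    using hm' by (intro P.integral_fst'[symmetric] P.integrable_const_bound[where B=1]) (auto simp: indicator_def)
  also have "\<dots> = (\<integral>x. sp.min_mass A x \<partial>sp.Om)"
  proof (intro Bochner_Integration.integral_cong refl)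
    fix x
    have "(\<integral>u. ?h (x, u) \<partial>distr M borel U) = measure (distr M borel U) {..sp.min_mass A x}"
      by (simp add: atMost_def)
    also have "\<dots> = prob {\<omega> \<in> space M. U \<omega> \<le> sp.min_mass A x}"
      by (subst measure_distr) (auto simp: vimage_def Int_def conj_commute)
    also have "\<dots> = sp.min_mass A x" by (rule prob_U_le[OF mm(2,3)])
    finally show "(\<integral>u. ?h (x, u) \<partial>distr M borel U) = sp.min_mass A x" .
  qed
  finally show ?thesis .
qed

lemma fringe_mean_frag_tree_AE:
  assumes f: "\<And>S. \<bar>f S\<bar> \<le> K" "\<And>S. \<not> rooted_tree S \<Longrightarrow> f S = 0"
  shows "AE \<omega> in M. ((\<lambda>y. fringe_mean f (frag_tree b V y 1 \<omega>)) \<longlongrightarrow> (\<integral>\<omega>. f (Tbar \<omega>) \<partial>M)) at_top"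
proof -
  have "AE x in sp.Om. ((\<lambda>y. (\<Sum>v\<in>sp.ftree x y. f (subtree_at (sp.ftree x y) v)) / real (card (sp.ftree x y)))
    \<longlongrightarrow> (\<integral>\<omega>. f (Tbar \<omega>) \<partial>M)) at_top"
    by (rule sp.fringe_limit_AE[OF prob_space_axioms sets_node_in_Tbar frag_tree_nodes Tbar_rooted_AE prob_subset_Tbar f])
  from AE_vectors[OF this] show ?thesis using frag_tree_AE
    by eventually_elim (simp add: fringe_mean_def)
qed

end

section \<open>Exponential mixtures and countable sets of trees\<close>

abbreviation exp_law :: "real measure" where "exp_law \<equiv> density lborel (exponential_density 1)"

lemma integral_exp_law:
  assumes [measurable]: "g \<in> borel_measurable borel"
  shows "(\<integral>t. g t \<partial>exp_law) = (LBINT t:{0..}. exp (- t) * g t)"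
proof -
  have "(\<integral>t. g t \<partial>exp_law) = (\<integral>t. exponential_density 1 t * g t \<partial>lborel)"
    by (rule integral_real_density) (auto simp: exponential_density_def)
  also have "\<dots> = (LBINT t:{0..}. exp (- t) * g t)"
    unfolding set_lebesgue_integral_def
    by (intro Bochner_Integration.integral_cong refl) (auto simp: exponential_density_def indicator_def)
  finally show ?thesis .
qed

lemma num_nodes_rooted:
  assumes "rooted_tree T"
  shows "num_nodes_with P T = num_nodes_with (P \<inter> Collect rooted_tree) T"
  unfolding num_nodes_with_def using rooted_subtree_at[OF assms] by (intro arg_cong[where f=card]) auto

text \<open>A member of the class need not be a rooted tree in the given encoding, but the bijection
  makes it a finite set of words, and there are countably many of these.\<close>

lemma countable_iso_class:
  assumes "r \<in> {unordered_iso, ordered_iso, bary_iso}" "rooted_tree T"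
  shows "countable {S. r S T}"
proof (rule countable_subset[OF _ countable_Collect_finite])
  have "finite S" if "rooted_iso_map f S T" for S f
    using that assms(2) by (auto simp: rooted_iso_map_def rooted_tree_def bij_betw_finite)
  then show "{S. r S T} \<subseteq> {S. finite S}"
    using assms(1) by (auto simp: unordered_iso_def ordered_iso_def bary_iso_def)
qed

lemma (in prob_space) prob_eq_expectation_indicator:
  assumes "{\<omega> \<in> space M. X \<omega> \<in> P} \<in> sets M"
  shows "prob {\<omega> \<in> space M. X \<omega> \<in> P} = (\<integral>\<omega>. indicat_real P (X \<omega>) \<partial>M)"
proof -
  have "(\<integral>\<omega>. indicat_real P (X \<omega>) \<partial>M) = (\<integral>\<omega>. indicat_real {\<omega> \<in> space M. X \<omega> \<in> P} \<omega> \<partial>M)"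
    by (intro Bochner_Integration.integral_cong refl) (auto simp: indicator_def)
  also have "\<dots> = prob {\<omega> \<in> space M. X \<omega> \<in> P}"
    using assms by (subst Bochner_Integration.integral_indicator) (auto simp: emeasure_eq_measure)
  finally show ?thesis ..
qed

context fragmentation_threshold
begin

lemma sets_Tbar_in: "countable P \<Longrightarrow> {\<omega> \<in> space M. Tbar \<omega> \<in> P} \<in> sets M"
proof -
  assume "countable P"
  then have "(\<Union>S\<in>P. {\<omega> \<in> space M. Tbar \<omega> = S}) \<in> sets M"
    by (intro sets.countable_UN') (use sets_tree_eq[OF sets_node_in_Tbar] in auto)
  moreover have "(\<Union>S\<in>P. {\<omega> \<in> space M. Tbar \<omega> = S}) = {\<omega> \<in> space M. Tbar \<omega> \<in> P}" by auto
  ultimately show ?thesis by simp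
qed

lemma indicator_frag_tree_measurable:
  assumes P: "countable P" and f: "f \<in> measurable N M" and g: "g \<in> borel_measurable N"
  shows "(\<lambda>x. indicat_real P (frag_tree b V (g x) 1 (f x))) \<in> borel_measurable N"
  by (rule measurable_countable_support[OF P sets_tree_eq[OF sets_node_in_frag_tree[OF f g]]]) auto

lemma prob_frag_tree_in:
  assumes P: "countable P"
  shows "prob {\<omega> \<in> space M. frag_tree b V y 1 \<omega> \<in> P} = (\<integral>\<omega>. indicat_real P (frag_tree b V y 1 \<omega>) \<partial>M)"
proof (rule prob_eq_expectation_indicator)
  have "(\<lambda>\<omega>. indicat_real P (frag_tree b V y 1 \<omega>)) \<in> borel_measurable M"
    by (rule indicator_frag_tree_measurable[OF P measurable_ident_sets[OF refl]]) simp
  from measurable_sets[OF this, of "{1}"]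
  show "{\<omega> \<in> space M. frag_tree b V y 1 \<omega> \<in> P} \<in> sets M"
    by (simp add: vimage_def Int_def conj_commute indicator_eq_1_iff)
qed

lemma minus_ln_U_exponential: "distributed M lborel (\<lambda>\<omega>. - ln (U \<omega>)) (exponential_density 1)"
proof (subst exponential_distributed_iff, simp, intro conjI allI impI)
  show "(\<lambda>\<omega>. - ln (U \<omega>)) \<in> borel_measurable M" by measurable
  fix a :: real assume a: "0 \<le> a"
  have "prob {\<omega> \<in> space M. - ln (U \<omega>) \<le> a} = prob (space M - {\<omega> \<in> space M. U \<omega> < exp (- a)})"
  proof (rule finite_measure_eq_AE)
    show "AE \<omega> in M. \<omega> \<in> {\<omega> \<in> space M. - ln (U \<omega>) \<le> a} \<longleftrightarrow> \<omega> \<in> space M - {\<omega> \<in> space M. U \<omega> < exp (- a)}"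
      using U_bounds_AE
    proof eventually_elim
      case (elim \<omega>)
      then have "- ln (U \<omega>) \<le> a \<longleftrightarrow> exp (- a) \<le> U \<omega>" using ln_ge_iff[of "U \<omega>" "- a"] by auto
      then show ?case by auto
    qed
  qed measurable
  also have "\<dots> = 1 - prob {\<omega> \<in> space M. U \<omega> < exp (- a)}" by (rule prob_compl) measurable
  also have "prob {\<omega> \<in> space M. U \<omega> < exp (- a)} = exp (- a)"
  proof -
    have "prob {\<omega> \<in> space M. U \<omega> < exp (- a)} = measure (distr M borel U) {..<exp (- a)}"
      by (subst measure_distr) (auto simp: vimage_def Int_def conj_commute)
    also have "\<dots> = measure lborel ({0<..<1} \<inter> {..<exp (- a)}) / measure lborel {0<..<1::real}"
      unfolding U_unif by (rule measure_uniform_measure) auto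
    also have "{0<..<1} \<inter> {..<exp (- a)} = {0<..<exp (- a)}"
    proof -
      have "exp (- a) \<le> 1" using a by simp
      then have "x < 1" if "x < exp (- a)" for x using that by (rule less_le_trans[rotated])
      then show ?thesis by auto
    qed
    finally show ?thesis by simp
  qed
  finally show "prob {\<omega> \<in> space M. - ln (U \<omega>) \<le> a} = 1 - exp (- a * 1)" by simp
qed

text \<open>With \<open>U = exp (- t)\<close> the threshold \<open>U\<close> turns into the ratio \<open>exp t\<close>, where \<open>t\<close> is exponentially distributed.\<close>

lemma prob_Tbar_exp_law:
  assumes P: "countable P"
  shows "prob {\<omega> \<in> space M. Tbar \<omega> \<in> P} = (\<integral>t. prob {\<omega> \<in> space M. frag_tree b V (exp t) 1 \<omega> \<in> P} \<partial>exp_law)"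
proof -
  interpret D: prob_space "distr M borel U" by (rule prob_space_distr) simp
  interpret PP: pair_prob_space sp.Om "distr M borel U" ..
  have sets_ft: "{x \<in> space N. u \<in> sp.ftree (f x) (g x)} \<in> sets N"
    if f: "f \<in> measurable N sp.Om" and [measurable]: "g \<in> borel_measurable N" for N :: "'n measure" and f g u
  proof (cases "u \<in> nodes b")
    case True
    note [measurable] = measurable_compose[OF f sp.mass_measurable[OF True]]
    have eq: "u \<in> sp.ftree (f x) (g x) \<longleftrightarrow> 1 \<le> g x * sp.mass (f x) u" for x
      using True by (simp add: sp.ftree_def)
    show ?thesis unfolding eq by measurable
  qed (simp add: sp.ftree_def)
  have ft_meas: "(\<lambda>x. indicat_real P (sp.ftree (f x) (g x))) \<in> borel_measurable N"
    if f: "f \<in> measurable N sp.Om" and g: "g \<in> borel_measurable N" for N :: "'n measure" and f g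
    by (rule measurable_countable_support[OF P sets_tree_eq[OF sets_ft[OF f g]]]) auto
  define G where "G y = (\<integral>x. indicat_real P (sp.ftree x y) \<partial>sp.Om)" for y
  have Gm [measurable]: "G \<in> borel_measurable borel" unfolding G_def[abs_def]
    by (rule sp.Om.borel_measurable_lebesgue_integral, unfold case_prod_beta', rule ft_meas) measurable
  have G: "G y = prob {\<omega> \<in> space M. frag_tree b V y 1 \<omega> \<in> P}" for y
  proof -
    have "G y = (\<integral>\<omega>. indicat_real P (sp.ftree (vectors \<omega>) y) \<partial>M)"
      unfolding G_def
      by (subst distr_vectors[symmetric], rule integral_distr[OF vectors_measurable])
         (rule ft_meas[OF measurable_ident_sets[OF refl]], simp)
    also have "\<dots> = (\<integral>\<omega>. indicat_real P (frag_tree b V y 1 \<omega>) \<partial>M)"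
    proof (rule integral_cong_AE)
      show "AE \<omega> in M. indicat_real P (sp.ftree (vectors \<omega>) y) = indicat_real P (frag_tree b V y 1 \<omega>)"
        using frag_tree_AE by eventually_elim simp
      show "(\<lambda>\<omega>. indicat_real P (sp.ftree (vectors \<omega>) y)) \<in> borel_measurable M"
        by (rule ft_meas) measurable
      show "(\<lambda>\<omega>. indicat_real P (frag_tree b V y 1 \<omega>)) \<in> borel_measurable M"
        by (rule indicator_frag_tree_measurable[OF P measurable_ident_sets[OF refl]]) simp
    qed
    finally show ?thesis by (simp add: prob_frag_tree_in[OF P])
  qed
  let ?h = "\<lambda>(x, u). indicat_real P (sp.ftree x (1 / u))"
  have hm: "?h \<in> borel_measurable (sp.Om \<Otimes>\<^sub>M borel)"
    unfolding case_prod_beta' by (rule ft_meas) measurable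
  have hm': "?h \<in> borel_measurable (sp.Om \<Otimes>\<^sub>M distr M borel U)"
    using hm by (subst measurable_cong_sets[OF sets_pair_measure_cong[OF refl sets_distr] refl])
  have "prob {\<omega> \<in> space M. Tbar \<omega> \<in> P} = (\<integral>\<omega>. indicat_real P (Tbar \<omega>) \<partial>M)"
    by (rule prob_eq_expectation_indicator[OF sets_Tbar_in[OF P]])
  also have "\<dots> = (\<integral>\<omega>. ?h (vectors \<omega>, U \<omega>) \<partial>M)"
  proof (rule integral_cong_AE)
    show "(\<lambda>\<omega>. indicat_real P (Tbar \<omega>)) \<in> borel_measurable M"
      by (rule measurable_countable_support[OF P sets_tree_eq[OF sets_node_in_Tbar]]) auto
    show "(\<lambda>\<omega>. ?h (vectors \<omega>, U \<omega>)) \<in> borel_measurable M"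
      unfolding prod.case by (rule ft_meas) measurable
    show "AE \<omega> in M. indicat_real P (Tbar \<omega>) = ?h (vectors \<omega>, U \<omega>)"
      using Tbar_eq_AE by eventually_elim simp
  qed
  also have "\<dots> = (\<integral>p. ?h p \<partial>(sp.Om \<Otimes>\<^sub>M distr M borel U))"
    unfolding joint_law[symmetric] by (rule integral_distr[symmetric, OF _ hm]) measurable
  also have "\<dots> = (\<integral>u. (\<integral>x. ?h (x, u) \<partial>sp.Om) \<partial>distr M borel U)"
  proof -
    have "integrable (sp.Om \<Otimes>\<^sub>M distr M borel U) (\<lambda>(x, u). indicat_real P (sp.ftree x (1 / u)))"
      using hm' by (intro PP.integrable_const_bound[where B=1]) (auto simp: indicator_def)
    from PP.integral_snd[OF this] show ?thesis by simp
  qed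
  also have "\<dots> = (\<integral>u. G (1 / u) \<partial>distr M borel U)" by (simp add: G_def)
  also have "\<dots> = (\<integral>\<omega>. G (1 / U \<omega>) \<partial>M)" by (rule integral_distr) measurable
  also have "\<dots> = (\<integral>\<omega>. G (exp (- ln (U \<omega>))) \<partial>M)"
  proof (rule integral_cong_AE)
    show "AE \<omega> in M. G (1 / U \<omega>) = G (exp (- ln (U \<omega>)))"
      using U_bounds_AE by eventually_elim (simp add: exp_minus inverse_eq_divide)
  qed measurable
  also have "\<dots> = (\<integral>t. exponential_density 1 t * G (exp t) \<partial>lborel)"
    by (rule distributed_integral[OF minus_ln_U_exponential, symmetric]) (auto simp: exponential_density_def)
  also have "\<dots> = (\<integral>t. G (exp t) \<partial>exp_law)"
    by (rule integral_real_density[symmetric]) (auto simp: exponential_density_def)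
  finally show ?thesis by (simp add: G)
qed

text \<open>Both claims rest on joint measurability in \<open>t\<close> and the sample point; the
  first permits \<open>integral_exp_law\<close>, the second is Fubini's theorem.\<close>

lemma prob_frag_tree_exp_law:
  assumes P: "countable P"
  shows "(\<lambda>t. prob {\<omega> \<in> space M. frag_tree b V (exp t) 1 \<omega> \<in> P}) \<in> borel_measurable borel"
    and "(\<integral>t. prob {\<omega> \<in> space M. frag_tree b V (exp t) 1 \<omega> \<in> P} \<partial>exp_law)
      = (\<integral>\<omega>. (LBINT t:{0..}. exp (- t) * indicat_real P (frag_tree b V (exp t) 1 \<omega>)) \<partial>M)"
proof -
  interpret E: prob_space exp_law by (rule prob_space_exponential_density) simp
  interpret PP: pair_prob_space M exp_law ..
  have m1: "(\<lambda>(t, \<omega>). indicat_real P (frag_tree b V (exp t) 1 \<omega>)) \<in> borel_measurable (borel \<Otimes>\<^sub>M M)"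
    unfolding case_prod_beta' by (rule indicator_frag_tree_measurable[OF P]) measurable
  have "(\<lambda>t. \<integral>\<omega>. indicat_real P (frag_tree b V (exp t) 1 \<omega>) \<partial>M) \<in> borel_measurable borel"
    by (rule borel_measurable_lebesgue_integral[OF m1])
  then show "(\<lambda>t. prob {\<omega> \<in> space M. frag_tree b V (exp t) 1 \<omega> \<in> P}) \<in> borel_measurable borel"
    unfolding prob_frag_tree_in[OF P] .
  have m2: "(\<lambda>(\<omega>, t). indicat_real P (frag_tree b V (exp t) 1 \<omega>)) \<in> borel_measurable (M \<Otimes>\<^sub>M exp_law)"
    unfolding case_prod_beta' by (rule indicator_frag_tree_measurable[OF P]) measurable
  have "integrable (M \<Otimes>\<^sub>M exp_law) (\<lambda>(\<omega>, t). indicat_real P (frag_tree b V (exp t) 1 \<omega>))"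
    using m2 by (intro PP.integrable_const_bound[where B=1]) (auto simp: indicator_def)
  from PP.Fubini_integral[OF this]
  have "(\<integral>t. (\<integral>\<omega>. indicat_real P (frag_tree b V (exp t) 1 \<omega>) \<partial>M) \<partial>exp_law)
      = (\<integral>\<omega>. (\<integral>t. indicat_real P (frag_tree b V (exp t) 1 \<omega>) \<partial>exp_law) \<partial>M)" .
  also have "\<dots> = (\<integral>\<omega>. (LBINT t:{0..}. exp (- t) * indicat_real P (frag_tree b V (exp t) 1 \<omega>)) \<partial>M)"
  proof (intro Bochner_Integration.integral_cong refl integral_exp_law)
    fix \<omega> assume "\<omega> \<in> space M"
    then show "(\<lambda>t. indicat_real P (frag_tree b V (exp t) 1 \<omega>)) \<in> borel_measurable borel"
      by (intro indicator_frag_tree_measurable[OF P]) auto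
  qed
  finally show "(\<integral>t. prob {\<omega> \<in> space M. frag_tree b V (exp t) 1 \<omega> \<in> P} \<partial>exp_law)
      = (\<integral>\<omega>. (LBINT t:{0..}. exp (- t) * indicat_real P (frag_tree b V (exp t) 1 \<omega>)) \<partial>M)"
    by (simp only: prob_frag_tree_in[OF P])
qed

text \<open>\<open>P\<close> may contain sets of words that are not rooted trees, as isomorphism
  classes do. Fringe trees of a rooted tree are rooted and \<open>Tbar\<close> is almost surely
  rooted, so intersecting \<open>P\<close> with the rooted trees changes neither the proportion for
  \<open>y \<ge> 1\<close> nor the limit.\<close>

lemma fringe_proportion_AE:
  assumes P: "countable P"
  shows "AE \<omega> in M. ((\<lambda>y. real (num_nodes_with P (frag_tree b V y 1 \<omega>)) / real (card (frag_tree b V y 1 \<omega>)))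
    \<longlongrightarrow> prob {\<omega> \<in> space M. Tbar \<omega> \<in> P}) at_top"
proof -
  let ?f = "indicat_real (P \<inter> Collect rooted_tree)"
  have "AE \<omega> in M. ((\<lambda>y. fringe_mean ?f (frag_tree b V y 1 \<omega>)) \<longlongrightarrow> (\<integral>\<omega>. ?f (Tbar \<omega>) \<partial>M)) at_top"
    by (rule fringe_mean_frag_tree_AE[where K=1]) (auto simp: indicator_def)
  moreover have "(\<integral>\<omega>. ?f (Tbar \<omega>) \<partial>M) = prob {\<omega> \<in> space M. Tbar \<omega> \<in> P}"
  proof -
    have c: "countable (P \<inter> Collect rooted_tree)" using P by auto
    have "prob {\<omega> \<in> space M. Tbar \<omega> \<in> P} = prob {\<omega> \<in> space M. Tbar \<omega> \<in> P \<inter> Collect rooted_tree}"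
      by (rule finite_measure_eq_AE[OF _ sets_Tbar_in[OF P] sets_Tbar_in[OF c]])
         (use Tbar_rooted_AE in \<open>eventually_elim, auto\<close>)
    then show ?thesis by (simp only: prob_eq_expectation_indicator[OF sets_Tbar_in[OF c]])
  qed
  ultimately have "AE \<omega> in M. ((\<lambda>y. fringe_mean ?f (frag_tree b V y 1 \<omega>)) \<longlongrightarrow> prob {\<omega> \<in> space M. Tbar \<omega> \<in> P}) at_top"
    by simp
  then show ?thesis using frag_tree_rooted_AE
  proof eventually_elim
    case (elim \<omega>)
    have "\<forall>\<^sub>F y in at_top. fringe_mean ?f (frag_tree b V y 1 \<omega>)
        = real (num_nodes_with P (frag_tree b V y 1 \<omega>)) / real (card (frag_tree b V y 1 \<omega>))"
      using eventually_ge_at_top[of "1::real"]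
    proof eventually_elim
      case (elim y)
      then have r: "rooted_tree (frag_tree b V y 1 \<omega>)" using \<open>\<forall>y\<ge>1. rooted_tree (frag_tree b V y 1 \<omega>)\<close> by blast
      then have "finite (frag_tree b V y 1 \<omega>)" by (simp add: rooted_tree_def)
      then show ?case by (simp only: fringe_mean_indicator num_nodes_rooted[OF r, of P])
    qed
    then show ?case by (rule Lim_transform_eventually[OF elim(1)])
  qed
qed

text \<open>The expectation at the random fringe tree equals the expectation of
  \<open>fringe_mean\<close>. The latter converges almost surely to a constant, and bounded
  convergence passes this to expectations.\<close>

lemma fringe_converges_in_distribution:
  assumes v: "\<And>y. y \<ge> 1 \<Longrightarrow> uniform_random_node M (frag_tree b V y 1) (v y)"
  shows "tree_converges_in_distribution M (\<lambda>y \<omega>. subtree_at (frag_tree b V y 1 \<omega>) (v y \<omega>)) Tbar"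
  unfolding tree_converges_in_distribution_def
proof (intro allI impI)
  fix f :: "tree \<Rightarrow> real"
  assume bd: "bounded (range f)" and f0: "\<forall>S. \<not> rooted_tree S \<longrightarrow> f S = 0"
  then obtain K where K: "\<And>S. \<bar>f S\<bar> \<le> K" by (auto simp: bounded_iff)
  have K0: "0 \<le> K" using K[of "{}"] by linarith
  have fm: "(\<lambda>\<omega>. fringe_mean f (frag_tree b V y 1 \<omega>)) \<in> borel_measurable M" for y
    by (rule fringe_mean_measurable[OF sets_node_in_frag_tree[OF measurable_ident_sets[OF refl]]]) auto
  have Tm: "(\<lambda>\<omega>. f (Tbar \<omega>)) \<in> borel_measurable M"
    by (rule measurable_countable_support[OF countable_rooted_trees sets_tree_eq[OF sets_node_in_Tbar]]) (use f0 in auto)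
  have "AE \<omega> in M. ((\<lambda>y. fringe_mean f (frag_tree b V y 1 \<omega>)) \<longlongrightarrow> (\<integral>\<omega>. f (Tbar \<omega>) \<partial>M)) at_top"
    by (rule fringe_mean_frag_tree_AE[OF K]) (use f0 in auto)
  then have "((\<lambda>y. \<integral>\<omega>. fringe_mean f (frag_tree b V y 1 \<omega>) \<partial>M) \<longlongrightarrow> (\<integral>\<omega>. (\<integral>\<omega>. f (Tbar \<omega>) \<partial>M) \<partial>M)) at_top"
    by (intro integral_dominated_convergence_at_top[where w="\<lambda>_. K"] fm)
       (auto intro!: always_eventually fringe_mean_bound K K0)
  then have lim: "((\<lambda>y. \<integral>\<omega>. fringe_mean f (frag_tree b V y 1 \<omega>) \<partial>M) \<longlongrightarrow> (\<integral>\<omega>. f (Tbar \<omega>) \<partial>M)) at_top"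
    by (simp add: prob_space)
  have "\<forall>\<^sub>F y in at_top. (\<integral>\<omega>. fringe_mean f (frag_tree b V y 1 \<omega>) \<partial>M)
      = (\<integral>\<omega>. f (subtree_at (frag_tree b V y 1 \<omega>) (v y \<omega>)) \<partial>M)"
    using eventually_ge_at_top[of "1::real"]
  proof eventually_elim
    case (elim y)
    interpret F: random_fringe M "frag_tree b V y 1" "v y"
      by (rule random_fringe_frag_tree[OF elim v[OF elim]])
    show ?case
      using F.fringe_mean_integral[where B=UNIV and f=f and K=K, OF countable_rooted_trees] K f0 by simp
  qed
  then show "((\<lambda>y. \<integral>\<omega>. f (subtree_at (frag_tree b V y 1 \<omega>) (v y \<omega>)) \<partial>M) \<longlongrightarrow> (\<integral>\<omega>. f (Tbar \<omega>) \<partial>M)) at_top"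
    by (rule Lim_transform_eventually[OF lim])
qed

end

theorem theorem9p3:
  fixes M :: "'w measure" and b :: nat and L :: "(nat \<Rightarrow> real) measure"
    and V :: "node \<Rightarrow> nat \<Rightarrow> 'w \<Rightarrow> real" and U :: "'w \<Rightarrow> real"
    and That :: "real \<Rightarrow> 'w \<Rightarrow> tree" and Tbar :: "'w \<Rightarrow> tree"
    and v :: "real \<Rightarrow> 'w \<Rightarrow> node" and Tstar :: "real \<Rightarrow> 'w \<Rightarrow> tree"
  assumes frag: "fragmentation M b L V"
    and nonlat: "non_lattice b L"
    and U_meas: "U \<in> borel_measurable M"
    and U_unif: "distr M borel U = uniform_measure lborel {0<..<1}"
    and U_indep: "prob_space.indep_set M
      (sets (vimage_algebra (space M) (\<lambda>\<omega>. \<lambda>u\<in>nodes b. split_vec b V u \<omega>)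
        (PiM (nodes b) (\<lambda>_. vec_space b))))
      (sets (vimage_algebra (space M) U borel))"
    and That: "That = (\<lambda>y. frag_tree b V y 1)"
    and Tbar: "Tbar = (\<lambda>\<omega>. frag_tree b V 1 (U \<omega>) \<omega>)"
    and v_unif: "\<And>y. y \<ge> 1 \<Longrightarrow> uniform_random_node M (That y) (v y)"
    and Tstar: "Tstar = (\<lambda>y \<omega>. subtree_at (That y \<omega>) (v y \<omega>))"
  shows
    "tree_converges_in_distribution M Tstar Tbar
     \<and>
     (\<forall>iso \<in> {unordered_iso, ordered_iso, bary_iso}. \<forall>T. rooted_tree T \<longrightarrow>
        (\<forall>y\<ge>1. AE \<omega> in M. cond_prob_tree M (Tstar y) {S. iso S T} (That y) \<omega>
                  = real (num_nodes_with {S. iso S T} (That y \<omega>)) / real (card (That y \<omega>))) \<and>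
        (AE \<omega> in M. ((\<lambda>y. real (num_nodes_with {S. iso S T} (That y \<omega>)) / real (card (That y \<omega>)))
                  \<longlongrightarrow> \<P>(\<omega>' in M. iso (Tbar \<omega>') T)) at_top))
     \<and>
     (\<forall>P \<subseteq> Collect rooted_tree.
        (\<forall>y\<ge>1. AE \<omega> in M. cond_prob_tree M (Tstar y) P (That y) \<omega>
                  = real (num_nodes_with P (That y \<omega>)) / real (card (That y \<omega>))) \<and>
        (AE \<omega> in M. ((\<lambda>y. real (num_nodes_with P (That y \<omega>)) / real (card (That y \<omega>)))
                  \<longlongrightarrow> \<P>(\<omega>' in M. Tbar \<omega>' \<in> P)) at_top) \<and>
        \<P>(\<omega> in M. Tbar \<omega> \<in> P)
          = (LBINT t:{0..}. exp (- t) * \<P>(\<omega> in M. That (exp t) \<omega> \<in> P)) \<and>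
        (LBINT t:{0..}. exp (- t) * \<P>(\<omega> in M. That (exp t) \<omega> \<in> P))
          = (\<integral>\<omega>. (LBINT t:{0..}. exp (- t) * indicat_real P (That (exp t) \<omega>)) \<partial>M))"
proof -
  interpret fragmentation M b L V by (rule frag)
  interpret fragmentation_threshold M b L V U
    by unfold_locales (fact nonlat U_meas U_unif U_indep)+
  have cond: "AE \<omega> in M. cond_prob_tree M (Tstar y) P (That y) \<omega>
      = real (num_nodes_with P (That y \<omega>)) / real (card (That y \<omega>))" if "countable P" "y \<ge> 1" for P y
  proof -
    have u: "uniform_random_node M (frag_tree b V y 1) (v y)" using v_unif[OF that(2)] by (simp only: That)
    interpret F: random_fringe M "frag_tree b V y 1" "v y"
      by (rule random_fringe_frag_tree[OF that(2) u])
    show ?thesis unfolding Tstar That by (rule F.cond_prob_fringe[OF that(1)])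
  qed
  have lim: "AE \<omega> in M. ((\<lambda>y. real (num_nodes_with P (That y \<omega>)) / real (card (That y \<omega>)))
      \<longlongrightarrow> \<P>(\<omega>' in M. Tbar \<omega>' \<in> P)) at_top" if "countable P" for P
    unfolding That Tbar by (rule fringe_proportion_AE[OF that])
  have dist: "tree_converges_in_distribution M Tstar Tbar"
    unfolding Tstar Tbar That by (rule fringe_converges_in_distribution) (use v_unif in \<open>simp only: That\<close>)
  have int: "\<P>(\<omega> in M. Tbar \<omega> \<in> P) = (LBINT t:{0..}. exp (- t) * \<P>(\<omega> in M. That (exp t) \<omega> \<in> P))"
    "(LBINT t:{0..}. exp (- t) * \<P>(\<omega> in M. That (exp t) \<omega> \<in> P))
      = (\<integral>\<omega>. (LBINT t:{0..}. exp (- t) * indicat_real P (That (exp t) \<omega>)) \<partial>M)" if "countable P" for P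
    unfolding That Tbar
    using prob_Tbar_exp_law[OF that] prob_frag_tree_exp_law[OF that]
      integral_exp_law[OF prob_frag_tree_exp_law(1)[OF that]] by simp_all
  show ?thesis
  proof (intro conjI ballI allI impI dist)
    fix r T assume rT: "r \<in> {unordered_iso, ordered_iso, bary_iso}" "rooted_tree T"
    show "AE \<omega> in M. cond_prob_tree M (Tstar y) {S. r S T} (That y) \<omega>
        = real (num_nodes_with {S. r S T} (That y \<omega>)) / real (card (That y \<omega>))" if "1 \<le> y" for y
      by (rule cond[OF countable_iso_class[OF rT] that])
    show "AE \<omega> in M. ((\<lambda>y. real (num_nodes_with {S. r S T} (That y \<omega>)) / real (card (That y \<omega>)))
        \<longlongrightarrow> \<P>(\<omega>' in M. r (Tbar \<omega>') T)) at_top"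
      using lim[OF countable_iso_class[OF rT]] unfolding mem_Collect_eq .
  next
    fix P :: "tree set" assume "P \<subseteq> Collect rooted_tree"
    \<comment> \<open>Every set of finite rooted trees is countable, which is the form in which the
      preceding facts take a property.\<close>
    then have P: "countable P" using countable_rooted_trees by (rule countable_subset)
    show "AE \<omega> in M. cond_prob_tree M (Tstar y) P (That y) \<omega>
        = real (num_nodes_with P (That y \<omega>)) / real (card (That y \<omega>))" if "1 \<le> y" for y
      by (rule cond[OF P that])
    show "AE \<omega> in M. ((\<lambda>y. real (num_nodes_with P (That y \<omega>)) / real (card (That y \<omega>)))
        \<longlongrightarrow> \<P>(\<omega>' in M. Tbar \<omega>' \<in> P)) at_top"
      by (rule lim[OF P])
    show "\<P>(\<omega> in M. Tbar \<omega> \<in> P) = (LBINT t:{0..}. exp (- t) * \<P>(\<omega> in M. That (exp t) \<omega> \<in> P))"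
      by (rule int(1)[OF P])
    show "(LBINT t:{0..}. exp (- t) * \<P>(\<omega> in M. That (exp t) \<omega> \<in> P))
        = (\<integral>\<omega>. (LBINT t:{0..}. exp (- t) * indicat_real P (That (exp t) \<omega>)) \<partial>M)"
      by (rule int(2)[OF P])
  qed
qed

end
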